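(* Consider the SSBM described in the context, with parameters $n,k,p,\eta$ and clusters $C_1,\dots,C_k$. Assume $n \ge \max\left\{\frac{2(1-\eta)}{s(1-2\eta)},\ \frac{2\eta}{(1-l)(1-\eta)}\right\}$, and let $\tau^+>0$, $\tau^-\ge 0$ satisfy $$\tau^+ > \frac{16\eta}{\beta s(1-2\eta)},\qquad \tau^- < \frac{\beta}{2}\left(\frac{s(1-2\eta)}{s(1-2\eta)+2\eta}\right)\min\left\{\frac{1}{4(1-\beta)},\ \frac{\tau^+}{8}\right\},$$ where $\beta,\eta$ satisfy one of: (1) $\beta=\frac{4\eta}{s(1-2\eta)+4\eta}$ and $0<\eta<\frac12$; or (2) $\beta=\frac12$ and $\eta\le \frac{s}{2s+4}$. Then there is a $k\times k$ rotation matrix $R$ such that $V_k(\bar T)=\Theta R$ and $G_k(\bar T)=\Theta (C^-)^{-1/2}R$, where $C^-\succ 0$. Moreover, for any $\epsilon,\delta\in(0,1)$ there exists a constant $\widetilde c_\epsilon>0$ such that if $$p\ \ge\ \max\left\{\widetilde c_\epsilon C_2(s,\eta,l),\ \frac{256\,C_1^4(\tau^+,\tau^-)(2+\tau^+)^4}{\delta^4(1+\tau^-)^4(1-\beta)^4}C_2(s,\eta,l),\ \frac{81}{(1-l)\delta^4}\right\}\frac{\ln(4n/\epsilon)}{n},$$ then with probability at least $1-2\epsilon$ there exists an orthogonal matrix $O\in\mathbb R^{k\times k}$ such that $$\|V_k(T)-V_k(\bar T)O\|\le\delta\qquad\text{and}\qquad \|G_k(T)-G_k(\bar T)O\|\le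 \frac{\delta}{\sqrt{\tau^+}}+\frac{\delta}{(\tau^+)^2}.$$
   Context: SSBM: fix integers $n\ge2$, $k\ge2$, $p\in(0,1]$, $\eta\in[0,1/2)$ and a partition of $[n]$ into nonempty clusters $C_1,\dots,C_k$ with $|C_i|=n_i$. Independently for each unordered pair $\{j,j'\}$, $j\ne j'$, an edge is present with probability $p$; a present edge gets sign $+1$ if $j,j'$ lie in the same cluster and $-1$ otherwise, and then independently its sign is flipped with probability $\eta$. $A\in\{0,\pm1\}^{n\times n}$ is the symmetric signed adjacency matrix (zero diagonal, zero for absent edges), $A^+=\max(A,0)$, $A^-=\max(-A,0)$ entrywise, $D^\pm=\mathrm{diag}(A^\pm\mathbf 1)$. Let $s=\min_i n_i/n$, $l=\max_i n_i/n$. $\Theta\in\mathbb R^{n\times k}$ has $\Theta_{ji}=1/\sqrt{n_i}$ if $j\in C_i$ and $0$ otherwise. For symmetric $M$, $V_k(M)$ is an $n\times k$ matrix whose columns are orthonormal eigenvectors for the $k$ smallest eigenvalues of $M$; $\|\cdot\|$ is the spectral norm. SPONGE$_{sym}$ operators: $L^\pm_{sym}=I-(D^\pm)^{-1/2}A^\pm(D^\pm)^{-1/2}$, $\overline{L^\pm_{sym}}=I-(\mathbb E D^\pm)^{-1/2}\mathbb E[A^\pm](\mathbb E D^\pm)^{-1/2}$, $T=(L^-_{sym}+\tau^+I)^{-1/2}(L^+_{sym}+\tau^-I)(L^-_{sym}+\tau^+I)^{-1/2}$, $\bar T=(\overline{L^-_{sym}}+\tau^+I)^{-1/2}(\overline{L^+_{sym}}+\tau^-I)(\overline{L^-_{sym}}+\tau^+I)^{-1/2}$,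 $G_k(T)=(L^-_{sym}+\tau^+I)^{-1/2}V_k(T)$, $G_k(\bar T)=(\overline{L^-_{sym}}+\tau^+I)^{-1/2}V_k(\bar T)$. For $i\in[k]$, $d_i^-=p(n(1-\eta)-n_i(1-2\eta)-\eta)$, $u^-=(\sqrt{n_1/d_1^-},\dots,\sqrt{n_k/d_k^-})^\top$, and $C^-=-p(1-\eta)u^-(u^-)^\top+\mathrm{diag}_i\big(1+\tau^++\frac{p}{d_i^-}(\eta+n_i(1-2\eta))\big)$. Constants: $C_1(\tau^+,\tau^-)=3\frac{(3+\tau^-)(2\sqrt{\tau^+}+1)+\tau^+}{(\tau^+)^2}$, $C_2(s,\eta,l)=\max\left\{\frac{1}{s(1-2\eta)+2\eta},\frac{2}{1-l}\right\}$. *)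

theory Defs
  imports "HOL-Probability.Product_PMF" "Jordan_Normal_Form.Matrix"
begin

definition vnorm :: "real vec \<Rightarrow> real" where
  "vnorm x = sqrt (x \<bullet> x)"

definition spec_norm :: "real mat \<Rightarrow> real" where
  "spec_norm M = Sup {vnorm (M *\<^sub>v x) | x. x \<in> carrier_vec (dim_col M) \<and> vnorm x \<le> 1}"

definition orth_mat :: "nat \<Rightarrow> real mat \<Rightarrow> bool" where
  "orth_mat k Q \<longleftrightarrow> Q \<in> carrier_mat k k \<and> transpose_mat Q * Q = 1\<^sub>m k"

definition sym_mat :: "real mat \<Rightarrow> bool" where
  "sym_mat M \<longleftrightarrow> transpose_mat M = M"

definition pos_def_mat :: "nat \<Rightarrow> real mat \<Rightarrow> bool" where
  "pos_def_mat n M \<longleftrightarrow> M \<in> carrier_mat n n \<and> sym_mat M \<and>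
     (\<forall>x \<in> carrier_vec n. x \<noteq> 0\<^sub>v n \<longrightarrow> x \<bullet> (M *\<^sub>v x) > 0)"

definition inv_sqrt_mat :: "real mat \<Rightarrow> real mat" where
  "inv_sqrt_mat M = (THE S. pos_def_mat (dim_row M) S \<and> S * S * M = 1\<^sub>m (dim_row M))"

text \<open>\<open>is_Vk M k V\<close>: \<open>V\<close> is an admissible choice of \<open>V_k(M)\<close>, i.e. an \<open>n\<times>k\<close> matrix whose
  columns are orthonormal eigenvectors of the symmetric \<open>n\<times>n\<close> matrix \<open>M\<close> for its \<open>k\<close> smallest
  eigenvalues (counted with multiplicity): the columns are orthonormal eigenvectors with
  eigenvalues \<open>lam 0, ..., lam (k-1)\<close>, and every eigenvalue of \<open>M\<close> with an eigenvector
  orthogonal to all columns of \<open>V\<close> is at least every \<open>lam i\<close>.\<close>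
definition is_Vk :: "real mat \<Rightarrow> nat \<Rightarrow> real mat \<Rightarrow> bool" where
  "is_Vk M k V \<longleftrightarrow> (let n = dim_row M in
     V \<in> carrier_mat n k \<and> transpose_mat V * V = 1\<^sub>m k \<and>
     (\<exists>lam :: nat \<Rightarrow> real.
        (\<forall>i<k. M *\<^sub>v col V i = lam i \<cdot>\<^sub>v col V i) \<and>
        (\<forall>x \<in> carrier_vec n. \<forall>mu. x \<noteq> 0\<^sub>v n \<longrightarrow> M *\<^sub>v x = mu \<cdot>\<^sub>v x \<longrightarrow>
             (\<forall>i<k. x \<bullet> col V i = 0) \<longrightarrow> (\<forall>i<k. lam i \<le> mu))))"

text \<open>Vertices are \<open>0..<n\<close>, clusters are \<open>0..<k\<close>; \<open>cl j\<close> is the cluster of vertex \<open>j\<close>.\<close>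
definition valid_partition :: "nat \<Rightarrow> nat \<Rightarrow> (nat \<Rightarrow> nat) \<Rightarrow> bool" where
  "valid_partition n k cl \<longleftrightarrow> (\<forall>j<n. cl j < k) \<and> (\<forall>i<k. \<exists>j<n. cl j = i)"

definition csize :: "nat \<Rightarrow> (nat \<Rightarrow> nat) \<Rightarrow> nat \<Rightarrow> nat" where
  "csize n cl i = card {j. j < n \<and> cl j = i}"

definition smin :: "nat \<Rightarrow> nat \<Rightarrow> (nat \<Rightarrow> nat) \<Rightarrow> real" where
  "smin n k cl = Min ((\<lambda>i. real (csize n cl i) / real n) ` {0..<k})"

definition lmax :: "nat \<Rightarrow> nat \<Rightarrow> (nat \<Rightarrow> nat) \<Rightarrow> real" where
  "lmax n k cl = Max ((\<lambda>i. real (csize n cl i) / real n) ` {0..<k})"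

definition edge_pmf :: "real \<Rightarrow> real \<Rightarrow> bool \<Rightarrow> real pmf" where
  "edge_pmf p \<eta> same =
     do { e \<leftarrow> bernoulli_pmf p; f \<leftarrow> bernoulli_pmf \<eta>;
          return_pmf (if e then (if same then 1 else -1) * (if f then -1 else 1) else 0) }"

definition ssbm_pmf :: "nat \<Rightarrow> (nat \<Rightarrow> nat) \<Rightarrow> real \<Rightarrow> real \<Rightarrow> real mat pmf" where
  "ssbm_pmf n cl p \<eta> =
     map_pmf (\<lambda>X. Matrix.mat n n (\<lambda>(i,j). if i < j then X (i,j) else if j < i then X (j,i) else 0))
       (Pi_pmf {(i,j). i < j \<and> j < n} 0 (\<lambda>(i,j). edge_pmf p \<eta> (cl i = cl j)))"

definition pos_part :: "real mat \<Rightarrow> real mat" where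
  "pos_part A = map_mat (\<lambda>x. max x 0) A"

definition neg_part :: "real mat \<Rightarrow> real mat" where
  "neg_part A = map_mat (\<lambda>x. max (- x) 0) A"

definition exp_mat :: "nat \<Rightarrow> real mat pmf \<Rightarrow> (real mat \<Rightarrow> real mat) \<Rightarrow> real mat" where
  "exp_mat n P f = Matrix.mat n n (\<lambda>ij. measure_pmf.expectation P (\<lambda>A. f A $$ ij))"

definition deg_mat :: "real mat \<Rightarrow> real mat" where
  "deg_mat B = mat_diag (dim_row B) (\<lambda>j. \<Sum>j'<dim_col B. B $$ (j,j'))"

text \<open>\<open>D^{-1/2}\<close> for a diagonal degree matrix; a zero degree yields a zero entry
  (pseudo-inverse convention, since \<open>1/0 = 0\<close>).\<close>
definition diag_inv_sqrt :: "real mat \<Rightarrow> real mat" where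
  "diag_inv_sqrt D = mat_diag (dim_row D) (\<lambda>j. 1 / sqrt (D $$ (j,j)))"

definition lap_sym :: "real mat \<Rightarrow> real mat \<Rightarrow> real mat" where
  "lap_sym D B = 1\<^sub>m (dim_row B) - diag_inv_sqrt D * B * diag_inv_sqrt D"

definition Lsym_pos :: "real mat \<Rightarrow> real mat" where
  "Lsym_pos A = lap_sym (deg_mat (pos_part A)) (pos_part A)"

definition Lsym_neg :: "real mat \<Rightarrow> real mat" where
  "Lsym_neg A = lap_sym (deg_mat (neg_part A)) (neg_part A)"

definition Lbar_pos :: "nat \<Rightarrow> (nat \<Rightarrow> nat) \<Rightarrow> real \<Rightarrow> real \<Rightarrow> real mat" where
  "Lbar_pos n cl p \<eta> = lap_sym (exp_mat n (ssbm_pmf n cl p \<eta>) (\<lambda>A. deg_mat (pos_part A)))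
                               (exp_mat n (ssbm_pmf n cl p \<eta>) pos_part)"

definition Lbar_neg :: "nat \<Rightarrow> (nat \<Rightarrow> nat) \<Rightarrow> real \<Rightarrow> real \<Rightarrow> real mat" where
  "Lbar_neg n cl p \<eta> = lap_sym (exp_mat n (ssbm_pmf n cl p \<eta>) (\<lambda>A. deg_mat (neg_part A)))
                               (exp_mat n (ssbm_pmf n cl p \<eta>) neg_part)"

definition sponge_op :: "real mat \<Rightarrow> real mat \<Rightarrow> real \<Rightarrow> real \<Rightarrow> real mat" where
  "sponge_op Lpos Lneg taup taum =
     (let n = dim_row Lpos; S = inv_sqrt_mat (Lneg + taup \<cdot>\<^sub>m 1\<^sub>m n)
      in S * (Lpos + taum \<cdot>\<^sub>m 1\<^sub>m n) * S)"

definition Gk :: "real mat \<Rightarrow> real \<Rightarrow> real mat \<Rightarrow> real mat" where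
  "Gk Lneg taup V = inv_sqrt_mat (Lneg + taup \<cdot>\<^sub>m 1\<^sub>m (dim_row Lneg)) * V"

definition Theta :: "nat \<Rightarrow> nat \<Rightarrow> (nat \<Rightarrow> nat) \<Rightarrow> real mat" where
  "Theta n k cl = Matrix.mat n k (\<lambda>(j,i). if cl j = i then 1 / sqrt (real (csize n cl i)) else 0)"

definition dminus :: "nat \<Rightarrow> (nat \<Rightarrow> nat) \<Rightarrow> real \<Rightarrow> real \<Rightarrow> nat \<Rightarrow> real" where
  "dminus n cl p \<eta> i = p * (real n * (1 - \<eta>) - real (csize n cl i) * (1 - 2*\<eta>) - \<eta>)"

definition Cminus :: "nat \<Rightarrow> nat \<Rightarrow> (nat \<Rightarrow> nat) \<Rightarrow> real \<Rightarrow> real \<Rightarrow> real \<Rightarrow> real mat" where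
  "Cminus n k cl p \<eta> taup = Matrix.mat k k (\<lambda>(i,i').
     - p * (1 - \<eta>) * sqrt (real (csize n cl i) / dminus n cl p \<eta> i)
                   * sqrt (real (csize n cl i') / dminus n cl p \<eta> i')
     + (if i = i' then 1 + taup + p / dminus n cl p \<eta> i * (\<eta> + real (csize n cl i) * (1 - 2*\<eta>))
        else 0))"

definition C1 :: "real \<Rightarrow> real \<Rightarrow> real" where
  "C1 taup taum = 3 * ((3 + taum) * (2 * sqrt taup + 1) + taup) / taup ^ 2"

definition C2 :: "real \<Rightarrow> real \<Rightarrow> real \<Rightarrow> real" where
  "C2 s \<eta> l = max (1 / (s * (1 - 2*\<eta>) + 2*\<eta>)) (2 / (1 - l))"

definition sponge_hyps :: "nat \<Rightarrow> nat \<Rightarrow> (nat \<Rightarrow> nat) \<Rightarrow> real \<Rightarrow> real \<Rightarrow> real \<Rightarrow> real \<Rightarrow> real \<Rightarrow> bool" where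
  "sponge_hyps n k cl p \<eta> taup taum \<beta> \<longleftrightarrow>
     (let s0 = smin n k cl; l0 = lmax n k cl in
      2 \<le> n \<and> 2 \<le> k \<and> 0 < p \<and> p \<le> 1 \<and> 0 \<le> \<eta> \<and> \<eta> < 1/2 \<and> valid_partition n k cl \<and>
      real n \<ge> max (2 * (1 - \<eta>) / (s0 * (1 - 2*\<eta>))) (2 * \<eta> / ((1 - l0) * (1 - \<eta>))) \<and>
      0 < taup \<and> 0 \<le> taum \<and>
      taup > 16 * \<eta> / (\<beta> * s0 * (1 - 2*\<eta>)) \<and>
      taum < \<beta> / 2 * (s0 * (1 - 2*\<eta>) / (s0 * (1 - 2*\<eta>) + 2*\<eta>))
               * min (1 / (4 * (1 - \<beta>))) (taup / 8) \<and>
      ((\<beta> = 4*\<eta> / (s0 * (1 - 2*\<eta>) + 4*\<eta>) \<and> 0 < \<eta> \<and> \<eta> < 1/2) \<or>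
       (\<beta> = 1/2 \<and> \<eta> \<le> s0 / (2* s0 + 4))))"

end

theory Submission
  imports Defs "Jordan_Normal_Form.Determinant"
begin

text \<open>
  The population Laplacians are constant on cluster blocks, so they preserve the range of
  \<open>\<Theta>\<close> and its orthogonal complement. With \<open>z = S y\<close>, where \<open>S\<close> is the inverse square root of
  \<open>M\<^sup>- = L\<^sup>- + \<tau>\<^sup>+ I\<close>, the Rayleigh quotient of \<open>T\<close> at \<open>y\<close> is the quotient of the forms
  of \<open>L\<^sup>+ + \<tau>\<^sup>- I\<close> and \<open>M\<^sup>-\<close> at \<open>z\<close>. It is less than \<open>\<beta> \<mu>\<close> on the range of \<open>\<Theta>\<close> and at
  least \<open>\<mu> = (1 + \<tau>\<^sup>-) / (2 + \<tau>\<^sup>+)\<close> on the complement; the bottom eigenspace is therefore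
  the range of \<open>\<Theta>\<close>, with gap at least \<open>(1 - \<beta>) \<mu>\<close>.

  For the random part, \<open>X = D\<^sup>-\<^sup>1\<^sup>/\<^sup>2 (A - E A) D\<^sup>-\<^sup>1\<^sup>/\<^sup>2\<close> is controlled by its trace moments. Resampling
  one edge at a time and using
  \<open>tr ((X - Y) (X\<^sup>r\<^sup>+\<^sup>1 - Y\<^sup>r\<^sup>+\<^sup>1)) \<le> (r + 1) / 2 * tr ((X - Y)\<^sup>2 (X\<^sup>r + Y\<^sup>r))\<close> for even \<open>r\<close> bounds
  \<open>E tr X\<^sup>2\<^sup>m\<close> by \<open>m\<^sup>m E tr V\<^sup>m\<close>, where \<open>V\<close> is a diagonal matrix that only involves degrees.
  Markov's inequality with \<open>m\<close> of order \<open>ln (4 n / \<epsilon>)\<close>, together with Chernoff bounds for the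
  degrees, bounds the distance of both Laplacians from their population versions by \<open>20 / sqrt \<rho>\<close> with \<open>\<rho> = n p / (C\<^sub>2 ln (4 n / \<epsilon>))\<close>. A Davis-Kahan
  argument transfers this to the eigenvectors. The inverse square root is Lipschitz on matrices
  bounded below by \<open>\<tau>\<^sup>+\<close>, so one only needs \<open>sqrt \<rho>\<close> to be a large multiple of
  \<open>y = 4 C\<^sub>1 / (\<delta> (1 - \<beta>) \<mu>)\<close>; this follows from \<open>\<rho> \<ge> c\<close> and \<open>\<rho> \<ge> y\<^sup>4\<close> with \<open>c = 10\<^sup>8\<close>.
\<close>

unbundle no inner_syntax and no vec_syntax

section \<open>The spectral theorem for real symmetric matrices\<close>

text \<open>Matrix Chernoff bounds usually rest on trace-exponential inequalities such as
  Golden-Thompson or Lieb; moments with one-edge resampling need only the spectral theorem and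
  scalar inequalities. This works because one edge changes the matrix by a symmetric two-entry
  matrix whose square is diagonal, so the variance proxy stays diagonal and its powers are powers of
  degrees. Entries are independent only under a deterministic normalisation. The random matrix is
  therefore first normalised by expected degrees, and a separate reweighting, governed by the
  relative degree errors, passes to the observed degrees. \<open>V_k\<close> is a relation, since
  eigenvalues may coincide: nothing sorts eigenvalues, and the results hold for every admissible
  choice. The population eigenvectors come from the perturbation bound itself, with perturbation
  zero. The constant \<open>10 ^ 8\<close> does not depend on \<open>\<epsilon>\<close>, which
  enters only through the logarithm.\<close>

lemma vnorm_sq: "(vnorm x)\<^sup>2 = x \<bullet> x"
proof -
  have "x \<bullet> x \<ge> 0" by (auto simp: scalar_prod_def intro!: sum_nonneg)
  thus ?thesis by (simp add: vnorm_def)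
qed

lemma vnorm_nonneg [simp]: "0 \<le> vnorm x"
proof -
  have "x \<bullet> x \<ge> 0" by (auto simp: scalar_prod_def intro!: sum_nonneg)
  thus ?thesis by (simp add: vnorm_def)
qed

lemma self_scalar_prod_nonneg [simp]: "0 \<le> (x :: real vec) \<bullet> x"
  by (metis vnorm_sq zero_le_power2)

lemma vnorm_L2_set: "x \<in> carrier_vec n \<Longrightarrow> vnorm x = L2_set (\<lambda>i. x $ i) {0..<n}"
  by (auto simp: vnorm_def L2_set_def scalar_prod_def power2_eq_square)

lemma self_scalar_prod_eq_0:
  "(x :: real vec) \<in> carrier_vec n \<Longrightarrow> x \<bullet> x = 0 \<longleftrightarrow> x = 0\<^sub>v n"
  by (auto simp: scalar_prod_def sum_nonneg_eq_0_iff intro!: eq_vecI)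

lemma vnorm_eq_0: "x \<in> carrier_vec n \<Longrightarrow> vnorm x = 0 \<longleftrightarrow> x = 0\<^sub>v n"
  using self_scalar_prod_eq_0[of x n] by (simp add: vnorm_def)

lemma vnorm_zero [simp]: "vnorm (0\<^sub>v n) = 0"
  by (simp add: vnorm_def)

lemma abs_scalar_prod_le:
  assumes "x \<in> carrier_vec n" "y \<in> carrier_vec n"
  shows "\<bar>x \<bullet> y\<bar> \<le> vnorm x * vnorm y"
proof -
  have "\<bar>x \<bullet> y\<bar> \<le> (\<Sum>i = 0..<n. \<bar>x $ i\<bar> * \<bar>y $ i\<bar>)"
    using assms by (auto simp: scalar_prod_def abs_mult[symmetric] intro!: sum_abs)
  also have "\<dots> \<le> vnorm x * vnorm y"
    using L2_set_mult_ineq[of "\<lambda>i. x $ i" "\<lambda>i. y $ i" "{0..<n}"] assms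
    by (simp add: vnorm_L2_set)
  finally show ?thesis .
qed

lemma vnorm_add_le:
  assumes "x \<in> carrier_vec n" "y \<in> carrier_vec n"
  shows "vnorm (x + y) \<le> vnorm x + vnorm y"
proof -
  have "vnorm (x + y) = L2_set (\<lambda>i. x $ i + y $ i) {0..<n}"
    using assms by (auto simp: vnorm_L2_set[of "x + y" n] intro!: L2_set_cong)
  thus ?thesis using L2_set_triangle_ineq[of "\<lambda>i. x $ i" "\<lambda>i. y $ i" "{0..<n}"] assms
    by (simp add: vnorm_L2_set)
qed

lemma vnorm_smult: "vnorm (a \<cdot>\<^sub>v x) = \<bar>a\<bar> * vnorm x"
proof -
  have "(a \<cdot>\<^sub>v x) \<bullet> (a \<cdot>\<^sub>v x) = a\<^sup>2 * (x \<bullet> x)"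
    by (simp add: scalar_prod_def sum_distrib_left power2_eq_square mult_ac)
  thus ?thesis by (simp add: vnorm_def real_sqrt_mult)
qed

lemma vnorm_diff_le:
  assumes "x \<in> carrier_vec n" "y \<in> carrier_vec n"
  shows "vnorm (x - y) \<le> vnorm x + vnorm y"
proof -
  have "x - y = x + (-1) \<cdot>\<^sub>v y" using assms by auto
  thus ?thesis using vnorm_add_le[of x n "(-1) \<cdot>\<^sub>v y"] assms by (simp add: vnorm_smult)
qed

lemma scalar_prod_mult_mat:
  assumes "(A :: real mat) \<in> carrier_mat m n" "x \<in> carrier_vec n" "y \<in> carrier_vec m"
  shows "y \<bullet> (A *\<^sub>v x) = (A\<^sup>T *\<^sub>v y) \<bullet> x"
  using transpose_vec_mult_scalar[OF assms] by simp

lemma sym_mat_scalar_prod: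
  assumes "A \<in> carrier_mat n n" "sym_mat A" "x \<in> carrier_vec n" "y \<in> carrier_vec n"
  shows "y \<bullet> (A *\<^sub>v x) = (A *\<^sub>v y) \<bullet> x"
  using scalar_prod_mult_mat[OF assms(1,3,4)] assms(2) by (simp add: sym_mat_def)

lemma form_eq_sum:
  assumes "(A :: real mat) \<in> carrier_mat n n" "x \<in> carrier_vec n" "y \<in> carrier_vec n"
  shows "y \<bullet> (A *\<^sub>v x) = (\<Sum>i = 0..<n. \<Sum>j = 0..<n. A $$ (i,j) * y $ i * x $ j)"
  using assms by (auto simp: scalar_prod_def sum_distrib_left mult_ac intro!: sum.cong)

text \<open>The rows of \<open>B\<close> are padded with zero rows to a square matrix. Since
  \<open>r < n\<close>, the row of index \<open>n - 1\<close> belongs to the padding, so the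
  determinant vanishes and the kernel is nontrivial.\<close>

lemma ex_orthogonal_vec:
  assumes "(B :: real mat) \<in> carrier_mat r n" "r < n"
  obtains x where "x \<in> carrier_vec n" "x \<noteq> 0\<^sub>v n" "B *\<^sub>v x = 0\<^sub>v r"
proof -
  define C where "C = mat\<^sub>r n n (\<lambda>i. if i = n - 1 then 0\<^sub>v n else if i < r then row B i else 0\<^sub>v n)"
  have C: "C \<in> carrier_mat n n" by (auto simp: C_def)
  have "det C = 0" unfolding C_def
    by (rule det_row_0) (use assms in auto)
  then obtain x where x: "x \<in> carrier_vec n" "x \<noteq> 0\<^sub>v n" "C *\<^sub>v x = 0\<^sub>v n"
    using det_0_iff_vec_prod_zero_field[OF C] by auto
  have "B *\<^sub>v x = 0\<^sub>v r"
  proof (rule eq_vecI)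
    fix i assume i: "i < dim_vec (0\<^sub>v r :: real vec)"
    have "(C *\<^sub>v x) $ i = row B i \<bullet> x" using i assms by (auto simp: C_def)
    thus "(B *\<^sub>v x) $ i = 0\<^sub>v r $ i" using i assms x by auto
  qed (use assms in auto)
  thus ?thesis using x that by auto
qed

text \<open>Compactness gives a constrained minimiser of the Rayleigh quotient. Vectors are viewed
  as functions on all of \<open>nat\<close>, zero from \<open>n\<close> on, so that the product
  topology applies.\<close>

lemma ex_min_form:
  fixes A :: "real mat" and W :: "real vec set"
  assumes A: "A \<in> carrier_mat n n" and W: "W \<subseteq> carrier_vec n"
    and x0: "x0 \<in> carrier_vec n" "x0 \<noteq> 0\<^sub>v n" "\<And>w. w \<in> W \<Longrightarrow> w \<bullet> x0 = 0"
  obtains x where "x \<in> carrier_vec n" "x \<bullet> x = 1" "\<And>w. w \<in> W \<Longrightarrow> w \<bullet> x = 0"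
    "\<And>y. y \<in> carrier_vec n \<Longrightarrow> (\<And>w. w \<in> W \<Longrightarrow> w \<bullet> y = 0) \<Longrightarrow> (x \<bullet> (A *\<^sub>v x)) * (y \<bullet> y) \<le> y \<bullet> (A *\<^sub>v y)"
proof -
  define f where "f = (\<lambda>x :: nat \<Rightarrow> real. \<Sum>i = 0..<n. \<Sum>j = 0..<n. A $$ (i,j) * x i * x j)"
  define S where "S = {x :: nat \<Rightarrow> real. (\<Sum>i = 0..<n. x i * x i) = 1} \<inter>
     (\<Inter>w\<in>W. {x. (\<Sum>i = 0..<n. w $ i * x i) = 0})"
  \<comment> \<open>The factor \<open>{0}\<close> from index \<open>n\<close> on makes every element
    of \<open>K\<close> the zero extension of a vector; the cube contains all unit vectors, and a
    product of compact sets is compact.\<close>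
  define K where "K = (\<Pi>\<^sub>E i\<in>UNIV. if i < n then {-1..1::real} else {0})"
  have cont: "continuous_on UNIV (\<lambda>x :: nat \<Rightarrow> real. x i)" for i
    by (rule continuous_on_product_coordinates)
  have "closed S" unfolding S_def
    by (intro closed_Int closed_INT ballI closed_Collect_eq continuous_intros cont)
  moreover have "compact K"
    unfolding K_def compactin_euclidean_iff[symmetric] euclidean_product_topology[symmetric] compactin_PiE by auto
  ultimately have comp: "compact (S \<inter> K)" by (simp add: closed_Int_compact)
  have fun_vec: "f (\<lambda>i. if i < n then y $ i else 0) = y \<bullet> (A *\<^sub>v y)" if "y \<in> carrier_vec n" for y
    using that form_eq_sum[OF A that that] by (auto simp: f_def intro!: sum.cong)
  have mem: "(\<lambda>i. if i < n then y $ i else 0) \<in> S \<inter> K"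
    if y: "y \<in> carrier_vec n" "y \<bullet> y = 1" "\<And>w. w \<in> W \<Longrightarrow> w \<bullet> y = 0" for y
  proof -
    have "\<bar>y $ i\<bar> \<le> 1" if "i < n" for i
    proof -
      have "(y $ i)\<^sup>2 \<le> (\<Sum>j = 0..<n. (y $ j)\<^sup>2)" using that by (intro member_le_sum) auto
      also have "\<dots> = 1" using y by (simp add: scalar_prod_def power2_eq_square)
      finally show ?thesis by (simp add: abs_square_le_1)
    qed
    hence "y $ i \<le> 1" "- 1 \<le> y $ i" if "i < n" for i using that by (auto simp: abs_le_iff)
    moreover have "(\<Sum>i = 0..<n. w $ i * (if i < n then y $ i else 0)) = w \<bullet> y" for w
      using y by (auto simp: scalar_prod_def)
    moreover have "(\<Sum>i = 0..<n. (if i < n then y $ i else 0) * (if i < n then y $ i else 0)) = y \<bullet> y"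
      using y by (auto simp: scalar_prod_def)
    ultimately show ?thesis using y by (auto simp: S_def K_def PiE_iff)
  qed
  have norm: "y \<bullet> y = 1 \<and> (\<forall>w\<in>W. w \<bullet> y = 0) \<and> y \<in> carrier_vec n"
    if "z \<in> carrier_vec n" "z \<noteq> 0\<^sub>v n" "\<And>w. w \<in> W \<Longrightarrow> w \<bullet> z = 0" "y = (1 / vnorm z) \<cdot>\<^sub>v z" for y z
  proof -
    have "z \<bullet> z > 0" using that self_scalar_prod_eq_0[of z n] self_scalar_prod_nonneg[of z] by linarith
    moreover have "w \<bullet> y = 0" if "w \<in> W" for w
      using that W \<open>y = _\<close> \<open>z \<in> _\<close> \<open>\<And>w. w \<in> W \<Longrightarrow> w \<bullet> z = 0\<close> by auto
    ultimately show ?thesis using that by (auto simp: vnorm_def)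
  qed
  have ne: "S \<inter> K \<noteq> {}" using mem norm[OF x0 refl] by blast
  have "continuous_on (S \<inter> K) f" unfolding f_def
    by (intro continuous_intros continuous_on_subset[OF cont]) auto
  from continuous_attains_inf[OF comp ne this] obtain g where
    g: "g \<in> S \<inter> K" "\<And>h. h \<in> S \<inter> K \<Longrightarrow> f g \<le> f h" by blast
  define x where "x = vec n g"
  have gx: "g = (\<lambda>i. if i < n then x $ i else 0)"
    using g(1) by (fastforce simp: K_def PiE_iff x_def fun_eq_iff split: if_splits)
  have x: "x \<in> carrier_vec n" "x \<bullet> x = 1" "\<And>w. w \<in> W \<Longrightarrow> w \<bullet> x = 0"
    using g by (auto simp: x_def S_def scalar_prod_def)
  have fg: "f g = x \<bullet> (A *\<^sub>v x)" using fun_vec[OF x(1)] gx by simp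
  have "(x \<bullet> (A *\<^sub>v x)) * (y \<bullet> y) \<le> y \<bullet> (A *\<^sub>v y)"
    if y: "y \<in> carrier_vec n" "\<And>w. w \<in> W \<Longrightarrow> w \<bullet> y = 0" for y
  proof (cases "y = 0\<^sub>v n")
    case True thus ?thesis using A by simp
  next
    case False
    define z where "z = (1 / vnorm y) \<cdot>\<^sub>v y"
    have z: "z \<in> carrier_vec n" "z \<bullet> z = 1" "\<And>w. w \<in> W \<Longrightarrow> w \<bullet> z = 0"
      using norm[OF y(1) False y(2) z_def] by auto
    have yz: "y = vnorm y \<cdot>\<^sub>v z" using False y vnorm_eq_0[OF y(1)] by (auto simp: z_def)
    have "x \<bullet> (A *\<^sub>v x) \<le> z \<bullet> (A *\<^sub>v z)" using g(2)[OF mem[OF z]] fun_vec[OF z(1)] fg by simp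
    hence "(x \<bullet> (A *\<^sub>v x)) * (vnorm y)\<^sup>2 \<le> (z \<bullet> (A *\<^sub>v z)) * (vnorm y)\<^sup>2" by (intro mult_right_mono) auto
    also have "\<dots> = y \<bullet> (A *\<^sub>v y)"
      using A z by (subst (2 3) yz) (simp add: mult_mat_vec[OF A] power2_eq_square)
    finally show ?thesis by (simp add: vnorm_sq)
  qed
  thus ?thesis using that x by blast
qed

lemma form_add_smult:
  assumes A: "A \<in> carrier_mat n n" "sym_mat A" and x: "x \<in> carrier_vec n" and z: "z \<in> carrier_vec n"
  shows "(x + t \<cdot>\<^sub>v z) \<bullet> (A *\<^sub>v (x + t \<cdot>\<^sub>v z)) =
    x \<bullet> (A *\<^sub>v x) + 2 * t * (z \<bullet> (A *\<^sub>v x)) + t\<^sup>2 * (z \<bullet> (A *\<^sub>v z))"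
proof -
  have c: "A *\<^sub>v x \<in> carrier_vec n" "A *\<^sub>v z \<in> carrier_vec n" using A x z by auto
  have 1: "A *\<^sub>v (x + t \<cdot>\<^sub>v z) = A *\<^sub>v x + t \<cdot>\<^sub>v (A *\<^sub>v z)"
    using A x z by (simp add: mult_add_distrib_mat_vec[of _ n n] mult_mat_vec[of _ n n])
  have 2: "x \<bullet> (A *\<^sub>v z) = z \<bullet> (A *\<^sub>v x)"
    using sym_mat_scalar_prod[OF A z x] comm_scalar_prod[OF c(1) z] by simp
  show ?thesis unfolding 1 using x z c 2
    by (simp add: scalar_prod_add_distrib[of _ n] add_scalar_prod_distrib[of _ n] algebra_simps power2_eq_square)
qed

text \<open>First-order condition: the residual \<open>z = A x - \<mu> x\<close> is itself an
  admissible direction, because \<open>inv\<close> keeps \<open>A x\<close> orthogonal to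
  \<open>W\<close>. Minimality along \<open>x + t z\<close> makes \<open>2 t q + t\<^sup>2 g\<close>
  nonnegative for every \<open>t\<close>, where \<open>q = z \<bullet> z\<close>, and this forces
  \<open>q = 0\<close>.\<close>

lemma min_form_is_eigenvector:
  fixes A :: "real mat"
  assumes A: "A \<in> carrier_mat n n" "sym_mat A" and W: "W \<subseteq> carrier_vec n"
    and inv: "\<And>y w. y \<in> carrier_vec n \<Longrightarrow> (\<And>w. w \<in> W \<Longrightarrow> w \<bullet> y = 0) \<Longrightarrow> w \<in> W \<Longrightarrow> w \<bullet> (A *\<^sub>v y) = 0"
    and x: "x \<in> carrier_vec n" "x \<bullet> x = 1" "\<And>w. w \<in> W \<Longrightarrow> w \<bullet> x = 0"
    and min: "\<And>y. y \<in> carrier_vec n \<Longrightarrow> (\<And>w. w \<in> W \<Longrightarrow> w \<bullet> y = 0) \<Longrightarrow> \<mu> * (y \<bullet> y) \<le> y \<bullet> (A *\<^sub>v y)"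
    and mu: "\<mu> = x \<bullet> (A *\<^sub>v x)"
  shows "A *\<^sub>v x = \<mu> \<cdot>\<^sub>v x"
proof -
  define z where "z = A *\<^sub>v x - \<mu> \<cdot>\<^sub>v x"
  have c: "z \<in> carrier_vec n" "A *\<^sub>v x \<in> carrier_vec n" using A x by (auto simp: z_def)
  have zW: "w \<bullet> z = 0" if "w \<in> W" for w
  proof -
    have "w \<in> carrier_vec n" using that W by auto
    thus ?thesis using inv[OF x(1) x(3) that] x(3)[OF that] c x
      by (simp add: z_def scalar_prod_minus_distrib[of _ n])
  qed
  define q where "q = z \<bullet> z"
  define g where "g = z \<bullet> (A *\<^sub>v z) - \<mu> * q"
  have g0: "g \<ge> 0" using min[OF c(1) zW] by (simp add: g_def q_def)
  have q: "z \<bullet> (A *\<^sub>v x) - \<mu> * (z \<bullet> x) = q"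
    unfolding q_def using c x by (subst (4) z_def) (simp add: scalar_prod_minus_distrib[of _ n])
  have ineq: "2 * t * q + t\<^sup>2 * g \<ge> 0" for t
  proof -
    let ?y = "x + t \<cdot>\<^sub>v z"
    have yW: "w \<bullet> ?y = 0" if "w \<in> W" for w
    proof -
      have "w \<in> carrier_vec n" using that W by auto
      thus ?thesis using zW[OF that] x(3)[OF that] c x by (simp add: scalar_prod_add_distrib[of _ n])
    qed
    have "?y \<bullet> ?y = x \<bullet> x + 2 * t * (z \<bullet> x) + t\<^sup>2 * (z \<bullet> z)"
      using form_add_smult[of "1\<^sub>m n" n x z t] x c by (simp add: sym_mat_def)
    hence "\<mu> * (x \<bullet> x + 2 * t * (z \<bullet> x) + t\<^sup>2 * (z \<bullet> z)) \<le> x \<bullet> (A *\<^sub>v x) + 2 * t * (z \<bullet> (A *\<^sub>v x)) + t\<^sup>2 * (z \<bullet> (A *\<^sub>v z))"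
      using min[OF _ yW] x c form_add_smult[OF A x(1) c(1), of t] by simp
    hence "0 \<le> 2 * t * (z \<bullet> (A *\<^sub>v x) - \<mu> * (z \<bullet> x)) + t\<^sup>2 * (z \<bullet> (A *\<^sub>v z) - \<mu> * (z \<bullet> z))"
      using x(2) mu by (simp add: algebra_simps)
    thus ?thesis unfolding q g_def q_def .
  qed
  have "q = 0"
  proof (rule ccontr)
    assume "q \<noteq> 0"
    hence "q > 0" using self_scalar_prod_nonneg[of z] unfolding q_def by linarith
    \<comment> \<open>The parabola has its minimum at \<open>- q / g\<close>; using
      \<open>g + 1\<close> avoids a zero denominator and still gives a negative value.\<close>
    have "2 * (- q / (g + 1)) * q + (- q / (g + 1))\<^sup>2 * g = - (q\<^sup>2 * (g + 2)) / (g + 1)\<^sup>2"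
      using g0 by (simp add: divide_simps power2_eq_square) (simp add: algebra_simps)
    moreover have "\<dots> < 0" using \<open>q > 0\<close> g0 by (intro divide_neg_pos) (auto intro!: mult_pos_pos)
    ultimately show False using ineq[of "- q / (g + 1)"] by linarith
  qed
  hence z0: "z = 0\<^sub>v n" using self_scalar_prod_eq_0[OF c(1)] by (simp add: q_def)
  show ?thesis
  proof (rule eq_vecI)
    fix i assume "i < dim_vec (\<mu> \<cdot>\<^sub>v x)"
    hence i: "i < n" using x by auto
    have "z $ i = (A *\<^sub>v x) $ i - \<mu> * x $ i" using i x c by (simp add: z_def)
    thus "(A *\<^sub>v x) $ i = (\<mu> \<cdot>\<^sub>v x) $ i" using z0 i x by simp
  qed (use A x in auto)
qed

text \<open>For symmetric \<open>A\<close> the orthogonal complement of a set of eigenvectors is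
  invariant, so the constrained minimiser is again an eigenvector. Its minimality stays in the
  conclusion for the eigenvalue comparison in \<open>form_ge_on_orthogonal\<close>.\<close>

lemma ex_min_eigenvector_orthogonal:
  fixes A :: "real mat"
  assumes A: "A \<in> carrier_mat n n" "sym_mat A" and W: "W \<subseteq> carrier_vec n"
    and eig: "\<And>w. w \<in> W \<Longrightarrow> \<exists>l. A *\<^sub>v w = l \<cdot>\<^sub>v w"
    and x0: "x0 \<in> carrier_vec n" "x0 \<noteq> 0\<^sub>v n" "\<And>w. w \<in> W \<Longrightarrow> w \<bullet> x0 = 0"
  obtains x \<mu> where "x \<in> carrier_vec n" "x \<bullet> x = 1" "\<And>w. w \<in> W \<Longrightarrow> w \<bullet> x = 0" "A *\<^sub>v x = \<mu> \<cdot>\<^sub>v x"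
    "\<And>y. y \<in> carrier_vec n \<Longrightarrow> (\<And>w. w \<in> W \<Longrightarrow> w \<bullet> y = 0) \<Longrightarrow> \<mu> * (y \<bullet> y) \<le> y \<bullet> (A *\<^sub>v y)"
proof -
  obtain x where x: "x \<in> carrier_vec n" "x \<bullet> x = 1" "\<And>w. w \<in> W \<Longrightarrow> w \<bullet> x = 0"
    "\<And>y. y \<in> carrier_vec n \<Longrightarrow> (\<And>w. w \<in> W \<Longrightarrow> w \<bullet> y = 0) \<Longrightarrow> (x \<bullet> (A *\<^sub>v x)) * (y \<bullet> y) \<le> y \<bullet> (A *\<^sub>v y)"
    using ex_min_form[OF A(1) W x0] by blast
  have "w \<bullet> (A *\<^sub>v y) = 0" if "y \<in> carrier_vec n" "\<And>w. w \<in> W \<Longrightarrow> w \<bullet> y = 0" and w: "w \<in> W" for y w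
  proof -
    obtain l where l: "A *\<^sub>v w = l \<cdot>\<^sub>v w" using eig[OF w] by auto
    have "w \<in> carrier_vec n" using W that by auto
    thus ?thesis using sym_mat_scalar_prod[OF A that(1), of w] l that by simp
  qed
  from min_form_is_eigenvector[OF A W this x refl] x show ?thesis using that by blast
qed

lemma ex_orthonormal_eigenvectors:
  fixes A :: "real mat"
  assumes A: "A \<in> carrier_mat n n" "sym_mat A" and "r \<le> n"
  shows "\<exists>u l. (\<forall>i<r. u i \<in> carrier_vec n \<and> A *\<^sub>v u i = l i \<cdot>\<^sub>v u i) \<and>
     (\<forall>i<r. \<forall>j<r. u i \<bullet> u j = (if i = j then 1 else 0))"
  using \<open>r \<le> n\<close>
proof (induction r)
  case (Suc r)
  obtain u l where ul: "(\<forall>i<r. u i \<in> carrier_vec n \<and> A *\<^sub>v u i = l i \<cdot>\<^sub>v u i) \<and>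
     (\<forall>i<r. \<forall>j<r. u i \<bullet> u j = (if i = j then 1 else 0 :: real))"
    using Suc.IH[OF Suc_leD[OF Suc.prems]] by (elim exE)
  hence u: "\<And>i. i < r \<Longrightarrow> u i \<in> carrier_vec n" "\<And>i. i < r \<Longrightarrow> A *\<^sub>v u i = l i \<cdot>\<^sub>v u i"
    "\<And>i j. i < r \<Longrightarrow> j < r \<Longrightarrow> u i \<bullet> u j = (if i = j then 1 else 0 :: real)"
    by simp_all
  obtain x0 where x0: "x0 \<in> carrier_vec n" "x0 \<noteq> 0\<^sub>v n" "mat\<^sub>r r n u *\<^sub>v x0 = 0\<^sub>v r"
    using ex_orthogonal_vec[of "mat\<^sub>r r n u" r n] Suc.prems by auto
  have "u i \<bullet> x0 = 0" if "i < r" for i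
  proof -
    have "(mat\<^sub>r r n u *\<^sub>v x0) $ i = 0" using x0 that by simp
    thus ?thesis using that u by simp
  qed
  hence orth: "w \<bullet> x0 = 0" if "w \<in> u ` {..<r}" for w using that by auto
  have "u ` {..<r} \<subseteq> carrier_vec n" "\<And>w. w \<in> u ` {..<r} \<Longrightarrow> \<exists>l. A *\<^sub>v w = l \<cdot>\<^sub>v w" using u by auto
  from ex_min_eigenvector_orthogonal[OF A this x0(1,2) orth]
  obtain x \<mu> where x: "x \<in> carrier_vec n" "x \<bullet> x = 1" "\<And>w. w \<in> u ` {..<r} \<Longrightarrow> w \<bullet> x = 0" "A *\<^sub>v x = \<mu> \<cdot>\<^sub>v x"
    by metis
  have x': "x \<bullet> u i = 0" "u i \<bullet> x = 0" if "i < r" for i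
    using x(3)[of "u i"] that comm_scalar_prod[OF x(1) u(1)[OF that]] by auto
  show ?case
    by (rule exI[of _ "u(r := x)"], rule exI[of _ "l(r := \<mu>)"])
       (use x x' u in \<open>auto simp: less_Suc_eq\<close>)
qed auto

lemma spectral_theorem:
  fixes A :: "real mat"
  assumes A: "A \<in> carrier_mat n n" "sym_mat A"
  obtains U l where "U \<in> carrier_mat n n" "U\<^sup>T * U = 1\<^sub>m n" "U * U\<^sup>T = 1\<^sub>m n"
    "A = U * mat_diag n l * U\<^sup>T" "\<And>i. i < n \<Longrightarrow> A *\<^sub>v col U i = l i \<cdot>\<^sub>v col U i"
proof -
  obtain u l where u: "\<And>i. i < n \<Longrightarrow> u i \<in> carrier_vec n" "\<And>i. i < n \<Longrightarrow> A *\<^sub>v u i = l i \<cdot>\<^sub>v u i"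
    "\<And>i j. i < n \<Longrightarrow> j < n \<Longrightarrow> u i \<bullet> u j = (if i = j then 1 else 0 :: real)"
    using ex_orthonormal_eigenvectors[OF A order_refl] by metis
  define U where "U = (mat\<^sub>r n n u)\<^sup>T"
  have U: "U \<in> carrier_mat n n" by (auto simp: U_def)
  have col: "col U i = u i" if "i < n" for i using that u by (auto simp: U_def)
  have 1: "U\<^sup>T * U = 1\<^sub>m n"
    by (rule eq_matI) (use U u col in auto)
  have 2: "U * U\<^sup>T = 1\<^sub>m n"
    by (rule mat_mult_left_right_inverse[OF _ U 1]) (use U in auto)
  have "A * U = U * mat_diag n l"
  proof (rule eq_matI)
    fix i j assume "i < dim_row (U * mat_diag n l)" "j < dim_col (U * mat_diag n l)"
    hence ij: "i < n" "j < n" using U by (auto simp: mat_diag_def)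
    have "(A * U) $$ (i,j) = (A *\<^sub>v u j) $ i" using ij A U col by simp
    also have "\<dots> = l j * U $$ (i,j)" using ij u(1)[OF ij(2)] u(2)[OF ij(2)] U by (simp add: U_def)
    finally show "(A * U) $$ (i,j) = (U * mat_diag n l) $$ (i,j)"
      using ij U by (simp add: mat_diag_mult_right[OF U])
  qed (use A U in \<open>auto simp: mat_diag_def\<close>)
  hence "A * U * U\<^sup>T = U * mat_diag n l * U\<^sup>T" by simp
  moreover have "A * U * U\<^sup>T = A"
    using A U 2 by (simp add: assoc_mult_mat[of _ n n _ n _ n])
  ultimately show ?thesis using that[OF U 1 2, of l] u col by auto
qed

section \<open>Operator norm bounds\<close>

text \<open>Functional calculus in a fixed eigenbasis: \<open>f\<close> is a function of the index
  of the eigenvector, and products, powers and square roots act on \<open>f\<close> alone.\<close>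

definition conj_diag :: "nat \<Rightarrow> real mat \<Rightarrow> (nat \<Rightarrow> real) \<Rightarrow> real mat" where
  "conj_diag n U f = U * mat_diag n f * U\<^sup>T"

lemma conj_diag_carrier [simp]: "U \<in> carrier_mat n n \<Longrightarrow> conj_diag n U f \<in> carrier_mat n n"
  by (auto simp: conj_diag_def)

lemma conj_diag_index:
  assumes "U \<in> carrier_mat n n" "i < n" "j < n"
  shows "conj_diag n U f $$ (i,j) = (\<Sum>k = 0..<n. f k * U $$ (i,k) * U $$ (j,k))"
  using assms by (auto simp: conj_diag_def mat_diag_mult_right[of U n n] scalar_prod_def mult_ac intro!: sum.cong)

lemma conj_diag_sym:
  assumes "U \<in> carrier_mat n n"
  shows "sym_mat (conj_diag n U f)"
  unfolding sym_mat_def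
proof (rule eq_matI)
  fix i j assume "i < dim_row (conj_diag n U f)" "j < dim_col (conj_diag n U f)"
  hence ij: "i < n" "j < n" using assms conj_diag_carrier[OF assms, of f] by auto
  thus "(conj_diag n U f)\<^sup>T $$ (i,j) = conj_diag n U f $$ (i,j)"
    using carrier_matD[OF conj_diag_carrier[OF assms, of f]] assms
    by (auto simp: conj_diag_index mult_ac intro!: sum.cong)
qed (use assms in \<open>auto simp: conj_diag_def\<close>)

lemma conj_diag_mult:
  assumes U: "U \<in> carrier_mat n n" "U\<^sup>T * U = 1\<^sub>m n"
  shows "conj_diag n U f * conj_diag n U g = conj_diag n U (\<lambda>i. f i * g i)"
proof -
  have Ut: "U\<^sup>T \<in> carrier_mat n n" using U by auto
  have "conj_diag n U f * conj_diag n U g =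
      U * (mat_diag n f * ((U\<^sup>T * U) * (mat_diag n g * U\<^sup>T)))"
    using U(1) Ut by (simp add: conj_diag_def assoc_mult_mat[of _ n n _ n _ n] mult_carrier_mat[of _ n n _ n])
  also have "\<dots> = U * ((mat_diag n f * mat_diag n g) * U\<^sup>T)"
    using U(1) Ut unfolding U(2) by (simp add: assoc_mult_mat[of _ n n _ n _ n] mult_carrier_mat[of _ n n _ n] mat_diag_def del: mat_diag_diag)
  also have "\<dots> = conj_diag n U (\<lambda>i. f i * g i)"
    using U(1) Ut by (simp add: conj_diag_def assoc_mult_mat[of _ n n _ n _ n] mult_carrier_mat[of _ n n _ n])
  finally show ?thesis .
qed

lemma conj_diag_one:
  assumes "U \<in> carrier_mat n n" "U * U\<^sup>T = 1\<^sub>m n"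
  shows "conj_diag n U (\<lambda>_. 1) = 1\<^sub>m n"
  using assms by (simp add: conj_diag_def)

lemma conj_diag_cong: "(\<And>i. i < n \<Longrightarrow> f i = g i) \<Longrightarrow> conj_diag n U f = conj_diag n U g"
  by (auto simp: conj_diag_def mat_diag_def intro!: arg_cong2[where f = "(*)"])

lemma conj_diag_pow:
  assumes U: "U \<in> carrier_mat n n" "U\<^sup>T * U = 1\<^sub>m n" "U * U\<^sup>T = 1\<^sub>m n"
  shows "conj_diag n U f ^\<^sub>m r = conj_diag n U (\<lambda>i. f i ^ r)"
proof (induction r)
  case 0
  show ?case using conj_diag_carrier[OF U(1), of f] conj_diag_one[OF U(1,3)] by auto
next
  case (Suc r)
  thus ?case by (simp add: conj_diag_mult[OF U(1,2)] mult.commute)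
qed

lemma conj_diag_form:
  assumes U: "U \<in> carrier_mat n n" and x: "x \<in> carrier_vec n"
  shows "x \<bullet> (conj_diag n U f *\<^sub>v x) = (\<Sum>k = 0..<n. f k * (col U k \<bullet> x)\<^sup>2)"
proof -
  have "x \<bullet> (conj_diag n U f *\<^sub>v x) = (\<Sum>i = 0..<n. \<Sum>j = 0..<n. \<Sum>k = 0..<n. f k * (U $$ (i,k) * x $ i) * (U $$ (j,k) * x $ j))"
    using U x by (auto simp: form_eq_sum[OF conj_diag_carrier[OF U] x x] conj_diag_index sum_distrib_left sum_distrib_right mult_ac intro!: sum.cong)
  also have "\<dots> = (\<Sum>i = 0..<n. \<Sum>k = 0..<n. \<Sum>j = 0..<n. f k * (U $$ (i,k) * x $ i) * (U $$ (j,k) * x $ j))"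
    by (intro sum.cong refl sum.swap)
  also have "\<dots> = (\<Sum>k = 0..<n. \<Sum>i = 0..<n. \<Sum>j = 0..<n. f k * (U $$ (i,k) * x $ i) * (U $$ (j,k) * x $ j))"
    by (rule sum.swap)
  also have "\<dots> = (\<Sum>k = 0..<n. f k * (col U k \<bullet> x)\<^sup>2)"
    using U x by (auto simp: scalar_prod_def power2_eq_square sum_product sum_distrib_left mult_ac intro!: sum.cong)
  finally show ?thesis .
qed

lemma sum_col_scalar_prod_sq:
  assumes "(U :: real mat) \<in> carrier_mat n n" "U * U\<^sup>T = 1\<^sub>m n" "x \<in> carrier_vec n"
  shows "(\<Sum>k = 0..<n. (col U k \<bullet> x)\<^sup>2) = x \<bullet> x"
  using conj_diag_form[OF assms(1,3), of "\<lambda>_. 1"] assms by (simp add: conj_diag_one)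

lemma orthonormal_col:
  assumes "U\<^sup>T * U = 1\<^sub>m k" "U \<in> carrier_mat n k" "i < k" "j < k"
  shows "col U i \<bullet> col U j = (if i = j then 1 else (0::real))"
proof -
  have "(U\<^sup>T * U) $$ (i,j) = col U i \<bullet> col U j" using assms(2-4) by auto
  thus ?thesis using assms by simp
qed

lemma spectral_conj_diag:
  fixes A :: "real mat"
  assumes A: "A \<in> carrier_mat n n" "sym_mat A"
  obtains U l where "U \<in> carrier_mat n n" "U\<^sup>T * U = 1\<^sub>m n" "U * U\<^sup>T = 1\<^sub>m n"
    "A = conj_diag n U l" "\<And>i. i < n \<Longrightarrow> A *\<^sub>v col U i = l i \<cdot>\<^sub>v col U i"
    "\<And>i. i < n \<Longrightarrow> col U i \<bullet> col U i = 1"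
    "\<And>i. i < n \<Longrightarrow> col U i \<in> carrier_vec n"
proof -
  obtain U l where U: "U \<in> carrier_mat n n" "U\<^sup>T * U = 1\<^sub>m n" "U * U\<^sup>T = 1\<^sub>m n"
    "A = U * mat_diag n l * U\<^sup>T" "\<And>i. i < n \<Longrightarrow> A *\<^sub>v col U i = l i \<cdot>\<^sub>v col U i"
    using spectral_theorem[OF A] by metis
  show ?thesis
    by (rule that[OF U(1-3) _ U(5)]) (use U orthonormal_col[OF U(2,1)] in \<open>auto simp: conj_diag_def\<close>)
qed

lemma eigen_form:
  assumes "A *\<^sub>v x = (l::real) \<cdot>\<^sub>v x" "x \<bullet> x = 1" "x \<in> carrier_vec n"
  shows "x \<bullet> (A *\<^sub>v x) = l"
  using assms by simp

text \<open>A relation in place of \<open>spec_norm\<close>: bounds compose under sums and products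
  without first showing that a supremum is finite. The condition \<open>0 \<le> c\<close> excludes
  negative constants, which a trivial space would allow and which do not multiply
  monotonically.\<close>

definition op_bound :: "real \<Rightarrow> real mat \<Rightarrow> bool" where
  "op_bound c M \<longleftrightarrow> 0 \<le> c \<and> (\<forall>x \<in> carrier_vec (dim_col M). vnorm (M *\<^sub>v x) \<le> c * vnorm x)"

lemma op_boundI:
  assumes "M \<in> carrier_mat m n" "0 \<le> c" "\<And>x. x \<in> carrier_vec n \<Longrightarrow> vnorm (M *\<^sub>v x) \<le> c * vnorm x"
  shows "op_bound c M"
  using assms by (auto simp: op_bound_def)

lemma op_boundD:
  assumes "op_bound c M" "M \<in> carrier_mat m n" "x \<in> carrier_vec n"
  shows "vnorm (M *\<^sub>v x) \<le> c * vnorm x"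
  using assms by (auto simp: op_bound_def)

lemma op_bound_nonneg: "op_bound c M \<Longrightarrow> 0 \<le> c" by (simp add: op_bound_def)

lemma op_bound_mono: "op_bound c M \<Longrightarrow> c \<le> d \<Longrightarrow> op_bound d M"
  unfolding op_bound_def by (meson mult_right_mono order_trans vnorm_nonneg)

lemma op_bound_mult:
  assumes "op_bound c M" "op_bound d N" "M \<in> carrier_mat m n" "N \<in> carrier_mat n k"
  shows "op_bound (c * d) (M * N)"
proof (rule op_boundI)
  fix x :: "real vec" assume x: "x \<in> carrier_vec k"
  have "vnorm (M * N *\<^sub>v x) = vnorm (M *\<^sub>v (N *\<^sub>v x))" using assms x by simp
  also have "\<dots> \<le> c * vnorm (N *\<^sub>v x)" using assms x by (intro op_boundD) auto
  also have "\<dots> \<le> c * (d * vnorm x)"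
    using assms x by (intro mult_left_mono op_boundD[OF assms(2,4)] op_bound_nonneg[OF assms(1)])
  finally show "vnorm (M * N *\<^sub>v x) \<le> c * d * vnorm x" by simp
qed (use assms op_bound_nonneg in auto)

lemma op_bound_add:
  assumes "op_bound c M" "op_bound d N" "M \<in> carrier_mat m n" "N \<in> carrier_mat m n"
  shows "op_bound (c + d) (M + N)"
proof (rule op_boundI)
  fix x :: "real vec" assume x: "x \<in> carrier_vec n"
  have "vnorm ((M + N) *\<^sub>v x) \<le> vnorm (M *\<^sub>v x) + vnorm (N *\<^sub>v x)"
    using assms x vnorm_add_le[of "M *\<^sub>v x" m "N *\<^sub>v x"]
    by (simp add: add_mult_distrib_mat_vec[of _ m n])
  also have "\<dots> \<le> (c + d) * vnorm x"
    using op_boundD[OF assms(1,3) x] op_boundD[OF assms(2,4) x] by (simp add: algebra_simps)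
  finally show "vnorm ((M + N) *\<^sub>v x) \<le> (c + d) * vnorm x" .
qed (use assms op_bound_nonneg in \<open>auto intro: add_nonneg_nonneg\<close>)

lemma op_bound_diff:
  assumes "op_bound c M" "op_bound d N" "M \<in> carrier_mat m n" "N \<in> carrier_mat m n"
  shows "op_bound (c + d) (M - N)"
proof (rule op_boundI)
  fix x :: "real vec" assume x: "x \<in> carrier_vec n"
  have "vnorm ((M - N) *\<^sub>v x) \<le> vnorm (M *\<^sub>v x) + vnorm (N *\<^sub>v x)"
    using assms x vnorm_diff_le[of "M *\<^sub>v x" m "N *\<^sub>v x"]
    by (simp add: minus_mult_distrib_mat_vec[of _ m n])
  also have "\<dots> \<le> (c + d) * vnorm x"
    using op_boundD[OF assms(1,3) x] op_boundD[OF assms(2,4) x] by (simp add: algebra_simps)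
  finally show "vnorm ((M - N) *\<^sub>v x) \<le> (c + d) * vnorm x" .
qed (use assms op_bound_nonneg in \<open>auto intro: add_nonneg_nonneg\<close>)

lemma op_bound_diff_commute:
  assumes "op_bound c (M - N)" "M \<in> carrier_mat m n" "N \<in> carrier_mat m n"
  shows "op_bound c (N - M)"
proof (rule op_boundI)
  fix x :: "real vec" assume x: "x \<in> carrier_vec n"
  have "(N - M) *\<^sub>v x = (-1) \<cdot>\<^sub>v ((M - N) *\<^sub>v x)"
    using assms x by (auto simp: minus_mult_distrib_mat_vec[of _ m n] intro!: eq_vecI)
  thus "vnorm ((N - M) *\<^sub>v x) \<le> c * vnorm x"
    using op_boundD[OF assms(1) minus_carrier_mat[OF assms(3)] x] by (simp add: vnorm_smult)
qed (use assms op_bound_nonneg in auto)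

lemma orthonormal_vnorm:
  assumes "V \<in> carrier_mat n k" "V\<^sup>T * V = 1\<^sub>m k" "x \<in> carrier_vec k"
  shows "vnorm (V *\<^sub>v x) = vnorm x"
proof -
  have "(V *\<^sub>v x) \<bullet> (V *\<^sub>v x) = (V\<^sup>T *\<^sub>v (V *\<^sub>v x)) \<bullet> x"
    using assms by (intro scalar_prod_mult_mat) auto
  also have "V\<^sup>T *\<^sub>v (V *\<^sub>v x) = x"
    using assms assoc_mult_mat_vec[of "V\<^sup>T" k n V k x] by simp
  finally show ?thesis by (simp add: vnorm_def)
qed

lemma op_bound_orthonormal:
  assumes "V \<in> carrier_mat n k" "V\<^sup>T * V = 1\<^sub>m k"
  shows "op_bound 1 V"
  using assms by (intro op_boundI[OF assms(1)]) (auto simp: orthonormal_vnorm)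

lemma op_bound_spectral:
  fixes A :: "real mat"
  assumes U: "U \<in> carrier_mat n n" "U\<^sup>T * U = 1\<^sub>m n" "U * U\<^sup>T = 1\<^sub>m n"
    and A: "A = conj_diag n U l" and l: "\<And>i. i < n \<Longrightarrow> \<bar>l i\<bar> \<le> c" and c: "0 \<le> c"
  shows "op_bound c A"
proof (rule op_boundI)
  show Ac: "A \<in> carrier_mat n n" using U A by simp
  have sym: "sym_mat A" using conj_diag_sym U A by simp
  fix x :: "real vec" assume x: "x \<in> carrier_vec n"
  have "(A *\<^sub>v x) \<bullet> (A *\<^sub>v x) = x \<bullet> ((A * A) *\<^sub>v x)"
    using sym_mat_scalar_prod[OF Ac sym, of "A *\<^sub>v x" x] x Ac by simp
  also have "\<dots> = (\<Sum>k = 0..<n. (l k * l k) * (col U k \<bullet> x)\<^sup>2)"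
    unfolding A conj_diag_mult[OF U(1,2)] by (rule conj_diag_form[OF U(1) x])
  also have "\<dots> \<le> (\<Sum>k = 0..<n. c\<^sup>2 * (col U k \<bullet> x)\<^sup>2)"
  proof (intro sum_mono mult_right_mono)
    fix k assume "k \<in> {0..<n}"
    thus "l k * l k \<le> c\<^sup>2" using power_mono[OF l, of k 2] by (simp add: power2_eq_square)
  qed auto
  also have "\<dots> = c\<^sup>2 * (x \<bullet> x)" using sum_col_scalar_prod_sq[OF U(1,3) x] by (simp add: sum_distrib_left[symmetric])
  finally have "(vnorm (A *\<^sub>v x))\<^sup>2 \<le> (c * vnorm x)\<^sup>2" by (simp add: vnorm_sq power_mult_distrib)
  thus "vnorm (A *\<^sub>v x) \<le> c * vnorm x" by (rule power2_le_imp_le) (use c in auto)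
qed (rule c)

text \<open>A unit eigenvector turns the form into its eigenvalue, so for a symmetric matrix the
  quadratic form alone controls the norm.\<close>

lemma op_bound_sym_form:
  assumes A: "A \<in> carrier_mat n n" "sym_mat A" and c: "0 \<le> c"
    and form: "\<And>x. x \<in> carrier_vec n \<Longrightarrow> \<bar>x \<bullet> (A *\<^sub>v x)\<bar> \<le> c * (x \<bullet> x)"
  shows "op_bound c A"
proof -
  obtain U l where U: "U \<in> carrier_mat n n" "U\<^sup>T * U = 1\<^sub>m n" "U * U\<^sup>T = 1\<^sub>m n"
    "A = conj_diag n U l" and e: "\<And>i. i < n \<Longrightarrow> A *\<^sub>v col U i = l i \<cdot>\<^sub>v col U i"
    "\<And>i. i < n \<Longrightarrow> col U i \<bullet> col U i = 1" "\<And>i. i < n \<Longrightarrow> col U i \<in> carrier_vec n"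
    using spectral_conj_diag[OF A] by metis
  have "\<bar>l i\<bar> \<le> c" if "i < n" for i
    using form[OF e(3)[OF that]] eigen_form[OF e(1-3)[OF that]] e(2)[OF that] by simp
  thus ?thesis by (rule op_bound_spectral[OF U _ c])
qed

lemma spec_norm_le:
  assumes "op_bound c M"
  shows "spec_norm M \<le> c"
  unfolding spec_norm_def
proof (rule cSup_least)
  show "{vnorm (M *\<^sub>v x) |x. x \<in> carrier_vec (dim_col M) \<and> vnorm x \<le> 1} \<noteq> {}"
    by (auto intro!: exI[of _ "0\<^sub>v (dim_col M)"])
next
  fix y assume "y \<in> {vnorm (M *\<^sub>v x) |x. x \<in> carrier_vec (dim_col M) \<and> vnorm x \<le> 1}"
  then obtain x where x: "y = vnorm (M *\<^sub>v x)" "x \<in> carrier_vec (dim_col M)" "vnorm x \<le> 1" by auto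
  have "y \<le> c * vnorm x" using assms x by (auto simp: op_bound_def)
  also have "\<dots> \<le> c * 1" using x op_bound_nonneg[OF assms] by (intro mult_left_mono) auto
  finally show "y \<le> c" by simp
qed

text \<open>A finite bound must be known before the supremum means anything. Having the least bound
  \<open>N\<close> then allows an inequality of the shape \<open>N \<le> a N + b\<close> to be
  solved for \<open>N\<close>.\<close>

lemma op_bound_spec_norm:
  assumes "op_bound c M"
  shows "op_bound (spec_norm M) M"
proof -
  let ?S = "{vnorm (M *\<^sub>v x) |x. x \<in> carrier_vec (dim_col M) \<and> vnorm x \<le> 1}"
  have bdd: "bdd_above ?S"
  proof (rule bdd_aboveI[of _ c])
    fix y assume "y \<in> ?S"
    then obtain x where x: "y = vnorm (M *\<^sub>v x)" "x \<in> carrier_vec (dim_col M)" "vnorm x \<le> 1" by auto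
    have "y \<le> c * vnorm x" using assms x by (auto simp: op_bound_def)
    also have "\<dots> \<le> c * 1" using x op_bound_nonneg[OF assms] by (intro mult_left_mono) auto
    finally show "y \<le> c" by simp
  qed
  have up: "vnorm (M *\<^sub>v x) \<le> spec_norm M" if "x \<in> carrier_vec (dim_col M)" "vnorm x \<le> 1" for x
    unfolding spec_norm_def by (rule cSup_upper[OF _ bdd]) (use that in auto)
  have 0: "0 \<le> spec_norm M"
    by (rule order_trans[OF _ up[of "0\<^sub>v (dim_col M)"]]) auto
  show ?thesis unfolding op_bound_def
  proof (intro conjI ballI 0)
    fix x :: "real vec" assume x: "x \<in> carrier_vec (dim_col M)"
    show "vnorm (M *\<^sub>v x) \<le> spec_norm M * vnorm x"
    proof (cases "x = 0\<^sub>v (dim_col M)")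
      case True
      have "M *\<^sub>v 0\<^sub>v (dim_col M) = 0\<^sub>v (dim_row M)" by auto
      thus ?thesis using True by simp
    next
      case False
      hence p: "vnorm x > 0" using vnorm_eq_0[OF x] vnorm_nonneg[of x] by linarith
      have "vnorm (M *\<^sub>v ((1 / vnorm x) \<cdot>\<^sub>v x)) \<le> spec_norm M"
        using p x by (intro up) (auto simp: vnorm_smult)
      moreover have "M *\<^sub>v ((1 / vnorm x) \<cdot>\<^sub>v x) = (1 / vnorm x) \<cdot>\<^sub>v (M *\<^sub>v x)"
        using x by (intro mult_mat_vec[of _ "dim_row M" "dim_col M"]) auto
      ultimately show ?thesis using p by (simp add: vnorm_smult field_simps)
    qed
  qed
qed

lemma pos_def_matD:
  assumes "pos_def_mat n S"
  shows "S \<in> carrier_mat n n" "sym_mat S" "\<And>x. x \<in> carrier_vec n \<Longrightarrow> x \<noteq> 0\<^sub>v n \<Longrightarrow> x \<bullet> (S *\<^sub>v x) > 0"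
  using assms by (auto simp: pos_def_mat_def)

text \<open>If \<open>Z z = \<zeta> z\<close> with \<open>\<zeta> > 0\<close>, the hypothesis makes \<open>Y z\<close> a solution of
  \<open>S y = - \<zeta> y\<close>, and \<open>S\<close> is positive definite. Uniqueness of the inverse square root and the
  identity \<open>S \<Theta> = \<Theta> (C\<^sup>-)\<^sup>-\<^sup>1\<^sup>/\<^sup>2\<close> are both instances.\<close>

lemma intertwine_eq_zero:
  assumes S: "pos_def_mat n S" and Z: "pos_def_mat k Z" and Y: "Y \<in> carrier_mat n k"
    and eq: "S * Y + Y * Z = 0\<^sub>m n k"
  shows "Y = 0\<^sub>m n k"
proof -
  note Sc = pos_def_matD[OF S] and Zc = pos_def_matD[OF Z]
  obtain U l where U: "U \<in> carrier_mat k k" "U\<^sup>T * U = 1\<^sub>m k" "U * U\<^sup>T = 1\<^sub>m k"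
    and e: "\<And>i. i < k \<Longrightarrow> Z *\<^sub>v col U i = l i \<cdot>\<^sub>v col U i"
    "\<And>i. i < k \<Longrightarrow> col U i \<bullet> col U i = 1" "\<And>i. i < k \<Longrightarrow> col U i \<in> carrier_vec k"
    using spectral_conj_diag[OF Zc(1,2)] by metis
  have Yz: "Y *\<^sub>v col U i = 0\<^sub>v n" if i: "i < k" for i
  proof (rule ccontr)
    let ?z = "col U i" and ?y = "Y *\<^sub>v col U i"
    assume ne: "?y \<noteq> 0\<^sub>v n"
    have y: "?y \<in> carrier_vec n" using Y e(3)[OF i] by auto
    have "?z \<noteq> 0\<^sub>v k" using e(2)[OF i] by auto
    hence "l i > 0" using Zc(3)[OF e(3)[OF i]] eigen_form[OF e[OF i]] by simp
    have "(S * Y + Y * Z) *\<^sub>v ?z = S *\<^sub>v ?y + l i \<cdot>\<^sub>v ?y"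
      using Sc Zc Y e(1,3)[OF i] by (simp add: add_mult_distrib_mat_vec[of _ n k] mult_mat_vec[of _ n k])
    moreover have "(S * Y + Y * Z) *\<^sub>v ?z = 0\<^sub>v n" using eq e(3)[OF i] by (auto intro!: eq_vecI)
    ultimately have "?y \<bullet> (S *\<^sub>v ?y + l i \<cdot>\<^sub>v ?y) = 0" using y by (metis scalar_prod_right_zero)
    hence "?y \<bullet> (S *\<^sub>v ?y) + l i * (?y \<bullet> ?y) = 0" using Sc y by (simp add: scalar_prod_add_distrib[of _ n])
    moreover have "?y \<bullet> (S *\<^sub>v ?y) > 0" by (rule Sc(3)[OF y ne])
    moreover have "l i * (?y \<bullet> ?y) \<ge> 0" using \<open>l i > 0\<close> by simp
    ultimately show False by linarith
  qed
  have "Y * U = 0\<^sub>m n k"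
  proof (rule eq_matI)
    fix i j assume ij: "i < dim_row (0\<^sub>m n k :: real mat)" "j < dim_col (0\<^sub>m n k :: real mat)"
    have "(Y * U) $$ (i,j) = (Y *\<^sub>v col U j) $ i" using ij Y U by simp
    thus "(Y * U) $$ (i,j) = 0\<^sub>m n k $$ (i,j)" using ij Yz[of j] by simp
  qed (use Y U in auto)
  hence "Y * U * U\<^sup>T = 0\<^sub>m n k" using U by simp
  moreover have "Y * U * U\<^sup>T = Y" using Y U by (simp add: assoc_mult_mat[of _ n k _ k _ k])
  ultimately show ?thesis by simp
qed

section \<open>Inverse square roots and eigenspace perturbation\<close>

lemma form_le_op_bound:
  assumes "op_bound c M" "M \<in> carrier_mat n n" "x \<in> carrier_vec n"
  shows "\<bar>x \<bullet> (M *\<^sub>v x)\<bar> \<le> c * (x \<bullet> x)"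
proof -
  have "\<bar>x \<bullet> (M *\<^sub>v x)\<bar> \<le> vnorm x * vnorm (M *\<^sub>v x)" using assms by (intro abs_scalar_prod_le) auto
  also have "\<dots> \<le> vnorm x * (c * vnorm x)" by (intro mult_left_mono op_boundD[OF assms]) auto
  finally show ?thesis using vnorm_sq[of x] by (simp add: power2_eq_square mult_ac)
qed

lemma pos_def_matI:
  assumes "M \<in> carrier_mat n n" "sym_mat M" "0 < \<tau>"
    "\<And>x. x \<in> carrier_vec n \<Longrightarrow> \<tau> * (x \<bullet> x) \<le> x \<bullet> (M *\<^sub>v x)"
  shows "pos_def_mat n M"
  unfolding pos_def_mat_def
proof (intro conjI ballI impI assms(1,2))
  fix x :: "real vec" assume x: "x \<in> carrier_vec n" "x \<noteq> 0\<^sub>v n"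
  hence "x \<bullet> x > 0" using self_scalar_prod_eq_0[of x n] self_scalar_prod_nonneg[of x] by linarith
  hence "0 < \<tau> * (x \<bullet> x)" using assms by simp
  thus "0 < x \<bullet> (M *\<^sub>v x)" using assms(4)[OF x(1)] by linarith
qed

text \<open>\<open>S * S\<close> and \<open>T * T\<close> both invert \<open>M\<close> and hence
  agree, but \<open>S\<close> and \<open>T\<close> are not known to commute. The identity
  \<open>S (S - T) + (S - T) T = S S - T T\<close> holds without commutation.\<close>

lemma inv_sqrt_unique:
  assumes S: "pos_def_mat n S" "S * S * M = 1\<^sub>m n" and T: "pos_def_mat n T" "T * T * M = 1\<^sub>m n"
    and M: "M \<in> carrier_mat n n"
  shows "S = T"
proof -
  note Sc = pos_def_matD(1)[OF S(1)] and Tc = pos_def_matD(1)[OF T(1)]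
  have "M * (T * T) = 1\<^sub>m n" by (rule mat_mult_left_right_inverse[OF _ M T(2)]) (use Tc in auto)
  hence "S * S = S * S * (M * (T * T))" using Sc by simp
  also have "\<dots> = (S * S * M) * (T * T)"
    using Sc Tc M by (simp add: assoc_mult_mat[of _ n n _ n _ n] mult_carrier_mat[of _ n n _ n])
  finally have eq: "S * S = T * T" using Tc S(2) by simp
  have "S * (S - T) + (S - T) * T = 0\<^sub>m n n"
  proof -
    have "S * (S - T) + (S - T) * T = (S * S - S * T) + (S * T - T * T)"
      using Sc Tc by (simp add: mult_minus_distrib_mat[of _ n n _ n] minus_mult_distrib_mat[of _ n n _ _ n])
    also have "\<dots> = 0\<^sub>m n n" unfolding eq using Sc Tc by (intro eq_matI) auto
    finally show ?thesis .
  qed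
  hence D: "S - T = 0\<^sub>m n n" by (rule intertwine_eq_zero[OF S(1) T(1) minus_carrier_mat[OF Tc]])
  show ?thesis
  proof (rule eq_matI)
    fix i j assume ij: "i < dim_row T" "j < dim_col T"
    hence "(S - T) $$ (i,j) = S $$ (i,j) - T $$ (i,j)" using Sc Tc by auto
    thus "S $$ (i,j) = T $$ (i,j)" unfolding D using ij Tc by auto
  qed (use Sc Tc in auto)
qed

lemma inv_sqrt_mat_eqI:
  assumes "M \<in> carrier_mat n n" "pos_def_mat n S" "S * S * M = 1\<^sub>m n"
  shows "inv_sqrt_mat M = S"
  unfolding inv_sqrt_mat_def
proof (rule the_equality)
  show "pos_def_mat (dim_row M) S \<and> S * S * M = 1\<^sub>m (dim_row M)" using assms by auto
next
  fix T assume "pos_def_mat (dim_row M) T \<and> T * T * M = 1\<^sub>m (dim_row M)"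
  thus "T = S" using assms inv_sqrt_unique[of n T M S] by auto
qed

text \<open>The root \<open>R\<close> of \<open>M\<close> is exported along with the inverse root,
  because the perturbation estimate is made for \<open>R\<close>, which is bounded below by
  \<open>sqrt \<tau>\<close>.\<close>

lemma inv_sqrt_mat_props:
  assumes M: "M \<in> carrier_mat n n" "sym_mat M" and t: "0 < \<tau>"
    and low: "\<And>x. x \<in> carrier_vec n \<Longrightarrow> \<tau> * (x \<bullet> x) \<le> x \<bullet> (M *\<^sub>v x)"
  obtains R where "pos_def_mat n (inv_sqrt_mat M)" "inv_sqrt_mat M * inv_sqrt_mat M * M = 1\<^sub>m n"
    "op_bound (1 / sqrt \<tau>) (inv_sqrt_mat M)"
    "R \<in> carrier_mat n n" "sym_mat R" "R * R = M" "R * inv_sqrt_mat M = 1\<^sub>m n" "inv_sqrt_mat M * R = 1\<^sub>m n"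
    "\<And>x. x \<in> carrier_vec n \<Longrightarrow> sqrt \<tau> * (x \<bullet> x) \<le> x \<bullet> (R *\<^sub>v x)"
proof -
  obtain U l where U: "U \<in> carrier_mat n n" "U\<^sup>T * U = 1\<^sub>m n" "U * U\<^sup>T = 1\<^sub>m n"
    "M = conj_diag n U l" and e: "\<And>i. i < n \<Longrightarrow> M *\<^sub>v col U i = l i \<cdot>\<^sub>v col U i"
    "\<And>i. i < n \<Longrightarrow> col U i \<bullet> col U i = 1" "\<And>i. i < n \<Longrightarrow> col U i \<in> carrier_vec n"
    using spectral_conj_diag[OF M] by metis
  have l: "l i \<ge> \<tau>" if "i < n" for i
    using low[OF e(3)[OF that]] eigen_form[OF e(1-3)[OF that]] e(2)[OF that] by simp
  have lp: "l i > 0" if "i < n" for i using l[OF that] t by linarith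
  define S where "S = conj_diag n U (\<lambda>i. 1 / sqrt (l i))"
  define R where "R = conj_diag n U (\<lambda>i. sqrt (l i))"
  have one: "conj_diag n U f = 1\<^sub>m n" if "\<And>i. i < n \<Longrightarrow> f i = 1" for f
    using conj_diag_cong[of n f "\<lambda>_. 1" U] conj_diag_one[OF U(1,3)] that by simp
  have SSM: "S * S * M = 1\<^sub>m n"
    unfolding S_def U(4) conj_diag_mult[OF U(1,2)] 
  proof (rule one)
    fix i assume "i < n"
    from lp[OF this] show "1 / sqrt (l i) * (1 / sqrt (l i)) * l i = 1" by simp
  qed
  have pd: "pos_def_mat n S" unfolding pos_def_mat_def
  proof (intro conjI ballI impI)
    show "S \<in> carrier_mat n n" "sym_mat S" unfolding S_def using U conj_diag_sym by auto
    fix x :: "real vec" assume x: "x \<in> carrier_vec n" "x \<noteq> 0\<^sub>v n"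
    have "\<exists>k<n. col U k \<bullet> x \<noteq> 0"
    proof (rule ccontr)
      assume "\<not> ?thesis"
      hence "(\<Sum>k = 0..<n. (col U k \<bullet> x)\<^sup>2) = 0" by simp
      thus False using sum_col_scalar_prod_sq[OF U(1,3) x(1)] self_scalar_prod_eq_0[OF x(1)] x(2) by simp
    qed
    then obtain k where k: "k < n" "col U k \<bullet> x \<noteq> 0" by auto
    show "0 < x \<bullet> (S *\<^sub>v x)" unfolding S_def conj_diag_form[OF U(1) x(1)]
      by (rule sum_pos2[of _ k]) (use k lp less_imp_le[OF lp] in auto)
  qed
  have S: "inv_sqrt_mat M = S" by (rule inv_sqrt_mat_eqI[OF M(1) pd SSM])
  show ?thesis
  proof (rule that[of R], unfold S)
    show "op_bound (1 / sqrt \<tau>) S"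
      by (rule op_bound_spectral[OF U(1-3) S_def])
         (use l lp t in \<open>auto simp: frac_le less_imp_le\<close>)
    show "R \<in> carrier_mat n n" "sym_mat R" unfolding R_def using U conj_diag_sym by auto
    show "R * R = M" unfolding R_def U(4) conj_diag_mult[OF U(1,2)]
      by (rule conj_diag_cong) (use lp in \<open>auto simp: less_imp_le\<close>)
    show "R * S = 1\<^sub>m n" "S * R = 1\<^sub>m n" unfolding R_def S_def conj_diag_mult[OF U(1,2)]
      by (rule one, metis lp less_irrefl nonzero_divide_eq_eq real_sqrt_eq_zero_cancel_iff mult.commute mult_1)+
    fix x :: "real vec" assume x: "x \<in> carrier_vec n"
    have "sqrt \<tau> * (x \<bullet> x) = (\<Sum>k = 0..<n. sqrt \<tau> * (col U k \<bullet> x)\<^sup>2)"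
      using sum_col_scalar_prod_sq[OF U(1,3) x] by (simp add: sum_distrib_left[symmetric])
    also have "\<dots> \<le> x \<bullet> (R *\<^sub>v x)" unfolding R_def conj_diag_form[OF U(1) x]
      by (intro sum_mono mult_right_mono) (use l in auto)
    finally show "sqrt \<tau> * (x \<bullet> x) \<le> x \<bullet> (R *\<^sub>v x)" .
  qed (use pd SSM in auto)
qed

lemma diff_sym_mat: "A \<in> carrier_mat n n \<Longrightarrow> B \<in> carrier_mat n n \<Longrightarrow> sym_mat A \<Longrightarrow> sym_mat B \<Longrightarrow> sym_mat (A - B)"
  by (auto simp: sym_mat_def transpose_minus)

text \<open>An eigenvector \<open>x\<close> of \<open>R - T\<close> with eigenvalue \<open>\<lambda>\<close> satisfies
  \<open>x \<bullet> (R\<^sup>2 - T\<^sup>2) x = \<lambda> (x \<bullet> R x + x \<bullet> T x)\<close>.\<close>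

lemma op_bound_sqrt_diff:
  assumes R: "R \<in> carrier_mat n n" "sym_mat R" and T: "T \<in> carrier_mat n n" "sym_mat T"
    and lr: "\<And>x. x \<in> carrier_vec n \<Longrightarrow> r * (x \<bullet> x) \<le> x \<bullet> (R *\<^sub>v x)"
    and lt: "\<And>x. x \<in> carrier_vec n \<Longrightarrow> t * (x \<bullet> x) \<le> x \<bullet> (T *\<^sub>v x)"
    and rt: "0 < r + t" and D: "0 \<le> \<Delta>"
    and form: "\<And>x. x \<in> carrier_vec n \<Longrightarrow> \<bar>x \<bullet> ((R * R - T * T) *\<^sub>v x)\<bar> \<le> \<Delta> * (x \<bullet> x)"
  shows "op_bound (\<Delta> / (r + t)) (R - T)"
proof -
  have DT: "R - T \<in> carrier_mat n n" "sym_mat (R - T)" using R T diff_sym_mat by auto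
  obtain U l where U: "U \<in> carrier_mat n n" "U\<^sup>T * U = 1\<^sub>m n" "U * U\<^sup>T = 1\<^sub>m n"
    "R - T = conj_diag n U l" and e: "\<And>i. i < n \<Longrightarrow> (R - T) *\<^sub>v col U i = l i \<cdot>\<^sub>v col U i"
    "\<And>i. i < n \<Longrightarrow> col U i \<bullet> col U i = 1" "\<And>i. i < n \<Longrightarrow> col U i \<in> carrier_vec n"
    using spectral_conj_diag[OF DT] by metis
  have "\<bar>l i\<bar> \<le> \<Delta> / (r + t)" if i: "i < n" for i
  proof -
    let ?x = "col U i"
    note x = e(3)[OF i]
    have c: "R *\<^sub>v ?x \<in> carrier_vec n" "T *\<^sub>v ?x \<in> carrier_vec n" using R T x by auto
    have Rx: "R *\<^sub>v ?x - T *\<^sub>v ?x = l i \<cdot>\<^sub>v ?x"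
      using e(1)[OF i] minus_mult_distrib_mat_vec[OF R(1) T(1) x] by simp
    have "?x \<bullet> ((R * R - T * T) *\<^sub>v ?x) = (R *\<^sub>v ?x) \<bullet> (R *\<^sub>v ?x) - (T *\<^sub>v ?x) \<bullet> (T *\<^sub>v ?x)"
      using R T x c sym_mat_scalar_prod[OF R c(1) x] sym_mat_scalar_prod[OF T c(2) x]
      by (simp add: minus_mult_distrib_mat_vec[of _ n n] scalar_prod_minus_distrib[of _ n] mult_carrier_mat[of _ n n _ n])
    also have "\<dots> = (R *\<^sub>v ?x - T *\<^sub>v ?x) \<bullet> (R *\<^sub>v ?x) + (R *\<^sub>v ?x - T *\<^sub>v ?x) \<bullet> (T *\<^sub>v ?x)"
      using c comm_scalar_prod[OF c] by (simp add: minus_scalar_prod_distrib[of _ n])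
    also have "\<dots> = l i * (?x \<bullet> (R *\<^sub>v ?x) + ?x \<bullet> (T *\<^sub>v ?x))"
      unfolding Rx using c x by (simp add: algebra_simps)
    finally have "\<bar>l i\<bar> * \<bar>?x \<bullet> (R *\<^sub>v ?x) + ?x \<bullet> (T *\<^sub>v ?x)\<bar> \<le> \<Delta>"
      using form[OF x] e(2)[OF i] by (simp add: abs_mult)
    moreover have "r + t \<le> \<bar>?x \<bullet> (R *\<^sub>v ?x) + ?x \<bullet> (T *\<^sub>v ?x)\<bar>"
      using lr[OF x] lt[OF x] e(2)[OF i] by simp
    ultimately have "\<bar>l i\<bar> * (r + t) \<le> \<Delta>" by (meson abs_ge_zero mult_left_mono order_trans)
    thus ?thesis using rt by (simp add: field_simps)
  qed
  thus ?thesis by (rule op_bound_spectral[OF U]) (use D rt in auto)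
qed

text \<open>With \<open>R\<close> and \<open>Q\<close> the roots of \<open>M\<close> and
  \<open>N\<close>, the identity \<open>S - T = S (Q - R) T\<close> for the inverse roots reduces to
  the perturbation of roots. That contributes \<open>\<Delta> / (2 * sqrt \<tau>)\<close>, and each
  outer factor \<open>1 / sqrt \<tau>\<close>.\<close>

lemma op_bound_inv_sqrt_diff:
  assumes M: "M \<in> carrier_mat n n" "sym_mat M" and N: "N \<in> carrier_mat n n" "sym_mat N" and t: "0 < \<tau>"
    and lM: "\<And>x. x \<in> carrier_vec n \<Longrightarrow> \<tau> * (x \<bullet> x) \<le> x \<bullet> (M *\<^sub>v x)"
    and lN: "\<And>x. x \<in> carrier_vec n \<Longrightarrow> \<tau> * (x \<bullet> x) \<le> x \<bullet> (N *\<^sub>v x)"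
    and D: "op_bound \<Delta> (M - N)"
  shows "op_bound (\<Delta> / (2 * \<tau> * sqrt \<tau>)) (inv_sqrt_mat M - inv_sqrt_mat N)"
proof -
  let ?S = "inv_sqrt_mat M" and ?T = "inv_sqrt_mat N"
  obtain R where R: "pos_def_mat n ?S" "op_bound (1 / sqrt \<tau>) ?S" "R \<in> carrier_mat n n" "sym_mat R"
    "R * R = M" "?S * R = 1\<^sub>m n" "\<And>x. x \<in> carrier_vec n \<Longrightarrow> sqrt \<tau> * (x \<bullet> x) \<le> x \<bullet> (R *\<^sub>v x)"
    using inv_sqrt_mat_props[OF M t lM] by metis
  obtain Q where Q: "pos_def_mat n ?T" "op_bound (1 / sqrt \<tau>) ?T" "Q \<in> carrier_mat n n" "sym_mat Q"
    "Q * Q = N" "Q * ?T = 1\<^sub>m n" "\<And>x. x \<in> carrier_vec n \<Longrightarrow> sqrt \<tau> * (x \<bullet> x) \<le> x \<bullet> (Q *\<^sub>v x)"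
    using inv_sqrt_mat_props[OF N t lN] by metis
  note Sc = pos_def_matD(1)[OF R(1)] and Tc = pos_def_matD(1)[OF Q(1)]
  have "op_bound (\<Delta> / (sqrt \<tau> + sqrt \<tau>)) (R - Q)"
    by (rule op_bound_sqrt_diff[OF R(3,4) Q(3,4) R(7) Q(7)])
       (use t op_bound_nonneg[OF D] form_le_op_bound[OF D minus_carrier_mat[OF N(1)]] M N in \<open>auto simp: R(5) Q(5)\<close>)
  hence "op_bound (\<Delta> / (sqrt \<tau> + sqrt \<tau>)) (Q - R)" using R Q by (intro op_bound_diff_commute[of _ R Q]) auto
  hence "op_bound (1 / sqrt \<tau> * (\<Delta> / (sqrt \<tau> + sqrt \<tau>)) * (1 / sqrt \<tau>)) (?S * (Q - R) * ?T)"
    using R Q Sc Tc by (intro op_bound_mult[of _ _ _ _ n n n] op_bound_mult[of _ ?S _ _ n n n]) auto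
  moreover have "?S * (Q - R) * ?T = ?S - ?T"
  proof -
    have "?S * (Q - R) * ?T = ?S * (Q * ?T) - (?S * R) * ?T"
      using R(3) Q(3) Sc Tc
      by (simp add: mult_minus_distrib_mat[of _ n n _ n] minus_mult_distrib_mat[of _ n n _ _ n]
          assoc_mult_mat[of _ n n _ n _ n] mult_carrier_mat[of _ n n _ n] del: R(6) Q(6))
    thus ?thesis unfolding R(6) Q(6) using Sc Tc by simp
  qed
  moreover have "1 / sqrt \<tau> * (\<Delta> / (sqrt \<tau> + sqrt \<tau>)) * (1 / sqrt \<tau>) = \<Delta> / (2 * \<tau> * sqrt \<tau>)"
    using t by (simp add: field_simps)
  ultimately show ?thesis by metis
qed

text \<open>\<open>is_Vk\<close> compares the \<open>lam i\<close> only with eigenvalues of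
  orthogonal eigenvectors. The minimum of the form over the orthogonal complement is attained at
  such an eigenvector, so the comparison extends to every vector there.\<close>

lemma form_ge_on_orthogonal:
  assumes M: "M \<in> carrier_mat n n" "sym_mat M" and V: "V \<in> carrier_mat n k"
    and eig: "\<And>i. i < k \<Longrightarrow> M *\<^sub>v col V i = lam i \<cdot>\<^sub>v col V i"
    and low: "\<And>x \<mu>. x \<in> carrier_vec n \<Longrightarrow> x \<noteq> 0\<^sub>v n \<Longrightarrow> M *\<^sub>v x = \<mu> \<cdot>\<^sub>v x \<Longrightarrow> (\<And>i. i < k \<Longrightarrow> x \<bullet> col V i = 0) \<Longrightarrow> a \<le> \<mu>"
    and w: "w \<in> carrier_vec n" "\<And>i. i < k \<Longrightarrow> w \<bullet> col V i = 0"
  shows "a * (w \<bullet> w) \<le> w \<bullet> (M *\<^sub>v w)"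
proof (cases "w = 0\<^sub>v n")
  case True thus ?thesis using M by simp
next
  case False
  let ?W = "col V ` {..<k}"
  have c: "col V i \<in> carrier_vec n" for i using V by auto
  have W: "?W \<subseteq> carrier_vec n" using c by auto
  have ew: "\<And>v. v \<in> ?W \<Longrightarrow> \<exists>l. M *\<^sub>v v = l \<cdot>\<^sub>v v" using eig by auto
  have ow: "\<And>v. v \<in> ?W \<Longrightarrow> v \<bullet> w = 0" using w comm_scalar_prod[OF w(1) c] by auto
  obtain x \<mu> where x: "x \<in> carrier_vec n" "x \<bullet> x = 1" "\<And>v. v \<in> ?W \<Longrightarrow> v \<bullet> x = 0" "M *\<^sub>v x = \<mu> \<cdot>\<^sub>v x"
    "\<And>y. y \<in> carrier_vec n \<Longrightarrow> (\<And>w. w \<in> ?W \<Longrightarrow> w \<bullet> y = 0) \<Longrightarrow> \<mu> * (y \<bullet> y) \<le> y \<bullet> (M *\<^sub>v y)"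
    using ex_min_eigenvector_orthogonal[OF M W ew w(1) False ow] by metis
  have "x \<noteq> 0\<^sub>v n" using x(2) by auto
  moreover have "x \<bullet> col V i = 0" if "i < k" for i
    using x(3)[of "col V i"] comm_scalar_prod[OF x(1) c] that by auto
  ultimately have "a \<le> \<mu>" using low[OF x(1) _ x(4)] by auto
  hence "a * (w \<bullet> w) \<le> \<mu> * (w \<bullet> w)" by (intro mult_right_mono) auto
  also have "\<dots> \<le> w \<bullet> (M *\<^sub>v w)" using x(5)[OF w(1) ow] by auto
  finally show ?thesis .
qed

text \<open>The range of \<open>Th\<close> contains a nonzero vector orthogonal to the \<open>k - 1\<close> columns of \<open>V\<close>
  other than the \<open>i\<close>-th one; its Rayleigh quotient is at least \<open>lam i\<close>.\<close>

lemma kth_eigenvalue_le: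
  assumes M: "M \<in> carrier_mat n n" "sym_mat M" and V: "V \<in> carrier_mat n k" "V\<^sup>T * V = 1\<^sub>m k"
    and eig: "\<And>i. i < k \<Longrightarrow> M *\<^sub>v col V i = lam i \<cdot>\<^sub>v col V i"
    and low: "\<And>x \<mu>. x \<in> carrier_vec n \<Longrightarrow> x \<noteq> 0\<^sub>v n \<Longrightarrow> M *\<^sub>v x = \<mu> \<cdot>\<^sub>v x \<Longrightarrow> (\<And>i. i < k \<Longrightarrow> x \<bullet> col V i = 0) \<Longrightarrow> lam i \<le> \<mu>"
    and i: "i < k"
    and Th: "Th \<in> carrier_mat n k" "Th\<^sup>T * Th = 1\<^sub>m k"
    and up: "\<And>c. c \<in> carrier_vec k \<Longrightarrow> (Th *\<^sub>v c) \<bullet> (M *\<^sub>v (Th *\<^sub>v c)) \<le> b * (c \<bullet> c)"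
  shows "lam i \<le> b"
proof -
  define B where "B = mat\<^sub>r (k - 1) k (\<lambda>j. row (V\<^sup>T * Th) (if j < i then j else Suc j))"
  obtain c where c: "c \<in> carrier_vec k" "c \<noteq> 0\<^sub>v k" "B *\<^sub>v c = 0\<^sub>v (k - 1)"
    using ex_orthogonal_vec[of B "k - 1" k] i by (auto simp: B_def)
  define x where "x = Th *\<^sub>v c"
  have x: "x \<in> carrier_vec n" using Th c by (auto simp: x_def)
  have cV: "col V j \<in> carrier_vec n" for j using V by auto
  have orth: "x \<bullet> col V j = 0" if j: "j < k" "j \<noteq> i" for j
  proof -
    define j' where "j' = (if j < i then j else j - 1)"
    have j': "j' < k - 1" "(if j' < i then j' else Suc j') = j" using j i by (auto simp: j'_def)
    have "(B *\<^sub>v c) $ j' = row (V\<^sup>T * Th) j \<bullet> c" using j' Th V j by (auto simp: B_def)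
    also have "\<dots> = ((V\<^sup>T * Th) *\<^sub>v c) $ j" using j V by simp
    also have "\<dots> = (V\<^sup>T *\<^sub>v x) $ j" using V Th c unfolding x_def
      by (simp add: assoc_mult_mat_vec[of _ k n _ k])
    also have "\<dots> = col V j \<bullet> x" using j V by simp
    finally show ?thesis using c(3) j' comm_scalar_prod[OF x cV] by simp
  qed
  define \<alpha> where "\<alpha> = x \<bullet> col V i"
  define w where "w = x - \<alpha> \<cdot>\<^sub>v col V i"
  have w: "w \<in> carrier_vec n" using x V by (auto simp: w_def)
  have vi: "col V i \<bullet> col V i = 1" using orthonormal_col[OF V(2,1) i i] by simp
  have w0: "w \<bullet> col V j = 0" if "j < k" for j
    using orth[OF that] orthonormal_col[OF V(2,1) i that] x cV
    by (cases "j = i") (auto simp: w_def \<alpha>_def minus_scalar_prod_distrib[of _ n])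
  have xw: "x = w + \<alpha> \<cdot>\<^sub>v col V i" using x V by (auto simp: w_def)
  have viw: "col V i \<bullet> w = 0" using w0[OF i] comm_scalar_prod[OF w cV] by simp
  have "col V i \<bullet> (M *\<^sub>v w) = 0"
    using sym_mat_scalar_prod[OF M w cV[of i]] eig[OF i] viw w cV[of i] by simp
  hence "x \<bullet> (M *\<^sub>v x) = w \<bullet> (M *\<^sub>v w) + \<alpha>\<^sup>2 * lam i"
    using form_add_smult[OF M w cV[of i], of \<alpha>] eig[OF i] vi cV[of i] unfolding xw[symmetric] by simp
  moreover have "x \<bullet> x = w \<bullet> w + \<alpha>\<^sup>2"
    using form_add_smult[of "1\<^sub>m n" n w "col V i" \<alpha>] w cV[of i] viw vi x unfolding xw[symmetric] by (simp add: sym_mat_def)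
  moreover have "lam i * (w \<bullet> w) \<le> w \<bullet> (M *\<^sub>v w)"
    by (rule form_ge_on_orthogonal[OF M V(1) eig low w w0])
  ultimately have "lam i * (x \<bullet> x) \<le> x \<bullet> (M *\<^sub>v x)" by (simp add: algebra_simps)
  also have "\<dots> \<le> b * (c \<bullet> c)" using up[OF c(1)] by (simp add: x_def)
  also have "c \<bullet> c = x \<bullet> x"
    using orthonormal_vnorm[OF Th c(1)] vnorm_sq[of c] vnorm_sq[of x] by (simp add: x_def)
  finally have "lam i * (x \<bullet> x) \<le> b * (x \<bullet> x)" .
  moreover have "x \<bullet> x > 0" using \<open>c \<bullet> c = x \<bullet> x\<close> self_scalar_prod_eq_0[OF c(1)] c(2) self_scalar_prod_nonneg[of c] by linarith
  ultimately show ?thesis by simp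
qed

section \<open>Subspace perturbation and orthogonal alignment\<close>

lemma orthonormal_transpose_mult_vec:
  assumes "Th \<in> carrier_mat n k" "Th\<^sup>T * Th = 1\<^sub>m k" "c \<in> carrier_vec k"
  shows "Th\<^sup>T *\<^sub>v (Th *\<^sub>v c) = (c :: real vec)"
  using assms assoc_mult_mat_vec[of "Th\<^sup>T" k n Th k c] by simp

lemma proj_complement_vec:
  assumes Th: "Th \<in> carrier_mat n k" "Th\<^sup>T * Th = 1\<^sub>m k" and x: "x \<in> carrier_vec n"
    and y: "y = x - Th *\<^sub>v (Th\<^sup>T *\<^sub>v x)"
  shows "Th\<^sup>T *\<^sub>v y = 0\<^sub>v k"
    and "(vnorm y)\<^sup>2 = (vnorm x)\<^sup>2 - (vnorm (Th\<^sup>T *\<^sub>v x))\<^sup>2"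
    and "vnorm y \<le> vnorm x"
proof -
  let ?c = "Th\<^sup>T *\<^sub>v x"
  have c: "?c \<in> carrier_vec k" "Th *\<^sub>v ?c \<in> carrier_vec n" using Th x by auto
  show 0: "Th\<^sup>T *\<^sub>v y = 0\<^sub>v k"
    unfolding y using Th x c orthonormal_transpose_mult_vec[OF Th c(1)]
    by (simp add: mult_minus_distrib_mat_vec[of _ k n])
  have yc: "y \<in> carrier_vec n" using x c by (auto simp: y)
  have "(Th *\<^sub>v ?c) \<bullet> y = ?c \<bullet> (Th\<^sup>T *\<^sub>v y)"
    using scalar_prod_mult_mat[of "Th\<^sup>T" k n y ?c] Th yc c by simp
  hence cy: "(Th *\<^sub>v ?c) \<bullet> y = 0" using 0 c by simp
  have "x = y + Th *\<^sub>v ?c" unfolding y using x c Th(1) by (intro eq_vecI) auto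
  hence "x \<bullet> x = (y + Th *\<^sub>v ?c) \<bullet> (y + Th *\<^sub>v ?c)" by simp
  also have "\<dots> = y \<bullet> y + (Th *\<^sub>v ?c) \<bullet> (Th *\<^sub>v ?c)"
    using yc c cy comm_scalar_prod[OF yc c(2)]
    by (simp add: scalar_prod_add_distrib[of _ n] add_scalar_prod_distrib[of _ n])
  finally have "(vnorm x)\<^sup>2 = (vnorm y)\<^sup>2 + (vnorm ?c)\<^sup>2"
    using orthonormal_vnorm[OF Th c(1)] by (simp add: vnorm_sq[symmetric])
  thus 1: "(vnorm y)\<^sup>2 = (vnorm x)\<^sup>2 - (vnorm ?c)\<^sup>2" by simp
  show "vnorm y \<le> vnorm x" by (rule power2_le_imp_le) (use 1 in auto)
qed

text \<open>With \<open>\<Pi> = I - Th Th\<^sup>T\<close> and \<open>Y = \<Pi> V\<close> one has \<open>T' Y = Y \<Lambda> - \<Pi> (T - T') V\<close>. Since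
  \<open>T' \<ge> \<mu>\<close> on the range of \<open>\<Pi>\<close> and \<open>0 \<le> \<Lambda> \<le> b + e\<close>, this gives
  \<open>\<mu> \<parallel>Y\<parallel> \<le> (b + e) \<parallel>Y\<parallel> + e\<close>.\<close>

lemma is_Vk_davis_kahan:
  assumes T: "T \<in> carrier_mat n n" "sym_mat T" and T': "T' \<in> carrier_mat n n" "sym_mat T'"
    and Th: "Th \<in> carrier_mat n k" "Th\<^sup>T * Th = 1\<^sub>m k"
    and K: "K \<in> carrier_mat k k" "T' * Th = Th * K"
    and low: "\<And>y. y \<in> carrier_vec n \<Longrightarrow> Th\<^sup>T *\<^sub>v y = 0\<^sub>v k \<Longrightarrow> \<mu> * (y \<bullet> y) \<le> y \<bullet> (T' *\<^sub>v y)"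
    and up: "\<And>c. c \<in> carrier_vec k \<Longrightarrow> (Th *\<^sub>v c) \<bullet> (T' *\<^sub>v (Th *\<^sub>v c)) \<le> b * (c \<bullet> c)"
    and psd: "\<And>y. y \<in> carrier_vec n \<Longrightarrow> 0 \<le> y \<bullet> (T *\<^sub>v y)"
    and e: "op_bound e (T - T')" and gap: "0 \<le> b" "b + e < \<mu>"
    and Vk: "is_Vk T k V"
  shows "op_bound (e / (\<mu> - b - e)) (V - Th * (Th\<^sup>T * V))"
proof -
  note e0 = op_bound_nonneg[OF e]
  from Vk obtain lam where V: "V \<in> carrier_mat n k" "V\<^sup>T * V = 1\<^sub>m k"
    and eig: "\<And>i. i < k \<Longrightarrow> T *\<^sub>v col V i = lam i \<cdot>\<^sub>v col V i"
    and lo: "\<And>x \<mu> i. x \<in> carrier_vec n \<Longrightarrow> x \<noteq> 0\<^sub>v n \<Longrightarrow> T *\<^sub>v x = \<mu> \<cdot>\<^sub>v x \<Longrightarrow>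
       (\<And>i. i < k \<Longrightarrow> x \<bullet> col V i = 0) \<Longrightarrow> i < k \<Longrightarrow> lam i \<le> \<mu>"
    using carrier_matD(1)[OF T(1)] unfolding is_Vk_def Let_def by auto
  have lam_le: "lam i \<le> b + e" if i: "i < k" for i
  proof (rule kth_eigenvalue_le[OF T V eig _ i Th])
    show "lam i \<le> \<mu>" if "x \<in> carrier_vec n" "x \<noteq> 0\<^sub>v n" "T *\<^sub>v x = \<mu> \<cdot>\<^sub>v x" "\<And>i. i < k \<Longrightarrow> x \<bullet> col V i = 0" for x \<mu>
      using lo[OF that i] .
    fix c :: "real vec" assume c: "c \<in> carrier_vec k"
    let ?x = "Th *\<^sub>v c"
    have x: "?x \<in> carrier_vec n" using Th c by auto
    have "?x \<bullet> (T *\<^sub>v ?x) = ?x \<bullet> (T' *\<^sub>v ?x) + ?x \<bullet> ((T - T') *\<^sub>v ?x)"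
      using T T' x by (simp add: minus_mult_distrib_mat_vec[of _ n n] scalar_prod_minus_distrib[of _ n])
    also have "\<dots> \<le> b * (c \<bullet> c) + e * (?x \<bullet> ?x)"
      using up[OF c] form_le_op_bound[OF e minus_carrier_mat[OF T'(1)] x] by linarith
    also have "?x \<bullet> ?x = c \<bullet> c" using orthonormal_vnorm[OF Th c] vnorm_sq[of c] vnorm_sq[of ?x] by simp
    finally show "?x \<bullet> (T *\<^sub>v ?x) \<le> (b + e) * (c \<bullet> c)" by (simp add: algebra_simps)
  qed auto
  \<comment> \<open>Positivity makes \<open>b + e\<close> a bound for the absolute values, hence for
    the norm of the diagonal matrix \<open>?L\<close>.\<close>
  have lam_ge: "0 \<le> lam i" if i: "i < k" for i
  proof -
    have c: "col V i \<in> carrier_vec n" using V by auto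
    show ?thesis using psd[OF c] eigen_form[OF eig[OF i] _ c] orthonormal_col[OF V(2,1) i i] by simp
  qed
  let ?L = "mat_diag k lam"
  have TV: "T * V = V * ?L"
  proof (rule eq_matI)
    fix i j assume "i < dim_row (V * ?L)" "j < dim_col (V * ?L)"
    hence ij: "i < n" "j < k" using V by (auto simp: mat_diag_def)
    have "(T * V) $$ (i,j) = (T *\<^sub>v col V j) $ i" using ij T V by simp
    also have "\<dots> = lam j * V $$ (i,j)" using ij eig[OF ij(2)] V by simp
    finally show "(T * V) $$ (i,j) = (V * ?L) $$ (i,j)"
      using ij V by (simp add: mat_diag_mult_right[OF V(1)])
  qed (use T V in \<open>auto simp: mat_diag_def\<close>)
  define Y where "Y = V - Th * (Th\<^sup>T * V)"
  have Y: "Y \<in> carrier_mat n k" using V Th by (auto simp: Y_def)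
  have Yc: "Y *\<^sub>v c = V *\<^sub>v c - Th *\<^sub>v (Th\<^sup>T *\<^sub>v (V *\<^sub>v c))" if "c \<in> carrier_vec k" for c
    using V Th that unfolding Y_def
    by (simp add: minus_mult_distrib_mat_vec[of _ n k] assoc_mult_mat_vec[of _ n k _ k] assoc_mult_mat_vec[of _ k n _ k]
        mult_carrier_mat[of _ n k _ k] mult_carrier_mat[of _ k n _ k])
  define N where "N = spec_norm Y"
  \<comment> \<open>Any finite bound would do: it makes \<open>N\<close> the least bound of
    \<open>Y\<close>, for which \<open>main\<close> becomes an inequality to be solved.\<close>
  have "op_bound 1 Y"
  proof (rule op_boundI[OF Y])
    fix c :: "real vec" assume c: "c \<in> carrier_vec k"
    have "V *\<^sub>v c \<in> carrier_vec n" using V c by auto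
    from proj_complement_vec(3)[OF Th this Yc[OF c]] show "vnorm (Y *\<^sub>v c) \<le> 1 * vnorm c"
      using orthonormal_vnorm[OF V c] by simp
  qed auto
  hence N: "op_bound N Y" unfolding N_def by (rule op_bound_spec_norm)
  have N0: "0 \<le> N" using op_bound_nonneg[OF N] .
  \<comment> \<open>\<open>K\<close> equals \<open>Th\<^sup>T T' Th\<close> and is therefore
    symmetric; transposing \<open>T' Th = Th K\<close> then shows that \<open>T'\<close> commutes
    with the projection onto the range of \<open>Th\<close>.\<close>
  have Kt: "Th\<^sup>T * T' = K * Th\<^sup>T"
  proof -
    have tc: "Th\<^sup>T \<in> carrier_mat k n" using Th by auto
    have "K = Th\<^sup>T * (Th * K)"
      using assoc_mult_mat[OF tc Th(1) K(1)] Th K by simp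
    hence K1: "K = Th\<^sup>T * (T' * Th)" using K by simp
    have "K\<^sup>T = (T' * Th)\<^sup>T * (transpose_mat Th)\<^sup>T"
      by (subst K1, rule transpose_mult[of _ k n _ k]) (use Th T' in auto)
    also have "\<dots> = Th\<^sup>T * T' * Th"
      using transpose_mult[OF T'(1) Th(1)] T' by (simp add: sym_mat_def)
    also have "\<dots> = K" using K1 assoc_mult_mat[OF tc T'(1) Th(1)] by simp
    finally have Ks: "K\<^sup>T = K" .
    have "Th\<^sup>T * T' = (T' * Th)\<^sup>T"
      using transpose_mult[OF T'(1) Th(1)] T' by (simp add: sym_mat_def)
    also have "\<dots> = K * Th\<^sup>T" unfolding K(2) transpose_mult[OF Th(1) K(1)] Ks ..
    finally show ?thesis .
  qed
  have comm: "T' *\<^sub>v (Th *\<^sub>v (Th\<^sup>T *\<^sub>v x)) = Th *\<^sub>v (Th\<^sup>T *\<^sub>v (T' *\<^sub>v x))"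
    if x: "x \<in> carrier_vec n" for x
  proof -
    have tc: "Th\<^sup>T \<in> carrier_mat k n" using Th by auto
    have c: "Th\<^sup>T *\<^sub>v x \<in> carrier_vec k" using tc x by auto
    have "T' *\<^sub>v (Th *\<^sub>v (Th\<^sup>T *\<^sub>v x)) = (T' * Th) *\<^sub>v (Th\<^sup>T *\<^sub>v x)"
      using assoc_mult_mat_vec[OF T'(1) Th(1) c] by simp
    also have "\<dots> = Th *\<^sub>v (K *\<^sub>v (Th\<^sup>T *\<^sub>v x))"
      unfolding K(2) using assoc_mult_mat_vec[OF Th(1) K(1) c] by simp
    also have "K *\<^sub>v (Th\<^sup>T *\<^sub>v x) = (K * Th\<^sup>T) *\<^sub>v x"
      using assoc_mult_mat_vec[OF K(1) tc x] by simp
    also have "\<dots> = Th\<^sup>T *\<^sub>v (T' *\<^sub>v x)"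
      unfolding Kt[symmetric] using assoc_mult_mat_vec[OF tc T'(1) x] by simp
    finally show ?thesis .
  qed
  have main: "vnorm (Y *\<^sub>v c) \<le> ((N * (b + e) + e) / \<mu>) * vnorm c" if c: "c \<in> carrier_vec k" for c
  proof -
    define y where "y = Y *\<^sub>v c"
    define v where "v = V *\<^sub>v c"
    define E where "E = (T - T') *\<^sub>v v"
    define q where "q = E - Th *\<^sub>v (Th\<^sup>T *\<^sub>v E)"
    have tc: "Th\<^sup>T \<in> carrier_mat k n" using Th by auto
    have v: "v \<in> carrier_vec n" unfolding v_def using V c by simp
    have y: "y \<in> carrier_vec n" unfolding y_def using Y c by simp
    have Ec: "E \<in> carrier_vec n" unfolding E_def by (rule mult_mat_vec_carrier[OF minus_carrier_mat[OF T'(1)] v])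
    have Lc: "?L *\<^sub>v c \<in> carrier_vec k" by (rule mult_mat_vec_carrier[OF mat_diag_dim c])
    have T'v: "T' *\<^sub>v v \<in> carrier_vec n" using T' v by simp
    have yv: "y = v - Th *\<^sub>v (Th\<^sup>T *\<^sub>v v)" unfolding y_def v_def by (rule Yc[OF c])
    have q: "q \<in> carrier_vec n" using Ec Th by (auto simp: q_def)
    have Tv: "T *\<^sub>v v = V *\<^sub>v (?L *\<^sub>v c)"
      unfolding v_def using assoc_mult_mat_vec[OF T(1) V(1) c] assoc_mult_mat_vec[OF V(1) mat_diag_dim c, of lam] TV by simp
    have Evv: "E = T *\<^sub>v v - T' *\<^sub>v v" unfolding E_def by (rule minus_mult_distrib_mat_vec[OF T(1) T'(1) v])
    have "T' *\<^sub>v y = T' *\<^sub>v v - Th *\<^sub>v (Th\<^sup>T *\<^sub>v (T' *\<^sub>v v))"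
      unfolding yv using Th v comm[OF v] by (simp add: mult_minus_distrib_mat_vec[OF T'(1)])
    also have "\<dots> = Y *\<^sub>v (?L *\<^sub>v c) - q"
    proof -
      have Tvc: "T *\<^sub>v v \<in> carrier_vec n" using T v by auto
      have "q = E - Th *\<^sub>v (Th\<^sup>T *\<^sub>v (T *\<^sub>v v) - Th\<^sup>T *\<^sub>v (T' *\<^sub>v v))"
        unfolding q_def Evv by (simp add: mult_minus_distrib_mat_vec[OF tc Tvc T'v])
      also have "\<dots> = E - (Th *\<^sub>v (Th\<^sup>T *\<^sub>v (T *\<^sub>v v)) - Th *\<^sub>v (Th\<^sup>T *\<^sub>v (T' *\<^sub>v v)))"
        by (subst mult_minus_distrib_mat_vec[OF Th(1)]) (use tc Tvc T'v in auto)
      finally have "q = E - (Th *\<^sub>v (Th\<^sup>T *\<^sub>v (T *\<^sub>v v)) - Th *\<^sub>v (Th\<^sup>T *\<^sub>v (T' *\<^sub>v v)))" .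
      moreover have "Y *\<^sub>v (?L *\<^sub>v c) = T *\<^sub>v v - Th *\<^sub>v (Th\<^sup>T *\<^sub>v (T *\<^sub>v v))"
        unfolding Yc[OF Lc] Tv ..
      moreover have "Th *\<^sub>v (Th\<^sup>T *\<^sub>v (T *\<^sub>v v)) \<in> carrier_vec n" "Th *\<^sub>v (Th\<^sup>T *\<^sub>v (T' *\<^sub>v v)) \<in> carrier_vec n"
        using Th tc Tvc T'v by (simp_all add: mult_mat_vec_carrier[of _ n k])
      ultimately show ?thesis using Tvc T'v Th(1) T(1) T'(1) unfolding Evv by (intro eq_vecI) auto
    qed
    finally have T'y: "T' *\<^sub>v y = Y *\<^sub>v (?L *\<^sub>v c) - q" .
    have "vnorm (?L *\<^sub>v c) \<le> (b + e) * vnorm c"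
    proof -
      have "(?L *\<^sub>v c) \<bullet> (?L *\<^sub>v c) = (\<Sum>i = 0..<k. (lam i * c $ i)\<^sup>2)"
      proof -
        have "(?L *\<^sub>v c) $ i = lam i * c $ i" if "i < k" for i
        proof -
          have "(?L *\<^sub>v c) $ i = (\<Sum>j = 0..<k. (if i = j then lam j else 0) * c $ j)"
            using that c by (auto simp: mat_diag_def scalar_prod_def intro!: sum.cong)
          also have "\<dots> = lam i * c $ i" using that by (subst sum.remove[of _ i]) auto
          finally show ?thesis .
        qed
        hence "(?L *\<^sub>v c) $ i * (?L *\<^sub>v c) $ i = (lam i * c $ i)\<^sup>2" if "i < k" for i
          using that by (simp only: power2_eq_square)
        thus ?thesis unfolding scalar_prod_def carrier_vecD[OF Lc] by (intro sum.cong) (simp_all del: index_mult_mat_vec)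
      qed
      also have "\<dots> \<le> (\<Sum>i = 0..<k. ((b + e) * c $ i)\<^sup>2)"
      proof (intro sum_mono)
        fix i assume "i \<in> {0..<k}"
        hence "(lam i)\<^sup>2 \<le> (b + e)\<^sup>2" using lam_le lam_ge by (intro power_mono) auto
        thus "(lam i * c $ i)\<^sup>2 \<le> ((b + e) * c $ i)\<^sup>2" by (simp add: power_mult_distrib mult_right_mono)
      qed
      also have "\<dots> = ((b + e) * vnorm c)\<^sup>2"
        unfolding power_mult_distrib vnorm_sq sum_distrib_left[symmetric] using c
        by (simp add: scalar_prod_def power2_eq_square)
      finally have "(vnorm (?L *\<^sub>v c))\<^sup>2 \<le> ((b + e) * vnorm c)\<^sup>2" by (simp add: vnorm_sq)
      thus ?thesis by (rule power2_le_imp_le) (use gap e0 in auto)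
    qed
    hence "N * vnorm (?L *\<^sub>v c) \<le> N * ((b + e) * vnorm c)" using N0 by (intro mult_left_mono)
    hence 1: "vnorm (Y *\<^sub>v (?L *\<^sub>v c)) \<le> N * (b + e) * vnorm c"
      using op_boundD[OF N Y Lc] by (simp add: mult.assoc)
    have "vnorm q \<le> vnorm E" by (rule proj_complement_vec(3)[OF Th Ec q_def])
    also have "\<dots> \<le> e * vnorm c"
      using op_boundD[OF e minus_carrier_mat[OF T'(1)] v] orthonormal_vnorm[OF V c] by (simp add: E_def v_def)
    finally have 2: "vnorm q \<le> e * vnorm c" .
    have T'yc: "T' *\<^sub>v y \<in> carrier_vec n" using T' y by auto
    have "\<mu> * (y \<bullet> y) \<le> y \<bullet> (T' *\<^sub>v y)" using low[OF y] proj_complement_vec(1)[OF Th v yv] by auto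
    also have "\<dots> \<le> vnorm y * vnorm (T' *\<^sub>v y)" using abs_scalar_prod_le[OF y T'yc] by linarith
    finally have "(\<mu> * vnorm y) * vnorm y \<le> vnorm (T' *\<^sub>v y) * vnorm y"
      using vnorm_sq[of y] by (simp add: power2_eq_square mult_ac)
    hence "\<mu> * vnorm y \<le> vnorm (T' *\<^sub>v y)"
      using vnorm_nonneg[of y] by (cases "vnorm y = 0") (auto simp: less_le)
    also have "\<dots> \<le> vnorm (Y *\<^sub>v (?L *\<^sub>v c)) + vnorm q"
      unfolding T'y by (rule vnorm_diff_le[of _ n]) (use Y Lc q in auto)
    also have "\<dots> \<le> (N * (b + e) + e) * vnorm c" using 1 2 by (simp add: algebra_simps)
    finally show ?thesis using gap e0 by (simp add: y_def field_simps)
  qed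
  have mu: "\<mu> > 0" using gap e0 by linarith
  have "op_bound ((N * (b + e) + e) / \<mu>) Y"
    by (rule op_boundI[OF Y _ main]) (use N0 gap e0 mu in auto)
  from spec_norm_le[OF this] have "N \<le> (N * (b + e) + e) / \<mu>" by (simp add: N_def)
  \<comment> \<open>The inequality \<open>N \<mu> \<le> N (b + e) + e\<close> can be solved for
    \<open>N\<close> because the gap is positive.\<close>
  hence "N \<le> e / (\<mu> - b - e)" using gap mu by (simp add: field_simps)
  from op_bound_mono[OF N this] show ?thesis by (simp add: Y_def)
qed

text \<open>\<open>Q\<close> is the orthogonal factor of the polar decomposition of \<open>Th\<^sup>T V\<close>.\<close>

lemma procrustes_alignment:
  assumes Th: "Th \<in> carrier_mat n k" "Th\<^sup>T * Th = 1\<^sub>m k"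
    and V: "V \<in> carrier_mat n k" "V\<^sup>T * V = 1\<^sub>m k"
    and s: "op_bound \<sigma> (V - Th * (Th\<^sup>T * V))" "\<sigma> < 1"
  obtains Q where "orth_mat k Q" "op_bound (\<sigma> + \<sigma>\<^sup>2) (V - Th * Q)"
proof -
  have s0: "0 \<le> \<sigma>" using op_bound_nonneg[OF s(1)] .
  define B where "B = Th\<^sup>T * V"
  define G where "G = B\<^sup>T * B"
  define Y where "Y = V - Th * B"
  have B: "B \<in> carrier_mat k k" using Th V by (auto simp: B_def)
  have G: "G \<in> carrier_mat k k" using B by (auto simp: G_def)
  have ThB: "Th * B \<in> carrier_mat n k" using Th B by auto
  have Y: "Y \<in> carrier_mat n k" using minus_carrier_mat[OF ThB] by (auto simp: Y_def)
  have Yb: "op_bound \<sigma> Y" using s(1) by (simp add: Y_def B_def)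
  have Gs: "sym_mat G" unfolding sym_mat_def G_def using B by (subst transpose_mult[of _ k k _ k]) auto
  \<comment> \<open>By Pythagoras, projecting \<open>V c\<close> onto the range of \<open>Th\<close>
    loses exactly \<open>Y c\<close>; so \<open>G\<close> lies between
    \<open>1 - \<sigma>\<^sup>2\<close> and 1 and \<open>B\<close> is nearly orthogonal.\<close>
  have form: "c \<bullet> (G *\<^sub>v c) = c \<bullet> c - (vnorm (Y *\<^sub>v c))\<^sup>2" if c: "c \<in> carrier_vec k" for c
  proof -
    have Vc: "V *\<^sub>v c \<in> carrier_vec n" using V c by auto
    have Bc: "B *\<^sub>v c = Th\<^sup>T *\<^sub>v (V *\<^sub>v c)" unfolding B_def
      using Th V c by (simp add: assoc_mult_mat_vec[of _ k n _ k])
    have Yc: "Y *\<^sub>v c = V *\<^sub>v c - Th *\<^sub>v (Th\<^sup>T *\<^sub>v (V *\<^sub>v c))"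
      unfolding Y_def minus_mult_distrib_mat_vec[OF V(1) ThB c] Bc[symmetric]
      using assoc_mult_mat_vec[OF Th(1) B c] by simp
    have "G *\<^sub>v c = B\<^sup>T *\<^sub>v (B *\<^sub>v c)"
      unfolding G_def using B c by (simp add: assoc_mult_mat_vec[of _ k k _ k])
    hence "c \<bullet> (G *\<^sub>v c) = (B *\<^sub>v c) \<bullet> (B *\<^sub>v c)"
      using scalar_prod_mult_mat[of "B\<^sup>T" k k "B *\<^sub>v c" c] B c by simp
    also have "\<dots> = (vnorm (B *\<^sub>v c))\<^sup>2" by (simp add: vnorm_sq)
    also have "\<dots> = (vnorm c)\<^sup>2 - (vnorm (Y *\<^sub>v c))\<^sup>2"
      using proj_complement_vec(2)[OF Th Vc Yc] Bc orthonormal_vnorm[OF V c] by simp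
    finally show ?thesis by (simp add: vnorm_sq)
  qed
  have Ysq: "(vnorm (Y *\<^sub>v c))\<^sup>2 \<le> \<sigma>\<^sup>2 * (c \<bullet> c)" if c: "c \<in> carrier_vec k" for c
    using power_mono[OF op_boundD[OF Yb Y c], of 2] by (simp add: power_mult_distrib vnorm_sq)
  have s2: "0 < 1 - \<sigma>\<^sup>2" using s0 s(2) by (simp add: abs_square_less_1)
  have low: "(1 - \<sigma>\<^sup>2) * (c \<bullet> c) \<le> c \<bullet> (G *\<^sub>v c)" if "c \<in> carrier_vec k" for c
    using form[OF that] Ysq[OF that] by (simp add: algebra_simps)
  define S where "S = inv_sqrt_mat G"
  obtain R where R: "pos_def_mat k S" "R \<in> carrier_mat k k" "sym_mat R" "R * R = G" "R * S = 1\<^sub>m k" "S * R = 1\<^sub>m k"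
    "\<And>x. x \<in> carrier_vec k \<Longrightarrow> sqrt (1 - \<sigma>\<^sup>2) * (x \<bullet> x) \<le> x \<bullet> (R *\<^sub>v x)"
    using inv_sqrt_mat_props[OF G Gs s2 low] unfolding S_def by metis
  note S = pos_def_matD(1,2)[OF R(1)]
  define Q where "Q = B * S"
  have Q: "Q \<in> carrier_mat k k" using B S by (auto simp: Q_def)
  have "Q\<^sup>T * Q = (S * B\<^sup>T) * (B * S)"
    unfolding Q_def transpose_mult[OF B S(1)] using S(2) by (simp add: sym_mat_def)
  also have "\<dots> = S * (G * S)" unfolding G_def using B S
    by (simp add: assoc_mult_mat[of _ k k _ k _ k] mult_carrier_mat[of _ k k _ k])
  also have "\<dots> = (S * R) * (R * S)" unfolding R(4)[symmetric] using R(2) S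
    by (simp add: assoc_mult_mat[of _ k k _ k _ k] mult_carrier_mat[of _ k k _ k] del: R(5,6))
  finally have QQ: "Q\<^sup>T * Q = 1\<^sub>m k" unfolding R(5,6) by simp
  \<comment> \<open>The denominator adds the lower bounds 0 of \<open>R\<close> and 1 of the
    identity. Since \<open>R * R\<close> is within \<open>\<sigma>\<^sup>2\<close> of the identity,
    replacing \<open>B\<close> by \<open>Q\<close> costs only a second-order term.\<close>
  have "op_bound (\<sigma>\<^sup>2 / (0 + 1)) (R - 1\<^sub>m k)"
  proof (rule op_bound_sqrt_diff[OF R(2,3)])
    show "sym_mat (1\<^sub>m k)" by (simp add: sym_mat_def)
    fix x :: "real vec" assume x: "x \<in> carrier_vec k"
    show "0 * (x \<bullet> x) \<le> x \<bullet> (R *\<^sub>v x)"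
      using order_trans[OF mult_nonneg_nonneg R(7)[OF x]] s2 by simp
    have "x \<bullet> ((R * R - 1\<^sub>m k * 1\<^sub>m k) *\<^sub>v x) = - ((vnorm (Y *\<^sub>v x))\<^sup>2)"
      using form[OF x] x G unfolding R(4)
      by (simp add: minus_mult_distrib_mat_vec[of _ k k] scalar_prod_minus_distrib[of _ k])
    thus "\<bar>x \<bullet> ((R * R - 1\<^sub>m k * 1\<^sub>m k) *\<^sub>v x)\<bar> \<le> \<sigma>\<^sup>2 * (x \<bullet> x)" using Ysq[OF x] by simp
  qed auto
  hence "op_bound (1 * (1 * \<sigma>\<^sup>2)) (Th * (Q * (R - 1\<^sub>m k)))"
    using op_bound_orthonormal[OF Th] op_bound_orthonormal[OF Q QQ] Th Q
    by (intro op_bound_mult[of _ _ _ _ n k k] op_bound_mult[of _ Q _ _ k k k]) auto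
  hence "op_bound (\<sigma> + 1 * (1 * \<sigma>\<^sup>2)) (Y + Th * (Q * (R - 1\<^sub>m k)))"
    by (rule op_bound_add[OF Yb _ Y]) (use Th Q in \<open>auto simp: mult_carrier_mat[of _ n k]\<close>)
  moreover have "Y + Th * (Q * (R - 1\<^sub>m k)) = V - Th * Q"
  proof -
    have "Q * R = B * (S * R)" unfolding Q_def using B S R(2) by (simp add: assoc_mult_mat[of _ k k _ k _ k] del: R(6))
    hence QR: "Q * R = B" using B unfolding R(6) by simp
    have "Q * (R - 1\<^sub>m k) = B - Q" using mult_minus_distrib_mat[OF Q R(2) one_carrier_mat] QR Q by simp
    hence "Th * (Q * (R - 1\<^sub>m k)) = Th * B - Th * Q" using mult_minus_distrib_mat[OF Th(1) B Q] by simp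
    moreover have "Th * Q \<in> carrier_mat n k" using Th Q by auto
    ultimately show ?thesis unfolding Y_def using V ThB Th(1) Q B by (intro eq_matI) auto
  qed
  ultimately show ?thesis using that[of Q] Q QQ by (simp add: orth_mat_def)
qed

section \<open>Quadratic forms of shifted and conjugated matrices\<close>

lemma shift_carrier: "L \<in> carrier_mat n n \<Longrightarrow> L + t \<cdot>\<^sub>m 1\<^sub>m n \<in> carrier_mat n n" for t :: real
  by auto

lemma shift_sym: "L \<in> carrier_mat n n \<Longrightarrow> sym_mat L \<Longrightarrow> sym_mat (L + t \<cdot>\<^sub>m 1\<^sub>m n)"
  unfolding sym_mat_def by (subst transpose_add[of _ n n]) (auto intro!: eq_matI)

lemma shift_mult_vec:
  assumes "L \<in> carrier_mat n n" "x \<in> carrier_vec n"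
  shows "(L + t \<cdot>\<^sub>m 1\<^sub>m n) *\<^sub>v x = L *\<^sub>v x + (t::real) \<cdot>\<^sub>v x"
proof -
  have "(t \<cdot>\<^sub>m 1\<^sub>m n) *\<^sub>v x = t \<cdot>\<^sub>v x" using assms(2) by (intro eq_vecI) (auto simp: smult_scalar_prod_distrib[of _ n])
  thus ?thesis using assms by (simp add: add_mult_distrib_mat_vec[of _ n n])
qed

lemma shift_form:
  assumes "L \<in> carrier_mat n n" "x \<in> carrier_vec n"
  shows "x \<bullet> ((L + t \<cdot>\<^sub>m 1\<^sub>m n) *\<^sub>v x) = x \<bullet> (L *\<^sub>v x) + (t::real) * (x \<bullet> x)"
  using assms by (simp add: shift_mult_vec scalar_prod_add_distrib[of _ n])

lemma sandwich_form:
  assumes S: "S \<in> carrier_mat n n" "sym_mat S" and M: "M \<in> carrier_mat n n" and x: "x \<in> carrier_vec n"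
  shows "x \<bullet> ((S * M * S) *\<^sub>v x) = (S *\<^sub>v x) \<bullet> (M *\<^sub>v (S *\<^sub>v x))"
proof -
  have c: "M *\<^sub>v (S *\<^sub>v x) \<in> carrier_vec n" using S M x by auto
  have "(S * M * S) *\<^sub>v x = S *\<^sub>v (M *\<^sub>v (S *\<^sub>v x))"
    using S M x by (simp add: assoc_mult_mat_vec[of _ n n _ n] mult_carrier_mat[of _ n n _ n])
  thus ?thesis using sym_mat_scalar_prod[OF S c x] by simp
qed

lemma sandwich_sym:
  assumes S: "S \<in> carrier_mat n n" "sym_mat S" and M: "M \<in> carrier_mat n n" "sym_mat M"
  shows "sym_mat (S * M * S)"
proof -
  have SM: "S * M \<in> carrier_mat n n" using S M by auto
  have "(S * M * S)\<^sup>T = S * (M * S)"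
    using transpose_mult[OF SM S(1)] transpose_mult[OF S(1) M(1)] S(2) M(2) by (simp add: sym_mat_def)
  thus ?thesis using S M by (simp add: sym_mat_def assoc_mult_mat[of _ n n _ n _ n])
qed

section \<open>Perturbation of the SPONGE operator and of normalised Laplacians\<close>

lemma sponge_op_factor:
  assumes Lp: "Lp \<in> carrier_mat n n" "sym_mat Lp" and Lm: "Lm \<in> carrier_mat n n" "sym_mat Lm"
    and psd: "\<And>x. x \<in> carrier_vec n \<Longrightarrow> 0 \<le> x \<bullet> (Lp *\<^sub>v x)" "\<And>x. x \<in> carrier_vec n \<Longrightarrow> 0 \<le> x \<bullet> (Lm *\<^sub>v x)"
    and t: "0 < tp" "0 \<le> tm"
  defines "S \<equiv> inv_sqrt_mat (Lm + tp \<cdot>\<^sub>m 1\<^sub>m n)"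
  shows "sponge_op Lp Lm tp tm = S * (Lp + tm \<cdot>\<^sub>m 1\<^sub>m n) * S"
    and "pos_def_mat n S" "S * S * (Lm + tp \<cdot>\<^sub>m 1\<^sub>m n) = 1\<^sub>m n" "op_bound (1 / sqrt tp) S"
    and "sponge_op Lp Lm tp tm \<in> carrier_mat n n" "sym_mat (sponge_op Lp Lm tp tm)"
    and "\<And>x. x \<in> carrier_vec n \<Longrightarrow> 0 \<le> x \<bullet> (sponge_op Lp Lm tp tm *\<^sub>v x)"
proof -
  have low: "tp * (x \<bullet> x) \<le> x \<bullet> ((Lm + tp \<cdot>\<^sub>m 1\<^sub>m n) *\<^sub>v x)" if "x \<in> carrier_vec n" for x
    using shift_form[OF Lm(1) that, of tp] psd(2)[OF that] by simp
  show 1: "sponge_op Lp Lm tp tm = S * (Lp + tm \<cdot>\<^sub>m 1\<^sub>m n) * S"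
    using Lp by (simp add: sponge_op_def Let_def S_def)
  show 2: "pos_def_mat n S" "S * S * (Lm + tp \<cdot>\<^sub>m 1\<^sub>m n) = 1\<^sub>m n" "op_bound (1 / sqrt tp) S"
    unfolding S_def using inv_sqrt_mat_props[OF shift_carrier[OF Lm(1)] shift_sym[OF Lm] t(1) low] by metis+
  note Sc = pos_def_matD(1,2)[OF 2(1)]
  note M = shift_carrier[OF Lp(1), of tm] shift_sym[OF Lp, of tm]
  show "sponge_op Lp Lm tp tm \<in> carrier_mat n n" unfolding 1 using Sc M by (simp add: mult_carrier_mat[of _ n n _ n])
  show "sym_mat (sponge_op Lp Lm tp tm)" unfolding 1 by (rule sandwich_sym[OF Sc M])
  fix x :: "real vec" assume x: "x \<in> carrier_vec n"
  have Sx: "S *\<^sub>v x \<in> carrier_vec n" using Sc x by auto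
  show "0 \<le> x \<bullet> (sponge_op Lp Lm tp tm *\<^sub>v x)"
    unfolding 1 sandwich_form[OF Sc M(1) x] shift_form[OF Lp(1) Sx] using psd(1)[OF Sx] t by simp
qed

lemma shift_diff: "L \<in> carrier_mat n n \<Longrightarrow> K \<in> carrier_mat n n \<Longrightarrow>
    (L + t \<cdot>\<^sub>m 1\<^sub>m n) - (K + t \<cdot>\<^sub>m 1\<^sub>m n) = L - (K :: real mat)"
  by (intro eq_matI) auto

lemma sponge_op_perturbation:
  assumes Lp: "Lp \<in> carrier_mat n n" "sym_mat Lp" and Lm: "Lm \<in> carrier_mat n n" "sym_mat Lm"
    and Kp: "Kp \<in> carrier_mat n n" "sym_mat Kp" and Km: "Km \<in> carrier_mat n n" "sym_mat Km"
    and psdL: "\<And>x. x \<in> carrier_vec n \<Longrightarrow> 0 \<le> x \<bullet> (Lp *\<^sub>v x)" "\<And>x. x \<in> carrier_vec n \<Longrightarrow> 0 \<le> x \<bullet> (Lm *\<^sub>v x)"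
    and psdK: "\<And>x. x \<in> carrier_vec n \<Longrightarrow> 0 \<le> x \<bullet> (Kp *\<^sub>v x)" "\<And>x. x \<in> carrier_vec n \<Longrightarrow> 0 \<le> x \<bullet> (Km *\<^sub>v x)"
    and up: "op_bound 2 Lp" "op_bound 2 Kp"
    and t: "0 < tp" "0 \<le> tm"
    and D: "op_bound \<Delta> (Lp - Kp)" "op_bound \<Delta> (Lm - Km)"
  shows "op_bound (\<Delta> * ((2 + tm) / tp\<^sup>2 + 1 / tp)) (sponge_op Lp Lm tp tm - sponge_op Kp Km tp tm)"
    and "op_bound (\<Delta> / (2 * tp * sqrt tp)) (inv_sqrt_mat (Lm + tp \<cdot>\<^sub>m 1\<^sub>m n) - inv_sqrt_mat (Km + tp \<cdot>\<^sub>m 1\<^sub>m n))"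
proof -
  define S where "S = inv_sqrt_mat (Lm + tp \<cdot>\<^sub>m 1\<^sub>m n)"
  define S' where "S' = inv_sqrt_mat (Km + tp \<cdot>\<^sub>m 1\<^sub>m n)"
  define M where "M = Lp + tm \<cdot>\<^sub>m 1\<^sub>m n"
  define M' where "M' = Kp + tm \<cdot>\<^sub>m 1\<^sub>m n"
  note L = sponge_op_factor[OF Lp Lm psdL t, folded S_def M_def]
  note K = sponge_op_factor[OF Kp Km psdK t, folded S'_def M'_def]
  note Sc = pos_def_matD(1)[OF L(2)] and S'c = pos_def_matD(1)[OF K(2)]
  have Mc: "M \<in> carrier_mat n n" "M' \<in> carrier_mat n n" using Lp Kp by (auto simp: M_def M'_def)
  have SD: "op_bound (\<Delta> / (2 * tp * sqrt tp)) (S - S')" unfolding S_def S'_def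
  proof (rule op_bound_inv_sqrt_diff[OF shift_carrier[OF Lm(1)] shift_sym[OF Lm] shift_carrier[OF Km(1)] shift_sym[OF Km] t(1)])
    show "tp * (x \<bullet> x) \<le> x \<bullet> ((Lm + tp \<cdot>\<^sub>m 1\<^sub>m n) *\<^sub>v x)" if "x \<in> carrier_vec n" for x
      using shift_form[OF Lm(1) that, of tp] psdL(2)[OF that] by simp
    show "tp * (x \<bullet> x) \<le> x \<bullet> ((Km + tp \<cdot>\<^sub>m 1\<^sub>m n) *\<^sub>v x)" if "x \<in> carrier_vec n" for x
      using shift_form[OF Km(1) that, of tp] psdK(2)[OF that] by simp
  qed (simp add: shift_diff[OF Lm(1) Km(1)] D)
  thus "op_bound (\<Delta> / (2 * tp * sqrt tp)) (inv_sqrt_mat (Lm + tp \<cdot>\<^sub>m 1\<^sub>m n) - inv_sqrt_mat (Km + tp \<cdot>\<^sub>m 1\<^sub>m n))"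
    unfolding S_def S'_def .
  have "op_bound tm (tm \<cdot>\<^sub>m 1\<^sub>m n)"
  proof (rule op_boundI[of _ n n])
    fix x :: "real vec" assume x: "x \<in> carrier_vec n"
    have "(tm \<cdot>\<^sub>m 1\<^sub>m n) *\<^sub>v x = tm \<cdot>\<^sub>v x" using x by (intro eq_vecI) (auto simp: smult_scalar_prod_distrib[of _ n])
    thus "vnorm ((tm \<cdot>\<^sub>m 1\<^sub>m n) *\<^sub>v x) \<le> tm * vnorm x" using t by (simp add: vnorm_smult)
  qed (use t in auto)
  hence Mb: "op_bound (2 + tm) M" "op_bound (2 + tm) M'"
    unfolding M_def M'_def using up Lp Kp by (auto intro!: op_bound_add[of _ _ _ _ n n])
  have MD: "op_bound \<Delta> (M - M')" unfolding M_def M'_def shift_diff[OF Lp(1) Kp(1)] by (rule D)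
  have c: "S - S' \<in> carrier_mat n n" "M - M' \<in> carrier_mat n n" using S'c Mc by (auto intro: minus_carrier_mat)
  \<comment> \<open>Telescoping through \<open>S' * M * S\<close> and \<open>S' * M' * S\<close>:
    the two differences of roots each contribute \<open>\<Delta> (2 + tm) / (2 tp\<^sup>2)\<close>,
    the middle term \<open>\<Delta> / tp\<close>.\<close>
  have eq: "S * M * S - S' * M' * S' = ((S - S') * M * S + S' * (M - M') * S) + S' * M' * (S - S')"
  proof -
    have "S * M * S \<in> carrier_mat n n" "S' * M * S \<in> carrier_mat n n" "S' * M' * S \<in> carrier_mat n n" "S' * M' * S' \<in> carrier_mat n n"
      using Sc S'c Mc by (simp_all add: mult_carrier_mat[of _ n n _ n])
    moreover have "(S - S') * M * S = S * M * S - S' * M * S"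
      using Sc S'c Mc by (simp add: minus_mult_distrib_mat[of _ n n _ _ n] mult_carrier_mat[of _ n n _ n])
    moreover have "S' * (M - M') * S = S' * M * S - S' * M' * S"
      using Sc S'c Mc by (simp add: mult_minus_distrib_mat[of _ n n _ n] minus_mult_distrib_mat[of _ n n _ _ n] mult_carrier_mat[of _ n n _ n])
    moreover have "S' * M' * (S - S') = S' * M' * S - S' * M' * S'"
      using Sc S'c Mc by (simp add: mult_minus_distrib_mat[of _ n n _ n] mult_carrier_mat[of _ n n _ n])
    moreover have "a - d = ((a - b) + (b - c)) + (c - d)"
      if "a \<in> carrier_mat n n" "b \<in> carrier_mat n n" "c \<in> carrier_mat n n" "d \<in> carrier_mat n n" for a b c d :: "real mat"
      using that by (intro eq_matI) auto
    ultimately show ?thesis by metis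
  qed
  have "op_bound ((\<Delta> / (2 * tp * sqrt tp) * (2 + tm) * (1 / sqrt tp) + 1 / sqrt tp * \<Delta> * (1 / sqrt tp))
      + 1 / sqrt tp * (2 + tm) * (\<Delta> / (2 * tp * sqrt tp)))
    (((S - S') * M * S + S' * (M - M') * S) + S' * M' * (S - S'))"
  proof -
    have p: "A * B \<in> carrier_mat n n" if "A \<in> carrier_mat n n" "B \<in> carrier_mat n n" for A B :: "real mat"
      using that by simp
    have b1: "op_bound (\<Delta> / (2 * tp * sqrt tp) * (2 + tm) * (1 / sqrt tp)) ((S - S') * M * S)"
      using op_bound_mult[OF op_bound_mult[OF SD Mb(1) c(1) Mc(1)] L(4) p[OF c(1) Mc(1)] Sc] by blast
    have b2: "op_bound (1 / sqrt tp * \<Delta> * (1 / sqrt tp)) (S' * (M - M') * S)"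
      using op_bound_mult[OF op_bound_mult[OF K(4) MD S'c c(2)] L(4) p[OF S'c c(2)] Sc] by blast
    have b3: "op_bound (1 / sqrt tp * (2 + tm) * (\<Delta> / (2 * tp * sqrt tp))) (S' * M' * (S - S'))"
      using op_bound_mult[OF op_bound_mult[OF K(4) Mb(2) S'c Mc(2)] SD p[OF S'c Mc(2)] c(1)] by blast
    note cs = p[OF p[OF c(1) Mc(1)] Sc] p[OF p[OF S'c c(2)] Sc] p[OF p[OF S'c Mc(2)] c(1)]
    show ?thesis
      by (rule op_bound_add[OF op_bound_add[OF b1 b2 cs(1,2)] b3 add_carrier_mat[OF cs(2)] cs(3)])
  qed
  moreover have "(\<Delta> / (2 * tp * sqrt tp) * (2 + tm) * (1 / sqrt tp) + 1 / sqrt tp * \<Delta> * (1 / sqrt tp))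
      + 1 / sqrt tp * (2 + tm) * (\<Delta> / (2 * tp * sqrt tp)) = \<Delta> * ((2 + tm) / tp\<^sup>2 + 1 / tp)"
  proof -
    define r where "r = sqrt tp"
    have "tp = r\<^sup>2" "r > 0" using t by (auto simp: r_def)
    thus ?thesis unfolding r_def[symmetric] by (simp add: field_simps power2_eq_square)
  qed
  ultimately show "op_bound (\<Delta> * ((2 + tm) / tp\<^sup>2 + 1 / tp)) (sponge_op Lp Lm tp tm - sponge_op Kp Km tp tm)"
    using eq L(1) K(1) by metis
qed

text \<open>The matrix \<open>D^(-1/2) B D^(-1/2)\<close> with the degrees \<open>d\<close>
  decoupled from \<open>B\<close>, so that an observed graph can be normalised by expected degrees.
  Division by zero gives 0, in agreement with the convention of \<open>diag_inv_sqrt\<close> for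
  isolated vertices.\<close>

definition nadj :: "nat \<Rightarrow> (nat \<Rightarrow> real) \<Rightarrow> real mat \<Rightarrow> real mat" where
  "nadj n d B = Matrix.mat n n (\<lambda>(i,j). B $$ (i,j) / (sqrt (d i) * sqrt (d j)))"

definition row_sum :: "real mat \<Rightarrow> nat \<Rightarrow> real" where
  "row_sum B i = (\<Sum>j<dim_col B. B $$ (i,j))"

lemma nadj_carrier [simp]: "nadj n d B \<in> carrier_mat n n"
  by (simp add: nadj_def)

lemma nadj_sym:
  assumes "B \<in> carrier_mat n n" "sym_mat B"
  shows "sym_mat (nadj n d B)"
proof -
  have "B $$ (i,j) = B $$ (j,i)" if "i < n" "j < n" for i j
    using assms that by (metis carrier_matD index_transpose_mat(1) sym_mat_def)
  thus ?thesis unfolding sym_mat_def nadj_def by (intro eq_matI) (auto simp: mult.commute)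
qed

lemma lap_sym_eq_nadj:
  assumes "B \<in> carrier_mat n n" "D \<in> carrier_mat n n"
  shows "lap_sym D B = 1\<^sub>m n - nadj n (\<lambda>i. D $$ (i,i)) B"
proof -
  have "diag_inv_sqrt D * B = Matrix.mat n n (\<lambda>(i,j). 1 / sqrt (D $$ (i,i)) * B $$ (i,j))"
    unfolding diag_inv_sqrt_def using assms by (simp add: mat_diag_mult_left[of _ n n])
  moreover have "\<dots> * diag_inv_sqrt D = nadj n (\<lambda>i. D $$ (i,i)) B"
    unfolding diag_inv_sqrt_def nadj_def using assms
    by (subst carrier_matD(1)[OF assms(2)], subst mat_diag_mult_right[of _ n n]) (auto intro!: eq_matI)
  ultimately show ?thesis using assms by (simp add: lap_sym_def)
qed

text \<open>Once the normalisation is absorbed into \<open>z\<close>, the inequality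
  \<open>2 |z i z j| <= (z i)^2 + (z j)^2\<close> distributes each entry over its two endpoints, and
  the row sums restore the degrees.\<close>

lemma op_bound_nadj:
  assumes B: "B \<in> carrier_mat n n" "sym_mat B" and nn: "\<And>i j. i < n \<Longrightarrow> j < n \<Longrightarrow> 0 \<le> B $$ (i,j)"
  shows "op_bound 1 (nadj n (row_sum B) B)"
proof (rule op_bound_sym_form[OF nadj_carrier nadj_sym[OF B]])
  fix x :: "real vec" assume x: "x \<in> carrier_vec n"
  let ?d = "row_sum B"
  define z where "z = (\<lambda>i. x $ i / sqrt (?d i))"
  have d0: "0 \<le> ?d i" if "i < n" for i using that nn B by (auto simp: row_sum_def intro!: sum_nonneg)
  have sB: "B $$ (i,j) = B $$ (j,i)" if "i < n" "j < n" for i j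
    using B that by (metis carrier_matD index_transpose_mat(1) sym_mat_def)
  \<comment> \<open>Only an inequality: at an isolated vertex \<open>z i\<close> is 0 by the
    division convention, while \<open>x $ i\<close> may be nonzero.\<close>
  have dz: "?d i * (z i)\<^sup>2 \<le> x $ i * x $ i" if "i < n" for i
    using d0[OF that] by (auto simp: z_def power_divide power2_eq_square)
  have sq: "(\<Sum>i = 0..<n. \<Sum>j = 0..<n. B $$ (i,j) * (z i)\<^sup>2) \<le> x \<bullet> x"
  proof -
    have "(\<Sum>i = 0..<n. \<Sum>j = 0..<n. B $$ (i,j) * (z i)\<^sup>2) = (\<Sum>i = 0..<n. ?d i * (z i)\<^sup>2)"
      using B by (auto simp: row_sum_def sum_distrib_right atLeast0LessThan)
    also have "\<dots> \<le> (\<Sum>i = 0..<n. x $ i * x $ i)" using dz by (intro sum_mono) auto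
    finally show ?thesis using x by (simp add: scalar_prod_def)
  qed
  have sq': "(\<Sum>i = 0..<n. \<Sum>j = 0..<n. B $$ (i,j) * (z j)\<^sup>2) = (\<Sum>i = 0..<n. \<Sum>j = 0..<n. B $$ (i,j) * (z i)\<^sup>2)"
    by (subst sum.swap) (auto intro!: sum.cong simp: sB)
  have "\<bar>x \<bullet> (nadj n ?d B *\<^sub>v x)\<bar> = \<bar>\<Sum>i = 0..<n. \<Sum>j = 0..<n. B $$ (i,j) * (z i * z j)\<bar>"
    by (subst form_eq_sum[OF nadj_carrier x x])
       (auto simp: nadj_def z_def intro!: arg_cong[where f = abs] sum.cong)
  also have "\<dots> \<le> (\<Sum>i = 0..<n. \<Sum>j = 0..<n. \<bar>B $$ (i,j) * (z i * z j)\<bar>)"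
    by (intro order_trans[OF sum_abs] sum_mono sum_abs)
  also have "\<dots> \<le> (\<Sum>i = 0..<n. \<Sum>j = 0..<n. B $$ (i,j) * (z i)\<^sup>2 / 2 + B $$ (i,j) * (z j)\<^sup>2 / 2)"
  proof (intro sum_mono)
    fix i j assume ij: "i \<in> {0..<n}" "j \<in> {0..<n}"
    have "\<bar>z i * z j\<bar> \<le> ((z i)\<^sup>2 + (z j)\<^sup>2) / 2"
      using sum_squares_bound[of "\<bar>z i\<bar>" "\<bar>z j\<bar>"] by (simp add: abs_mult)
    hence "B $$ (i,j) * \<bar>z i * z j\<bar> \<le> B $$ (i,j) * (((z i)\<^sup>2 + (z j)\<^sup>2) / 2)"
      using nn ij by (intro mult_left_mono) auto
    thus "\<bar>B $$ (i,j) * (z i * z j)\<bar> \<le> B $$ (i,j) * (z i)\<^sup>2 / 2 + B $$ (i,j) * (z j)\<^sup>2 / 2"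
      using nn ij by (simp add: abs_mult algebra_simps add_divide_distrib)
  qed
  also have "\<dots> = (\<Sum>i = 0..<n. \<Sum>j = 0..<n. B $$ (i,j) * (z i)\<^sup>2)"
    using sq' by (simp add: sum.distrib sum_divide_distrib[symmetric])
  also have "\<dots> \<le> 1 * (x \<bullet> x)" using sq by simp
  finally show "\<bar>x \<bullet> (nadj n ?d B *\<^sub>v x)\<bar> \<le> 1 * (x \<bullet> x)" .
qed auto

text \<open>With \<open>W = diag (sqrt (row_sum B i / d i))\<close> and \<open>N\<close> the self-normalised matrix, the difference
  is \<open>W N W - N\<close>, whose form at \<open>x\<close> is \<open>(W x - x) \<bullet> N (W x + x)\<close>.\<close>

lemma op_bound_nadj_reweight:
  assumes B: "B \<in> carrier_mat n n" "sym_mat B" and nn: "\<And>i j. i < n \<Longrightarrow> j < n \<Longrightarrow> 0 \<le> B $$ (i,j)"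
    and d: "\<And>i. i < n \<Longrightarrow> 0 < d i" and b: "0 \<le> b"
    and close: "\<And>i. i < n \<Longrightarrow> \<bar>row_sum B i - d i\<bar> \<le> b * d i"
  shows "op_bound (b * (2 + b)) (nadj n d B - nadj n (row_sum B) B)"
proof (rule op_bound_sym_form)
  let ?N = "nadj n (row_sum B) B" and ?e = "row_sum B"
  show "nadj n d B - ?N \<in> carrier_mat n n" by (rule minus_carrier_mat) simp
  show "sym_mat (nadj n d B - ?N)" by (intro diff_sym_mat[of _ n] nadj_sym B) auto
  fix x :: "real vec" assume x: "x \<in> carrier_vec n"
  have e0: "0 \<le> ?e i" if "i < n" for i using that nn B by (auto simp: row_sum_def intro!: sum_nonneg)
  have B0: "B $$ (i,j) = 0" if "?e i = 0" "i < n" "j < n" for i j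
  proof -
    have "\<forall>j\<in>{..<n}. B $$ (i,j) = 0"
      using that nn B by (subst sum_nonneg_eq_0_iff[symmetric]) (auto simp: row_sum_def)
    thus ?thesis using that by simp
  qed
  have sB: "B $$ (i,j) = B $$ (j,i)" if "i < n" "j < n" for i j
    using B that by (metis carrier_matD index_transpose_mat(1) sym_mat_def)
  define W where "W = (\<lambda>i. sqrt (?e i / d i))"
  define y where "y = vec n (\<lambda>i. W i * x $ i)"
  have y: "y \<in> carrier_vec n" by (simp add: y_def)
  \<comment> \<open>For the ratio \<open>r = (W i)\<^sup>2\<close> one has
    \<open>r - 1 = (W i - 1) (W i + 1)\<close> with \<open>W i + 1 \<ge> 1\<close>, so taking the
    root does not increase the relative error.\<close>
  have W1: "\<bar>W i - 1\<bar> \<le> b" if "i < n" for i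
  proof -
    have r: "0 \<le> ?e i / d i" using e0 d that by (simp add: less_imp_le)
    have "\<bar>?e i / d i - 1\<bar> \<le> b" using close[OF that] d[OF that] by (simp add: abs_le_iff field_simps)
    moreover have "W i * W i = ?e i / d i" using real_sqrt_pow2[OF r] by (simp only: W_def power2_eq_square)
    hence "?e i / d i - 1 = (W i - 1) * (W i + 1)" by (simp add: algebra_simps)
    hence "\<bar>?e i / d i - 1\<bar> = \<bar>W i - 1\<bar> * (W i + 1)" using r by (simp add: abs_mult W_def)
    moreover have "\<bar>W i - 1\<bar> * 1 \<le> \<bar>W i - 1\<bar> * (W i + 1)" using r by (intro mult_left_mono) (auto simp: W_def)
    ultimately show ?thesis by (metis mult.right_neutral order_trans)
  qed
  have "x \<bullet> (nadj n d B *\<^sub>v x) = y \<bullet> (?N *\<^sub>v y)"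
    unfolding form_eq_sum[OF nadj_carrier x x] form_eq_sum[OF nadj_carrier y y]
  proof (intro sum.cong refl)
    fix i j assume "i \<in> {0..<n}" "j \<in> {0..<n}"
    hence ij: "i < n" "j < n" by auto
    show "nadj n d B $$ (i,j) * x $ i * x $ j = ?N $$ (i,j) * y $ i * y $ j"
    \<comment> \<open>Where a row sum is 0, the weight \<open>W\<close> does not cancel against the
      normalisation of \<open>?N\<close>, but the entry of \<open>B\<close> is then 0 as
      well.\<close>
    proof (cases "?e i = 0 \<or> ?e j = 0")
      case True
      hence "B $$ (i,j) = 0" using B0 sB ij by metis
      thus ?thesis using ij by (simp add: nadj_def)
    next
      case False
      have "sqrt (?e i) \<noteq> 0" "sqrt (?e j) \<noteq> 0" using False by auto
      thus ?thesis using ij by (simp add: nadj_def y_def W_def real_sqrt_divide)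
    qed
  qed
  moreover have "(y - x) \<bullet> (?N *\<^sub>v (y + x)) = y \<bullet> (?N *\<^sub>v y) - x \<bullet> (?N *\<^sub>v x)"
  proof -
    have c: "?N *\<^sub>v x \<in> carrier_vec n" "?N *\<^sub>v y \<in> carrier_vec n"
      using mult_mat_vec_carrier[OF nadj_carrier] x y by auto
    have "y \<bullet> (?N *\<^sub>v x) = x \<bullet> (?N *\<^sub>v y)"
      using sym_mat_scalar_prod[OF nadj_carrier nadj_sym[OF B] x y] comm_scalar_prod[OF c(2) x] by simp
    thus ?thesis using x y c
      by (simp add: mult_add_distrib_mat_vec[OF nadj_carrier y x] scalar_prod_add_distrib[of _ n] minus_scalar_prod_distrib[of _ n])
  qed
  moreover have "x \<bullet> ((nadj n d B - ?N) *\<^sub>v x) = x \<bullet> (nadj n d B *\<^sub>v x) - x \<bullet> (?N *\<^sub>v x)"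
    using mult_mat_vec_carrier[OF nadj_carrier x] x
    by (simp add: minus_mult_distrib_mat_vec[OF nadj_carrier nadj_carrier x] scalar_prod_minus_distrib[of _ n])
  ultimately have "\<bar>x \<bullet> ((nadj n d B - ?N) *\<^sub>v x)\<bar> = \<bar>(y - x) \<bullet> (?N *\<^sub>v (y + x))\<bar>" by simp
  also have "\<dots> \<le> vnorm (y - x) * vnorm (?N *\<^sub>v (y + x))"
    by (rule abs_scalar_prod_le[of _ n]) (use x y mult_mat_vec_carrier[OF nadj_carrier, of "y + x" n] in auto)
  also have "\<dots> \<le> (b * vnorm x) * ((2 + b) * vnorm x)"
  proof (rule mult_mono)
    have "(vnorm (y - x))\<^sup>2 = (\<Sum>i = 0..<n. ((W i - 1) * x $ i)\<^sup>2)"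
      unfolding vnorm_sq using x by (auto simp: scalar_prod_def y_def power2_eq_square algebra_simps)
    also have "\<dots> \<le> (\<Sum>i = 0..<n. b\<^sup>2 * (x $ i)\<^sup>2)"
      unfolding power_mult_distrib using W1 power_mono[of "\<bar>_\<bar>" b 2]
      by (intro sum_mono mult_right_mono) fastforce+
    also have "\<dots> = (b * vnorm x)\<^sup>2"
      unfolding power_mult_distrib vnorm_sq sum_distrib_left[symmetric] using x by (simp add: scalar_prod_def power2_eq_square)
    finally show yx: "vnorm (y - x) \<le> b * vnorm x" by (rule power2_le_imp_le) (use b in auto)
    have "y + x = (y - x) + 2 \<cdot>\<^sub>v x" using x y by (intro eq_vecI) auto
    hence "vnorm (y + x) \<le> vnorm (y - x) + 2 * vnorm x"
      using vnorm_add_le[of "y - x" n "2 \<cdot>\<^sub>v x"] x y by (simp add: vnorm_smult)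
    moreover have "vnorm (?N *\<^sub>v (y + x)) \<le> 1 * vnorm (y + x)"
      by (rule op_boundD[OF op_bound_nadj[OF B nn] nadj_carrier]) (use x y in auto)
    ultimately show "vnorm (?N *\<^sub>v (y + x)) \<le> (2 + b) * vnorm x" using yx by (simp add: algebra_simps)
  qed (use b in auto)
  also have "\<dots> = b * (2 + b) * (x \<bullet> x)" using vnorm_sq[of x] by (simp add: power2_eq_square mult_ac)
  finally show "\<bar>x \<bullet> ((nadj n d B - ?N) *\<^sub>v x)\<bar> \<le> b * (2 + b) * (x \<bullet> x)" .
qed (use b in auto)

section \<open>The population operator\<close>

text \<open>Both expected adjacency matrices have this shape: \<open>a = p * (1 - \<eta>)\<close>
  and \<open>b = p * \<eta>\<close> for the positive part, the same values exchanged for the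
  negative part.\<close>

definition qmat :: "nat \<Rightarrow> (nat \<Rightarrow> nat) \<Rightarrow> real \<Rightarrow> real \<Rightarrow> real mat" where
  "qmat n cl a b = Matrix.mat n n (\<lambda>(i,j). if i = j then 0 else if cl i = cl j then a else b)"

definition bdeg :: "nat \<Rightarrow> (nat \<Rightarrow> nat) \<Rightarrow> real \<Rightarrow> real \<Rightarrow> nat \<Rightarrow> real" where
  "bdeg n cl a b c = a * (real (csize n cl c) - 1) + b * (real n - real (csize n cl c))"

definition blap :: "nat \<Rightarrow> (nat \<Rightarrow> nat) \<Rightarrow> real \<Rightarrow> real \<Rightarrow> real mat" where
  "blap n cl a b = lap_sym (deg_mat (qmat n cl a b)) (qmat n cl a b)"

lemma qmat_carrier [simp]: "qmat n cl a b \<in> carrier_mat n n"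
  by (simp add: qmat_def)

lemma qmat_sym: "sym_mat (qmat n cl a b)"
  unfolding sym_mat_def qmat_def by (intro eq_matI) auto

lemma sum_indicator_cluster: "(\<Sum>j<n. if cl j = c then a else (0::real)) = a * real (csize n cl c)"
proof -
  have "(\<Sum>j<n. if cl j = c then a else 0) = (\<Sum>j\<in>{j. j < n \<and> cl j = c}. a)"
    by (rule sum.mono_neutral_cong_right) auto
  thus ?thesis by (simp add: csize_def)
qed

lemma row_sum_qmat:
  assumes "i < n"
  shows "row_sum (qmat n cl a b) i = bdeg n cl a b (cl i)"
proof -
  have "row_sum (qmat n cl a b) i = (\<Sum>j<n. (if cl j = cl i then a - b else 0) + b - (if j = i then a else 0))"
    using assms by (auto simp: row_sum_def qmat_def intro!: sum.cong)
  also have "\<dots> = (a - b) * real (csize n cl (cl i)) + b * n - a"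
    using assms by (simp add: sum.distrib sum_subtractf sum_indicator_cluster[where cl = cl])
  finally show ?thesis by (simp add: bdeg_def algebra_simps)
qed

lemma deg_mat_row_sum:
  assumes "B \<in> carrier_mat n n" "i < n"
  shows "deg_mat B $$ (i,i) = row_sum B i"
  using assms by (simp add: deg_mat_def mat_diag_def row_sum_def)

lemma deg_mat_carrier: "B \<in> carrier_mat n n \<Longrightarrow> deg_mat B \<in> carrier_mat n n"
  unfolding deg_mat_def mat_diag_def by auto

lemma nadj_cong: "(\<And>i. i < n \<Longrightarrow> d i = e i) \<Longrightarrow> nadj n d B = nadj n e B"
  by (auto simp: nadj_def intro!: eq_matI)

lemma lap_sym_deg_mat:
  assumes "B \<in> carrier_mat n n"
  shows "lap_sym (deg_mat B) B = 1\<^sub>m n - nadj n (row_sum B) B"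
  using lap_sym_eq_nadj[OF assms deg_mat_carrier[OF assms]] nadj_cong[of n "\<lambda>i. deg_mat B $$ (i,i)" "row_sum B" B]
    deg_mat_row_sum[OF assms] by simp

lemma lap_sym_deg_mat_props:
  assumes B: "B \<in> carrier_mat n n" "sym_mat B" and nn: "\<And>i j. i < n \<Longrightarrow> j < n \<Longrightarrow> 0 \<le> B $$ (i,j)"
  shows "lap_sym (deg_mat B) B \<in> carrier_mat n n" "sym_mat (lap_sym (deg_mat B) B)"
    "\<And>x. x \<in> carrier_vec n \<Longrightarrow> 0 \<le> x \<bullet> (lap_sym (deg_mat B) B *\<^sub>v x)"
    "op_bound 2 (lap_sym (deg_mat B) B)"
proof -
  let ?N = "nadj n (row_sum B) B"
  have L: "lap_sym (deg_mat B) B = 1\<^sub>m n - ?N" by (rule lap_sym_deg_mat[OF B(1)])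
  show "lap_sym (deg_mat B) B \<in> carrier_mat n n" unfolding L by (rule minus_carrier_mat) simp
  show "sym_mat (lap_sym (deg_mat B) B)" unfolding L
    by (rule diff_sym_mat[OF one_carrier_mat nadj_carrier _ nadj_sym[OF B]]) (simp add: sym_mat_def)
  have N: "op_bound 1 ?N" by (rule op_bound_nadj[OF B nn])
  have "op_bound 1 (1\<^sub>m n)" by (rule op_boundI[of _ n n]) auto
  from op_bound_diff[OF this N one_carrier_mat nadj_carrier] show "op_bound 2 (lap_sym (deg_mat B) B)"
    unfolding L by simp
  fix x :: "real vec" assume x: "x \<in> carrier_vec n"
  show "0 \<le> x \<bullet> (lap_sym (deg_mat B) B *\<^sub>v x)"
    using form_le_op_bound[OF N nadj_carrier x] x mult_mat_vec_carrier[OF nadj_carrier x, of "row_sum B" B]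
    unfolding L by (simp add: minus_mult_distrib_mat_vec[OF one_carrier_mat nadj_carrier x] scalar_prod_minus_distrib[of _ n])
qed

locale block_lap =
  fixes n k :: nat and cl :: "nat \<Rightarrow> nat" and a b :: real
  assumes part: "valid_partition n k cl"
    and a0: "0 \<le> a" and b0: "0 \<le> b"
    and dpos: "\<And>c. c < k \<Longrightarrow> 0 < bdeg n cl a b c"
begin

abbreviation d where "d \<equiv> bdeg n cl a b"
abbreviation "L \<equiv> blap n cl a b"
abbreviation Th where "Th \<equiv> Theta n k cl"

text \<open>The weight depends on the two clusters only, as if the diagonal of \<open>qmat\<close>
  were \<open>a\<close>. The diagonal that is actually zero is restored by the term
  \<open>a / d\<close> in \<open>L_index\<close>.\<close>

definition w where "w c c' = (if c = c' then a else b) / (sqrt (d c) * sqrt (d c'))"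

text \<open>The compression of \<open>L\<close> to the range of \<open>Th\<close>, with one
  coordinate per cluster.\<close>

definition BC :: "real mat" where
  "BC = Matrix.mat k k (\<lambda>(c,c'). (if c = c' then 1 + a / d c else 0)
      - w c c' * sqrt (real (csize n cl c)) * sqrt (real (csize n cl c')))"

lemma cl_less: "j < n \<Longrightarrow> cl j < k" using part by (simp add: valid_partition_def)

lemma csize_pos: "c < k \<Longrightarrow> 0 < csize n cl c"
  using part unfolding valid_partition_def csize_def by (fastforce simp: card_gt_0_iff)

lemma L_props: "L \<in> carrier_mat n n" "sym_mat L" "x \<in> carrier_vec n \<Longrightarrow> 0 \<le> x \<bullet> (L *\<^sub>v x)" "op_bound 2 L"
proof -
  have "0 \<le> qmat n cl a b $$ (i,j)" if "i < n" "j < n" for i j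
    using that a0 b0 by (simp add: qmat_def)
  note nn = this
  show "L \<in> carrier_mat n n" unfolding blap_def by (rule lap_sym_deg_mat_props(1)[OF qmat_carrier qmat_sym nn])
  show "sym_mat L" unfolding blap_def by (rule lap_sym_deg_mat_props(2)[OF qmat_carrier qmat_sym nn])
  show "op_bound 2 L" unfolding blap_def by (rule lap_sym_deg_mat_props(4)[OF qmat_carrier qmat_sym nn])
  show "x \<in> carrier_vec n \<Longrightarrow> 0 \<le> x \<bullet> (L *\<^sub>v x)" unfolding blap_def
    by (rule lap_sym_deg_mat_props(3)[OF qmat_carrier qmat_sym nn])
qed

lemma L_index:
  assumes "i < n" "j < n"
  shows "L $$ (i,j) = (if i = j then 1 + a / d (cl i) else 0) - w (cl i) (cl j)"
proof -
  have "L = 1\<^sub>m n - nadj n (\<lambda>i. d (cl i)) (qmat n cl a b)"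
    unfolding blap_def lap_sym_deg_mat[OF qmat_carrier]
    by (rule arg_cong[where f = "\<lambda>N. 1\<^sub>m n - N"], rule nadj_cong, rule row_sum_qmat)
  moreover have "0 < d (cl i)" using dpos cl_less assms by simp
  ultimately show ?thesis using assms by (auto simp: nadj_def qmat_def w_def)
qed

lemma L_mult_vec:
  assumes x: "x \<in> carrier_vec n" and i: "i < n"
  shows "(L *\<^sub>v x) $ i = (1 + a / d (cl i)) * x $ i - (\<Sum>j<n. w (cl i) (cl j) * x $ j)"
proof -
  have "(L *\<^sub>v x) $ i = (\<Sum>j<n. L $$ (i,j) * x $ j)"
    using x i L_props(1) by (auto simp: scalar_prod_def atLeast0LessThan intro!: sum.cong)
  also have "\<dots> = (\<Sum>j<n. (if j = i then (1 + a / d (cl i)) * x $ i else 0) - w (cl i) (cl j) * x $ j)"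
    using i by (intro sum.cong refl) (auto simp: L_index algebra_simps)
  also have "\<dots> = (1 + a / d (cl i)) * x $ i - (\<Sum>j<n. w (cl i) (cl j) * x $ j)"
    using i by (simp add: sum_subtractf)
  finally show ?thesis .
qed

lemma Th_carrier: "Th \<in> carrier_mat n k" by (simp add: Theta_def)

lemma Th_orthonormal: "Th\<^sup>T * Th = 1\<^sub>m k"
proof (rule eq_matI)
  fix c c' assume "c < dim_row (1\<^sub>m k :: real mat)" "c' < dim_col (1\<^sub>m k :: real mat)"
  hence c: "c < k" "c' < k" by auto
  have "(Th\<^sup>T * Th) $$ (c,c') = (\<Sum>j<n. Th $$ (j,c) * Th $$ (j,c'))"
    using c Th_carrier by (auto simp: scalar_prod_def atLeast0LessThan intro!: sum.cong)
  also have "\<dots> = (\<Sum>j<n. if cl j = c then (if c = c' then 1 / real (csize n cl c) else 0) else 0)"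
    using c csize_pos[of c] by (intro sum.cong refl) (auto simp: Theta_def)
  also have "\<dots> = (if c = c' then 1 else 0)" using c csize_pos[of c] by (auto simp: sum_indicator_cluster)
  finally show "(Th\<^sup>T * Th) $$ (c,c') = 1\<^sub>m k $$ (c,c')" using c by simp
qed (use Th_carrier in auto)

lemma cluster_sums_zero:
  assumes x: "x \<in> carrier_vec n" and 0: "Th\<^sup>T *\<^sub>v x = 0\<^sub>v k" and c: "c < k"
  shows "(\<Sum>j<n. if cl j = c then x $ j else 0) = 0"
proof -
  have "(Th\<^sup>T *\<^sub>v x) $ c = (\<Sum>j<n. Th $$ (j,c) * x $ j)"
    using c x Th_carrier by (auto simp: scalar_prod_def atLeast0LessThan intro!: sum.cong)
  also have "\<dots> = (\<Sum>j<n. (1 / sqrt (real (csize n cl c))) * (if cl j = c then x $ j else 0))"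
    using c by (intro sum.cong refl) (auto simp: Theta_def)
  also have "\<dots> = (1 / sqrt (real (csize n cl c))) * (\<Sum>j<n. if cl j = c then x $ j else 0)"
    by (simp add: sum_distrib_left)
  finally show ?thesis using 0 c csize_pos[OF c] by simp
qed

text \<open>A kernel that is constant on blocks sees only cluster sums, and these vanish for
  \<open>x\<close> orthogonal to the cluster indicators.\<close>

lemma L_on_orthogonal:
  assumes x: "x \<in> carrier_vec n" and 0: "Th\<^sup>T *\<^sub>v x = 0\<^sub>v k" and i: "i < n"
  shows "(L *\<^sub>v x) $ i = (1 + a / d (cl i)) * x $ i"
proof -
  have "(\<Sum>j<n. w (cl i) (cl j) * x $ j) = (\<Sum>j<n. \<Sum>c<k. w (cl i) c * (if cl j = c then x $ j else 0))"
  proof (intro sum.cong refl)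
    fix j assume "j \<in> {..<n}"
    hence "cl j < k" using cl_less by simp
    have "(\<Sum>c<k. w (cl i) c * (if cl j = c then x $ j else 0)) = (\<Sum>c<k. if cl j = c then w (cl i) c * x $ j else 0)"
      by (intro sum.cong) auto
    also have "\<dots> = w (cl i) (cl j) * x $ j" using \<open>cl j < k\<close> by simp
    finally show "w (cl i) (cl j) * x $ j = (\<Sum>c<k. w (cl i) c * (if cl j = c then x $ j else 0))" by simp
  qed
  also have "\<dots> = (\<Sum>c<k. w (cl i) c * (\<Sum>j<n. if cl j = c then x $ j else 0))"
    by (subst sum.swap) (simp add: sum_distrib_left)
  also have "\<dots> = 0" using cluster_sums_zero[OF x 0] by simp
  finally show ?thesis using L_mult_vec[OF x i] by simp
qed

lemma form_on_orthogonal: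
  assumes x: "x \<in> carrier_vec n" and 0: "Th\<^sup>T *\<^sub>v x = 0\<^sub>v k"
  shows "x \<bullet> x \<le> x \<bullet> (L *\<^sub>v x)"
    and "(\<And>c. c < k \<Longrightarrow> a \<le> d c) \<Longrightarrow> x \<bullet> (L *\<^sub>v x) \<le> 2 * (x \<bullet> x)"
proof -
  have eq: "x \<bullet> (L *\<^sub>v x) = (\<Sum>i<n. (1 + a / d (cl i)) * (x $ i * x $ i))"
  proof -
    have "x \<bullet> (L *\<^sub>v x) = (\<Sum>i<n. x $ i * (L *\<^sub>v x) $ i)"
      unfolding scalar_prod_def using L_props(1) by (simp add: atLeast0LessThan)
    also have "\<dots> = (\<Sum>i<n. (1 + a / d (cl i)) * (x $ i * x $ i))"
      by (intro sum.cong refl) (simp add: L_on_orthogonal[OF x 0] del: index_mult_mat_vec)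
    finally show ?thesis .
  qed
  have xx: "x \<bullet> x = (\<Sum>i<n. x $ i * x $ i)" using x by (simp add: scalar_prod_def atLeast0LessThan)
  have d: "0 < d (cl i)" if "i < n" for i using dpos cl_less that by simp
  show "x \<bullet> x \<le> x \<bullet> (L *\<^sub>v x)" unfolding eq xx
  proof (intro sum_mono)
    fix i assume "i \<in> {..<n}"
    hence "1 \<le> 1 + a / d (cl i)" using d[of i] a0 by (simp add: less_imp_le)
    from mult_right_mono[OF this, of "x $ i * x $ i"]
    show "x $ i * x $ i \<le> (1 + a / d (cl i)) * (x $ i * x $ i)" by simp
  qed
  assume ad: "\<And>c. c < k \<Longrightarrow> a \<le> d c"
  show "x \<bullet> (L *\<^sub>v x) \<le> 2 * (x \<bullet> x)" unfolding eq xx sum_distrib_left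
  proof (intro sum_mono mult_right_mono)
    fix i assume "i \<in> {..<n}"
    thus "1 + a / d (cl i) \<le> 2" using d[of i] ad[of "cl i"] cl_less by simp
  qed auto
qed

lemma BC_carrier: "BC \<in> carrier_mat k k" by (simp add: BC_def)

lemma L_Th: "L * Th = Th * BC"
proof (rule eq_matI)
  fix i c assume "i < dim_row (Th * BC)" "c < dim_col (Th * BC)"
  hence ic: "i < n" "c < k" using Th_carrier BC_carrier by auto
  let ?n = "\<lambda>c. sqrt (real (csize n cl c))"
  have cli: "cl i < k" using cl_less ic by simp
  have np: "0 < ?n (cl i)" "0 < ?n c" using csize_pos cli ic by auto
  have cv: "col Th c \<in> carrier_vec n" using Th_carrier by (metis carrier_matD(1) col_dim)
  have "(L * Th) $$ (i,c) = (L *\<^sub>v col Th c) $ i" using ic L_props(1) Th_carrier by simp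
  also have "\<dots> = (1 + a / d (cl i)) * Th $$ (i,c) - (\<Sum>j<n. w (cl i) (cl j) * Th $$ (j,c))"
    using L_mult_vec[OF cv ic(1)] ic Th_carrier by simp
  also have "(\<Sum>j<n. w (cl i) (cl j) * Th $$ (j,c)) = (\<Sum>j<n. if cl j = c then w (cl i) c / ?n c else 0)"
    using ic by (intro sum.cong refl) (auto simp: Theta_def)
  also have "\<dots> = w (cl i) c * ?n c"
    unfolding sum_indicator_cluster using np by (simp add: field_simps)
  also have "(1 + a / d (cl i)) * Th $$ (i,c) - w (cl i) c * ?n c = 1 / ?n (cl i) * BC $$ (cl i, c)"
    using ic cli np by (auto simp: Theta_def BC_def field_simps)
  also have "\<dots> = (\<Sum>c'<k. if c' = cl i then 1 / ?n c' * BC $$ (c', c) else 0)"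
    using cli by simp
  also have "\<dots> = (\<Sum>c'<k. Th $$ (i,c') * BC $$ (c', c))"
    using ic by (intro sum.cong refl) (auto simp: Theta_def)
  also have "\<dots> = (Th * BC) $$ (i,c)"
    using ic Th_carrier BC_carrier by (auto simp: scalar_prod_def atLeast0LessThan intro!: sum.cong)
  finally show "(L * Th) $$ (i,c) = (Th * BC) $$ (i,c)" .
qed (use L_props(1) Th_carrier BC_carrier in auto)

text \<open>In cluster coordinates \<open>L\<close> is the diagonal matrix of the
  \<open>b n / d c\<close> minus \<open>b\<close> times a rank-one square, which is discarded. The
  diagonal takes this form because \<open>d c + a\<close> minus \<open>a\<close> times the cluster
  size is \<open>b\<close> times the number of vertices outside the cluster.\<close>

lemma form_on_range:
  assumes v: "v \<in> carrier_vec k" and r: "\<And>c. c < k \<Longrightarrow> b * real n \<le> r * d c"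
  shows "(Th *\<^sub>v v) \<bullet> (L *\<^sub>v (Th *\<^sub>v v)) \<le> r * (v \<bullet> v)"
proof -
  let ?n = "\<lambda>c. sqrt (real (csize n cl c))"
  define u where "u c = ?n c / sqrt (d c) * v $ c" for c
  have Thv: "Th *\<^sub>v v \<in> carrier_vec n" using Th_carrier v by auto
  have c: "BC *\<^sub>v v \<in> carrier_vec k" using BC_carrier v by auto
  have "L *\<^sub>v (Th *\<^sub>v v) = Th *\<^sub>v (BC *\<^sub>v v)"
    using assoc_mult_mat_vec[OF L_props(1) Th_carrier v] assoc_mult_mat_vec[OF Th_carrier BC_carrier v] L_Th by simp
  hence "(Th *\<^sub>v v) \<bullet> (L *\<^sub>v (Th *\<^sub>v v)) = v \<bullet> (BC *\<^sub>v v)"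
    using scalar_prod_mult_mat[OF Th_carrier c Thv] orthonormal_transpose_mult_vec[OF Th_carrier Th_orthonormal v] by simp
  also have "\<dots> = (\<Sum>c<k. \<Sum>c'<k. BC $$ (c,c') * v $ c * v $ c')"
    using form_eq_sum[OF BC_carrier v v] by (simp add: atLeast0LessThan)
  also have "\<dots> = (\<Sum>c<k. \<Sum>c'<k. (if c = c' then (b * real n / d c) * (v $ c)\<^sup>2 else 0) - b * (u c * u c'))"
    unfolding u_def
  proof (intro sum.cong refl)
    fix c c' assume "c \<in> {..<k}" "c' \<in> {..<k}"
    hence cc: "c < k" "c' < k" by auto
    have dc: "0 < d c" "0 < d c'" using dpos cc by auto
    show "BC $$ (c,c') * v $ c * v $ c' = (if c = c' then (b * real n / d c) * (v $ c)\<^sup>2 else 0)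
       - b * ((?n c / sqrt (d c) * v $ c) * (?n c' / sqrt (d c') * v $ c'))"
    proof (cases "c = c'")
      case False
      thus ?thesis using cc by (simp add: BC_def w_def)
    next
      case True
      have "BC $$ (c,c) = 1 + a / d c - a * real (csize n cl c) / d c"
        using cc dc by (simp add: BC_def w_def)
      also have "\<dots> = (d c + a - a * real (csize n cl c)) / d c" using dc by (simp add: field_simps)
      also have "d c + a - a * real (csize n cl c) = b * real n - b * real (csize n cl c)" by (simp add: bdeg_def algebra_simps)
      also have "(b * real n - b * real (csize n cl c)) / d c = b * real n / d c - b * real (csize n cl c) / d c" by (rule diff_divide_distrib)
      finally have 1: "BC $$ (c,c) = b * real n / d c - b * (real (csize n cl c) / d c)" by simp
      have 2: "(?n c / sqrt (d c) * v $ c) * (?n c / sqrt (d c) * v $ c) = real (csize n cl c) / d c * (v $ c * v $ c)"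
        using dc by simp
      show ?thesis unfolding True[symmetric] 1 2 by (simp add: power2_eq_square algebra_simps)
    qed
  qed
  also have "\<dots> = (\<Sum>c<k. (b * real n / d c) * (v $ c)\<^sup>2) - b * (\<Sum>c<k. u c)\<^sup>2"
  proof -
    have "b * (\<Sum>c<k. u c)\<^sup>2 = (\<Sum>c<k. \<Sum>c'<k. b * (u c * u c'))"
      unfolding power2_eq_square sum_product by (simp add: sum_distrib_left)
    thus ?thesis by (simp add: sum_subtractf)
  qed
  also have "\<dots> \<le> (\<Sum>c<k. (b * real n / d c) * (v $ c)\<^sup>2)" using b0 by simp
  also have "\<dots> \<le> (\<Sum>c<k. r * (v $ c)\<^sup>2)"
  proof (intro sum_mono mult_right_mono)
    fix c assume "c \<in> {..<k}"
    thus "b * real n / d c \<le> r" using r[of c] dpos[of c] by (simp add: field_simps)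
  qed auto
  also have "\<dots> = r * (v \<bullet> v)"
    using v by (simp add: scalar_prod_def atLeast0LessThan sum_distrib_left power2_eq_square)
  finally show ?thesis .
qed

end

section \<open>The SPONGE hypotheses and the population spectral gap\<close>

locale sponge =
  fixes n k :: nat and cl :: "nat \<Rightarrow> nat" and p \<eta> tp tm \<beta> :: real
  assumes H: "sponge_hyps n k cl p \<eta> tp tm \<beta>"
begin

abbreviation "s \<equiv> smin n k cl"
abbreviation "l \<equiv> lmax n k cl"
abbreviation "Lp \<equiv> blap n cl (p * (1 - \<eta>)) (p * \<eta>)"
abbreviation "Lm \<equiv> blap n cl (p * \<eta>) (p * (1 - \<eta>))"

lemma basic: "2 \<le> n" "2 \<le> k" "0 < p" "p \<le> 1" "0 \<le> \<eta>" "\<eta> < 1/2" "valid_partition n k cl" "0 < tp" "0 \<le> tm"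
  and n_ge: "real n \<ge> 2 * (1 - \<eta>) / (s * (1 - 2 * \<eta>))"
  and tp_gt: "tp > 16 * \<eta> / (\<beta> * s * (1 - 2 * \<eta>))"
  and tm_less: "tm < \<beta> / 2 * (s * (1 - 2 * \<eta>) / (s * (1 - 2 * \<eta>) + 2 * \<eta>)) * min (1 / (4 * (1 - \<beta>))) (tp / 8)"
  and beta_cases: "(\<beta> = 4 * \<eta> / (s * (1 - 2 * \<eta>) + 4 * \<eta>) \<and> 0 < \<eta>) \<or> (\<beta> = 1/2 \<and> \<eta> \<le> s / (2 * s + 4))"
  using H[unfolded sponge_hyps_def Let_def max.bounded_iff] by blast+

lemma csize_ge1: "c < k \<Longrightarrow> 1 \<le> csize n cl c"
  using basic(7) unfolding valid_partition_def csize_def by (fastforce simp: card_gt_0_iff Suc_le_eq)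

lemma csize_less:
  assumes "c < k"
  shows "csize n cl c + 1 \<le> n"
proof -
  define c' where "c' = (if c = 0 then 1 else 0 :: nat)"
  have c': "c' < k" "c' \<noteq> c" using basic(2) by (auto simp: c'_def)
  then obtain j where j: "j < n" "cl j = c'" using basic(7) unfolding valid_partition_def by auto
  have "{j. j < n \<and> cl j = c} \<subset> {..<n}" using j c' by auto
  from psubset_card_mono[OF finite_lessThan this] show ?thesis by (simp add: csize_def)
qed

lemma s_le: "c < k \<Longrightarrow> s * real n \<le> real (csize n cl c)"
  and s_pos: "0 < s"
  and l_ge: "c < k \<Longrightarrow> real (csize n cl c) \<le> l * real n"
  and l_less: "l < 1"
proof -
  let ?S = "(\<lambda>i. real (csize n cl i) / real n) ` {0..<k}"
  have fin: "finite ?S" "?S \<noteq> {}" using basic(2) by auto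
  have n0: "0 < real n" using basic(1) by simp
  show "s * real n \<le> real (csize n cl c)" if "c < k"
  proof -
    have "s \<le> real (csize n cl c) / real n" unfolding smin_def using that by (intro Min_le fin(1)) auto
    thus ?thesis using n0 by (simp add: field_simps)
  qed
  show "real (csize n cl c) \<le> l * real n" if "c < k"
  proof -
    have "real (csize n cl c) / real n \<le> l" unfolding lmax_def using that by (intro Max_ge fin(1)) auto
    thus ?thesis using n0 by (simp add: field_simps)
  qed
  show "0 < s" unfolding smin_def using fin csize_ge1 n0 by (subst Min_gr_iff) (auto simp: Suc_le_eq)
  show "l < 1" unfolding lmax_def using fin csize_less n0 by (subst Max_less_iff) (auto simp: Suc_le_eq)
qed

text \<open>With \<open>h = 2 * \<eta>\<close>, the quotient in \<open>tm_less\<close> is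
  \<open>A / (A + h)\<close> and the first admissible \<open>\<beta>\<close> is
  \<open>2 h / (A + 2 h)\<close>; the lower bound of the positive degrees is proportional to
  \<open>A + h\<close>.\<close>

definition A where "A = s * (1 - 2 * \<eta>)"
definition h where "h = 2 * \<eta>"

lemma A_pos: "0 < A" and h0: "0 \<le> h" using s_pos basic by (auto simp: A_def h_def)

lemma beta: "0 < \<beta>" "\<beta> < 1"
proof -
  have "0 < \<beta> \<and> \<beta> < 1" if "\<beta> = 4 * \<eta> / (A + 4 * \<eta>)" "0 < \<eta>"
    using that A_pos by simp
  thus "0 < \<beta>" "\<beta> < 1" using beta_cases unfolding A_def[symmetric] by auto
qed

text \<open>The lower bound on \<open>n\<close> is spent here: a vertex is not its own neighbour,
  which costs \<open>1 - \<eta>\<close>, at most half of \<open>n A\<close>.\<close>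

lemma pos_deg:
  assumes c: "c < k"
  shows "bdeg n cl (p * (1 - \<eta>)) (p * \<eta>) c \<ge> p * real n * (A + h) / 2"
proof -
  let ?m = "real (csize n cl c)"
  have "2 * (1 - \<eta>) \<le> real n * A"
    using n_ge A_pos unfolding A_def[symmetric] by (simp add: field_simps)
  moreover have "real n * A \<le> ?m * (1 - 2 * \<eta>)"
    using mult_right_mono[OF s_le[OF c], of "1 - 2 * \<eta>"] basic(6) by (simp add: A_def mult_ac)
  ultimately have "p * (real n * (A + h) / 2) \<le> p * (?m * (1 - 2 * \<eta>) + real n * \<eta> - (1 - \<eta>))"
    using basic(3)
  proof (intro mult_left_mono)
    have "real n * (A + h) / 2 = real n * A / 2 + real n * \<eta>" by (simp add: h_def field_simps)
    thus "real n * (A + h) / 2 \<le> ?m * (1 - 2 * \<eta>) + real n * \<eta> - (1 - \<eta>)"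
      using \<open>2 * (1 - \<eta>) \<le> real n * A\<close> \<open>real n * A \<le> ?m * (1 - 2 * \<eta>)\<close> by argo
  qed simp
  thus ?thesis by (simp add: bdeg_def algebra_simps)
qed

lemma neg_deg_eq: "bdeg n cl (p * \<eta>) (p * (1 - \<eta>)) c = dminus n cl p \<eta> c"
  by (simp add: bdeg_def dminus_def algebra_simps)

text \<open>The second bound comes from having at least one vertex outside the cluster. It gives
  positivity and, since \<open>\<eta> < 1/2\<close>, shows that \<open>p * \<eta>\<close> does not
  exceed the degree.\<close>

lemma neg_deg:
  assumes c: "c < k"
  shows "bdeg n cl (p * \<eta>) (p * (1 - \<eta>)) c \<ge> p * real n * (1 - l) / 2"
    and "bdeg n cl (p * \<eta>) (p * (1 - \<eta>)) c \<ge> p / 2"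
proof -
  let ?m = "real (csize n cl c)"
  have m: "1 \<le> ?m" "?m + 1 \<le> real n" using csize_ge1[OF c] csize_less[OF c] by linarith+
  have 1: "0 \<le> \<eta> * (?m - 1)" using basic(5) m by simp
  have 2: "1/2 * (real n - ?m) \<le> (1 - \<eta>) * (real n - ?m)" using basic(6) m by (intro mult_right_mono) auto
  have "p * (1/2 * (real n - ?m)) \<le> p * (\<eta> * (?m - 1) + (1 - \<eta>) * (real n - ?m))"
    using 1 2 basic(3) by (intro mult_left_mono) auto
  hence 3: "p * (1/2 * (real n - ?m)) \<le> bdeg n cl (p * \<eta>) (p * (1 - \<eta>)) c" by (simp add: bdeg_def algebra_simps)
  have "p * (1/2 * (real n * (1 - l))) \<le> p * (1/2 * (real n - ?m))"
    using basic(3) l_ge[OF c] by (intro mult_left_mono) (auto simp: algebra_simps)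
  moreover have "p * real n * (1 - l) / 2 = p * (1/2 * (real n * (1 - l)))" by simp
  ultimately show "bdeg n cl (p * \<eta>) (p * (1 - \<eta>)) c \<ge> p * real n * (1 - l) / 2" using 3 by linarith
  have "p * (1/2 * 1) \<le> p * (1/2 * (real n - ?m))" using basic(3) m by (intro mult_left_mono) auto
  thus "bdeg n cl (p * \<eta>) (p * (1 - \<eta>)) c \<ge> p / 2" using 3 by simp
qed

sublocale pos: block_lap n k cl "p * (1 - \<eta>)" "p * \<eta>"
proof
  show "0 < bdeg n cl (p * (1 - \<eta>)) (p * \<eta>) c" if "c < k" for c
    by (rule less_le_trans[OF _ pos_deg[OF that]]) (use basic A_pos h0 in auto)
qed (use basic in auto)

sublocale neg: block_lap n k cl "p * \<eta>" "p * (1 - \<eta>)"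
proof
  show "0 < bdeg n cl (p * \<eta>) (p * (1 - \<eta>)) c" if "c < k" for c
    by (rule less_le_trans[OF _ neg_deg(2)[OF that]]) (use basic in auto)
qed (use basic in auto)

abbreviation "Th \<equiv> Theta n k cl"
abbreviation "Cm \<equiv> Cminus n k cl p \<eta> tp"
abbreviation "Mn \<equiv> Lm + tp \<cdot>\<^sub>m 1\<^sub>m n"
abbreviation "Sb \<equiv> inv_sqrt_mat Mn"
abbreviation "Tb \<equiv> sponge_op Lp Lm tp tm"

definition \<mu> where "\<mu> = (1 + tm) / (2 + tp)"
text \<open>Bounds the Rayleigh quotient on the range of \<open>Th\<close>: there the form of
  \<open>Lp\<close> is at most \<open>h / (A + h)\<close> and that of \<open>Mn\<close> at least
  \<open>tp\<close>.\<close>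

definition bb where "bb = (h / (A + h) + tm) / tp"

lemma mu_pos: "0 < \<mu>" using basic by (simp add: \<mu>_def)
lemma bb_nonneg: "0 \<le> bb" using basic A_pos h0 by (simp add: bb_def)

text \<open>The hypotheses on \<open>tp\<close>, \<open>tm\<close> and \<open>\<beta>\<close> meet
  here. After multiplication by \<open>2 + tp\<close>, the facts \<open>i\<close> and
  \<open>ii\<close> each cost at most \<open>\<beta> q / 8\<close> and \<open>iii\<close> costs
  \<open>\<beta> q / 4\<close>; by \<open>iv\<close>, this total \<open>\<beta> q / 2\<close> fits
  between \<open>1 - q\<close> and \<open>\<beta>\<close>.\<close>

lemma bb_less: "bb < \<beta> * \<mu>"
proof -
  define q where "q = A / (A + h)"
  have Ah: "0 < A + h" using A_pos h0 by simp
  have q: "0 < q" "q \<le> 1" using A_pos h0 Ah by (auto simp: q_def)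
  have hq: "h / (A + h) = 1 - q" using Ah by (simp add: q_def field_simps)
  have bq: "0 < \<beta> / 2 * q" using q beta by simp
  have "tm < \<beta> / 2 * q * min (1 / (4 * (1 - \<beta>))) (tp / 8)"
    using tm_less by (simp add: q_def A_def h_def)
  moreover have "\<beta> / 2 * q * min (1 / (4 * (1 - \<beta>))) (tp / 8) \<le> \<beta> / 2 * q * (1 / (4 * (1 - \<beta>)))"
    "\<beta> / 2 * q * min (1 / (4 * (1 - \<beta>))) (tp / 8) \<le> \<beta> / 2 * q * (tp / 8)"
    by (rule mult_left_mono[OF min.cobounded1 less_imp_le[OF bq]], rule mult_left_mono[OF min.cobounded2 less_imp_le[OF bq]])
  ultimately have t: "tm < \<beta> / 2 * q * (1 / (4 * (1 - \<beta>)))" "tm < \<beta> / 2 * q * (tp / 8)" by linarith+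
  have i: "tm * (1 - \<beta>) < \<beta> * q / 8" using t(1) beta by (simp add: field_simps)
  have ii: "2 * tm / tp < \<beta> * q / 8" using t(2) basic(8) by (simp add: field_simps)
  have "8 * h < tp * (\<beta> * A)" using tp_gt beta A_pos by (simp add: A_def h_def field_simps)
  hence "2 * h / tp \<le> \<beta> * A / 4" using basic(8) by (simp add: field_simps)
  hence "(2 * h / tp) / (A + h) \<le> (\<beta> * A / 4) / (A + h)" by (rule divide_right_mono) (use Ah in simp)
  moreover have "(1 - q) * 2 / tp = (2 * h / tp) / (A + h)" unfolding hq[symmetric] by (simp add: mult.commute)
  moreover have "\<beta> * q / 4 = (\<beta> * A / 4) / (A + h)" unfolding q_def by simp
  ultimately have iii: "(1 - q) * 2 / tp \<le> \<beta> * q / 4" by metis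
  \<comment> \<open>For the first choice of \<open>\<beta>\<close> this is an equality, so that
    choice is the smallest value the inequality permits. For \<open>\<beta> = 1/2\<close> it means
    \<open>q \<ge> 2/3\<close>, that is \<open>2 h \<le> A\<close>.\<close>
  have iv: "1 - q + \<beta> * q / 2 \<le> \<beta>"
    using beta_cases
  proof (elim disjE conjE)
    assume "\<beta> = 4 * \<eta> / (s * (1 - 2 * \<eta>) + 4 * \<eta>)"
    hence b: "\<beta> = 2 * h / (A + 2 * h)" by (simp add: A_def h_def)
    have "1 - q / 2 = (A + 2 * h) / (2 * (A + h))" using Ah by (simp add: q_def field_simps)
    hence "\<beta> * (1 - q / 2) = 2 * h / (A + 2 * h) * ((A + 2 * h) / (2 * (A + h)))" by (simp only: b)
    also have "\<dots> = h / (A + h)"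
    proof -
      have "A + 2 * h \<noteq> 0" "A + h \<noteq> 0" using A_pos h0 by linarith+
      thus ?thesis by (simp add: divide_simps)
    qed
    finally have "\<beta> * (1 - q / 2) = h / (A + h)" .
    thus ?thesis unfolding hq by (simp add: algebra_simps)
  next
    assume b: "\<beta> = 1/2" and "\<eta> \<le> s / (2 * s + 4)"
    hence "2 * h \<le> A" using s_pos by (simp add: A_def h_def field_simps)
    hence "2/3 \<le> q" using Ah by (simp add: q_def field_simps)
    thus ?thesis unfolding b by simp
  qed
  have "(h / (A + h) + tm) * (2 + tp) / tp = (1 - q) + (1 - q) * 2 / tp + tm + 2 * tm / tp"
    unfolding hq using basic(8) by (simp add: field_simps)
  also have "\<dots> < \<beta> * (1 + tm)"
  proof -
    have "tm - \<beta> * tm < \<beta> * q / 8" using i by (simp add: algebra_simps)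
    moreover have "(1 - q) + X + tm + Y < \<beta> + \<beta> * tm"
      if "tm - \<beta> * tm < \<beta> * q / 8" "Y < \<beta> * q / 8" "X \<le> \<beta> * q / 4" for X Y using that iv by linarith
    ultimately have "(1 - q) + (1 - q) * 2 / tp + tm + 2 * tm / tp < \<beta> + \<beta> * tm" using ii iii by blast
    thus ?thesis by (simp only: distrib_left mult_1_right)
  qed
  finally have "(h / (A + h) + tm) * (2 + tp) / tp < \<beta> * (1 + tm)" .
  thus ?thesis using basic(8) by (simp add: bb_def \<mu>_def field_simps)
qed

text \<open>Identifies the matrix \<open>C^-\<close> of the statement as the compression of
  \<open>Mn\<close>. On the diagonal the coefficients \<open>- (1 - \<eta>)\<close> and
  \<open>1 - 2 * \<eta>\<close> of the cluster size combine to \<open>- \<eta>\<close>.\<close>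

lemma Cm_eq: "neg.BC + tp \<cdot>\<^sub>m 1\<^sub>m k = Cm"
proof (rule eq_matI)
  fix i j assume "i < dim_row Cm" "j < dim_col Cm"
  hence ij: "i < k" "j < k" by (auto simp: Cminus_def)
  have d: "0 < dminus n cl p \<eta> i" "0 < dminus n cl p \<eta> j" using neg.dpos ij by (auto simp: neg_deg_eq)
  show "(neg.BC + tp \<cdot>\<^sub>m 1\<^sub>m k) $$ (i,j) = Cm $$ (i,j)"
  proof (cases "i = j")
    case False
    thus ?thesis using ij by (simp add: neg.BC_def neg.w_def Cminus_def neg_deg_eq real_sqrt_divide)
  next
    case True
    have "sqrt (real (csize n cl j) / dminus n cl p \<eta> j) * sqrt (real (csize n cl j) / dminus n cl p \<eta> j) = real (csize n cl j) / dminus n cl p \<eta> j"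
      using d by (simp add: real_sqrt_divide)
    thus ?thesis using ij d True
      by (simp add: neg.BC_def neg.w_def Cminus_def neg_deg_eq mult.assoc) (simp add: field_simps)
  qed
qed (auto simp: neg.BC_def Cminus_def)

lemma Cm_carrier: "Cm \<in> carrier_mat k k" by (simp add: Cminus_def)

lemma Cm_sym: "sym_mat Cm" unfolding sym_mat_def Cminus_def by (intro eq_matI) auto

lemma Mn_Th: "Mn * Th = Th * Cm"
proof -
  note T = neg.Th_carrier and B = neg.BC_carrier and L = neg.L_props(1)
  have 1: "(tp \<cdot>\<^sub>m 1\<^sub>m n) * Th = tp \<cdot>\<^sub>m Th" using mult_smult_assoc_mat[OF one_carrier_mat T] left_mult_one_mat[OF T] by simp
  have 2: "Th * (tp \<cdot>\<^sub>m 1\<^sub>m k) = tp \<cdot>\<^sub>m Th" using mult_smult_distrib[OF T one_carrier_mat] right_mult_one_mat[OF T] by simp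
  have "Mn * Th = Lm * Th + tp \<cdot>\<^sub>m Th" using T L 1 by (simp add: add_mult_distrib_mat[of _ n n _ _ k])
  also have "\<dots> = Th * (neg.BC + tp \<cdot>\<^sub>m 1\<^sub>m k)"
    using T B 2 neg.L_Th by (simp add: mult_add_distrib_mat[of _ n k _ k])
  finally show ?thesis by (simp add: Cm_eq)
qed

text \<open>\<open>Th\<close> is an isometry that intertwines \<open>Cm\<close> with
  \<open>Mn\<close>, so \<open>Cm\<close> inherits the lower bound \<open>tp\<close>. Positive
  definiteness and the inverse root of \<open>Cm\<close> rest on this.\<close>

lemma Cm_lower:
  assumes c: "c \<in> carrier_vec k"
  shows "tp * (c \<bullet> c) \<le> c \<bullet> (Cm *\<^sub>v c)"
proof -
  let ?x = "Th *\<^sub>v c"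
  have M: "Mn \<in> carrier_mat n n" using neg.L_props(1) by simp
  have x: "?x \<in> carrier_vec n" by (rule mult_mat_vec_carrier[OF neg.Th_carrier c])
  have Cc: "Cm *\<^sub>v c \<in> carrier_vec k" by (rule mult_mat_vec_carrier[OF Cm_carrier c])
  have "Mn *\<^sub>v ?x = Th *\<^sub>v (Cm *\<^sub>v c)"
    using assoc_mult_mat_vec[OF M neg.Th_carrier c] assoc_mult_mat_vec[OF neg.Th_carrier Cm_carrier c] Mn_Th by simp
  hence "?x \<bullet> (Mn *\<^sub>v ?x) = c \<bullet> (Cm *\<^sub>v c)"
    using scalar_prod_mult_mat[OF neg.Th_carrier Cc x] orthonormal_transpose_mult_vec[OF neg.Th_carrier neg.Th_orthonormal c] by simp
  moreover have "tp * (?x \<bullet> ?x) \<le> ?x \<bullet> (Mn *\<^sub>v ?x)"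
    using shift_form[OF neg.L_props(1) x, of tp] neg.L_props(3)[OF x] by simp
  moreover have "?x \<bullet> ?x = c \<bullet> c"
    using orthonormal_vnorm[OF neg.Th_carrier neg.Th_orthonormal c] vnorm_sq[of c] vnorm_sq[of ?x] by simp
  ultimately show ?thesis by simp
qed

lemma Cm_pos_def: "pos_def_mat k Cm"
  by (rule pos_def_matI[OF Cm_carrier Cm_sym basic(8) Cm_lower])

lemma Tb_props: "Tb = Sb * (Lp + tm \<cdot>\<^sub>m 1\<^sub>m n) * Sb"
  "pos_def_mat n Sb"
  "Sb * Sb * Mn = 1\<^sub>m n"
  "op_bound (1 / sqrt tp) Sb"
  "Tb \<in> carrier_mat n n"
  "sym_mat Tb"
  "x \<in> carrier_vec n \<Longrightarrow> 0 \<le> x \<bullet> (Tb *\<^sub>v x)"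
proof -
  note f = sponge_op_factor[OF pos.L_props(1,2) neg.L_props(1,2) pos.L_props(3) neg.L_props(3) basic(8,9)]
  show "Tb = Sb * (Lp + tm \<cdot>\<^sub>m 1\<^sub>m n) * Sb" by (rule f(1))
  show "pos_def_mat n Sb" by (rule f(2))
  show "Sb * Sb * Mn = 1\<^sub>m n" by (rule f(3))
  show "op_bound (1 / sqrt tp) Sb" by (rule f(4))
  show "Tb \<in> carrier_mat n n" by (rule f(5))
  show "sym_mat Tb" by (rule f(6))
  show "x \<in> carrier_vec n \<Longrightarrow> 0 \<le> x \<bullet> (Tb *\<^sub>v x)" by (rule f(7))
qed

lemma Sb_Th: "Sb * Th = Th * inv_sqrt_mat Cm"
proof -
  let ?Z = "inv_sqrt_mat Cm"
  note S = pos_def_matD(1)[OF Tb_props(2)] and T = neg.Th_carrier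
  have Z: "pos_def_mat k ?Z" "?Z * ?Z * Cm = 1\<^sub>m k"
    using inv_sqrt_mat_props[OF Cm_carrier Cm_sym basic(8) Cm_lower] by metis+
  note Zc = pos_def_matD(1)[OF Z(1)]
  have M: "Mn \<in> carrier_mat n n" using neg.L_props(1) by simp
  have ZZ: "?Z * ?Z \<in> carrier_mat k k" using Zc by simp
  have SS: "Sb * Sb \<in> carrier_mat n n" using S by simp
  have CZ: "Cm * (?Z * ?Z) = 1\<^sub>m k" by (rule mat_mult_left_right_inverse[OF ZZ Cm_carrier Z(2)])
  have ThZZ: "Th * (?Z * ?Z) \<in> carrier_mat n k" using T ZZ by simp
  \<comment> \<open>Intertwining passes from \<open>Mn\<close> and \<open>Cm\<close> to their
    inverses \<open>Sb * Sb\<close> and \<open>?Z * ?Z\<close> by algebra; descending to the roots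
    is the task of \<open>Y\<close>.\<close>
  have "Th * (?Z * ?Z) = (Sb * Sb * Mn) * (Th * (?Z * ?Z))" unfolding Tb_props(3) by (rule left_mult_one_mat[OF ThZZ, symmetric])
  also have "\<dots> = (Sb * Sb) * (Mn * (Th * (?Z * ?Z)))" by (rule assoc_mult_mat[OF SS M ThZZ])
  also have "Mn * (Th * (?Z * ?Z)) = (Mn * Th) * (?Z * ?Z)" using assoc_mult_mat[OF M T ZZ] by simp
  also have "\<dots> = Th * (Cm * (?Z * ?Z))" unfolding Mn_Th by (rule assoc_mult_mat[OF T Cm_carrier ZZ])
  also have "\<dots> = Th" unfolding CZ using T by simp
  finally have eq: "Th * (?Z * ?Z) = Sb * Sb * Th" .
  have ST: "Sb * Th \<in> carrier_mat n k" and TZ: "Th * ?Z \<in> carrier_mat n k" using S T Zc by auto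
  define Y where "Y = Sb * Th - Th * ?Z"
  have Y: "Y \<in> carrier_mat n k" unfolding Y_def by (rule minus_carrier_mat[OF TZ])
  have zero: "U - V + (V - U) = 0\<^sub>m n k" if "U \<in> carrier_mat n k" "V \<in> carrier_mat n k" for U V :: "real mat"
    using that by (intro eq_matI) auto
  have "Sb * Y = Sb * Sb * Th - Sb * (Th * ?Z)"
    unfolding Y_def mult_minus_distrib_mat[OF S ST TZ] assoc_mult_mat[OF S S T] ..
  moreover have "Y * ?Z = Sb * (Th * ?Z) - Th * (?Z * ?Z)"
    unfolding Y_def minus_mult_distrib_mat[OF ST TZ Zc] assoc_mult_mat[OF S T Zc] assoc_mult_mat[OF T Zc Zc] ..
  moreover have "Sb * (Th * ?Z) \<in> carrier_mat n k" using S TZ by simp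
  ultimately have "Sb * Y + Y * ?Z = 0\<^sub>m n k" unfolding eq[symmetric] using zero ThZZ by metis
  from intertwine_eq_zero[OF Tb_props(2) Z(1) Y this] have Y0: "Y = 0\<^sub>m n k" .
  show ?thesis
  proof (rule eq_matI)
    fix i j assume "i < dim_row (Th * ?Z)" "j < dim_col (Th * ?Z)"
    hence ij: "i < n" "j < k" using TZ by auto
    have "Y $$ (i,j) = (Sb * Th) $$ (i,j) - (Th * ?Z) $$ (i,j)"
      unfolding Y_def using ij TZ by (metis carrier_matD index_minus_mat(1))
    thus "(Sb * Th) $$ (i,j) = (Th * ?Z) $$ (i,j)" unfolding Y0 using ij by simp
  qed (simp_all only: carrier_matD[OF ST] carrier_matD[OF TZ])
qed

text \<open>One factor \<open>Sb\<close> may be moved to the right of \<open>Mn\<close>, because a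
  left inverse of a square matrix is a right inverse; so \<open>Sb\<close> carries the form of
  \<open>Mn\<close> to the Euclidean one.\<close>

lemma Sb_Mn_form:
  assumes y: "y \<in> carrier_vec n"
  shows "(Sb *\<^sub>v y) \<bullet> (Mn *\<^sub>v (Sb *\<^sub>v y)) = y \<bullet> y"
proof -
  note S = pos_def_matD(1,2)[OF Tb_props(2)]
  have M: "Mn \<in> carrier_mat n n" using neg.L_props(1) by simp
  have SM: "Sb * Mn \<in> carrier_mat n n" using S M by simp
  have "Sb * (Sb * Mn) = 1\<^sub>m n" using Tb_props(3) assoc_mult_mat[OF S(1) S(1) M] by simp
  hence "Sb * Mn * Sb = 1\<^sub>m n" by (rule mat_mult_left_right_inverse[OF S(1) SM])
  thus ?thesis using sandwich_form[OF S M y] y by simp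
qed

lemma Tb_form:
  assumes y: "y \<in> carrier_vec n"
  shows "y \<bullet> (Tb *\<^sub>v y) = (Sb *\<^sub>v y) \<bullet> (Lp *\<^sub>v (Sb *\<^sub>v y)) + tm * ((Sb *\<^sub>v y) \<bullet> (Sb *\<^sub>v y))"
proof -
  note S = pos_def_matD(1,2)[OF Tb_props(2)]
  have z: "Sb *\<^sub>v y \<in> carrier_vec n" by (rule mult_mat_vec_carrier[OF S(1) y])
  show ?thesis unfolding Tb_props(1) sandwich_form[OF S shift_carrier[OF pos.L_props(1)] y] shift_form[OF pos.L_props(1) z] ..
qed

lemma Tb_low:
  assumes y: "y \<in> carrier_vec n" and 0: "Th\<^sup>T *\<^sub>v y = 0\<^sub>v k"
  shows "\<mu> * (y \<bullet> y) \<le> y \<bullet> (Tb *\<^sub>v y)"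
proof -
  note S = pos_def_matD(1,2)[OF Tb_props(2)] and T = neg.Th_carrier
  let ?Z = "inv_sqrt_mat Cm"
  have Z: "pos_def_mat k ?Z"
    using inv_sqrt_mat_props[OF Cm_carrier Cm_sym basic(8) Cm_lower] by metis
  note Zc = pos_def_matD(1,2)[OF Z]
  define z where "z = Sb *\<^sub>v y"
  have z: "z \<in> carrier_vec n" unfolding z_def by (rule mult_mat_vec_carrier[OF S(1) y])
  have tT: "Th\<^sup>T \<in> carrier_mat k n" using T by simp
  have "Th\<^sup>T * Sb = (Sb * Th)\<^sup>T"
    using transpose_mult[OF S(1) T] S(2) by (simp add: sym_mat_def)
  also have "\<dots> = ?Z * Th\<^sup>T"
    unfolding Sb_Th transpose_mult[OF T Zc(1)] using Zc(2) by (simp add: sym_mat_def)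
  finally have eq: "Th\<^sup>T * Sb = ?Z * Th\<^sup>T" .
  have "Th\<^sup>T *\<^sub>v z = (?Z * Th\<^sup>T) *\<^sub>v y"
    unfolding z_def eq[symmetric] using assoc_mult_mat_vec[OF tT S(1) y] by simp
  also have "\<dots> = ?Z *\<^sub>v 0\<^sub>v k" using assoc_mult_mat_vec[OF Zc(1) tT y] 0 by simp
  finally have z0: "Th\<^sup>T *\<^sub>v z = 0\<^sub>v k" using Zc by (auto intro!: eq_vecI)
  \<comment> \<open>On the complement \<open>Lm\<close> multiplies by \<open>1 + a / d\<close>,
    which is at most 2 once \<open>a \<le> d\<close>; hence the denominator \<open>2 + tp\<close> of
    \<open>\<mu>\<close>.\<close>
  have "p * \<eta> \<le> bdeg n cl (p * \<eta>) (p * (1 - \<eta>)) c" if "c < k" for c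
    using neg_deg(2)[OF that] mult_left_mono[of \<eta> "1/2" p] basic by linarith
  hence up: "z \<bullet> (Lm *\<^sub>v z) \<le> 2 * (z \<bullet> z)" by (rule neg.form_on_orthogonal(2)[OF z z0])
  have "y \<bullet> y = z \<bullet> (Lm *\<^sub>v z) + tp * (z \<bullet> z)"
    using Sb_Mn_form[OF y] shift_form[OF neg.L_props(1) z, of tp] by (simp add: z_def)
  hence "y \<bullet> y \<le> (2 + tp) * (z \<bullet> z)" using up by (simp add: algebra_simps)
  hence "\<mu> * (y \<bullet> y) \<le> \<mu> * ((2 + tp) * (z \<bullet> z))" using mu_pos by (intro mult_left_mono) auto
  also have "\<dots> = (1 + tm) * (z \<bullet> z)" using basic(8) by (simp add: \<mu>_def)
  also have "\<dots> \<le> y \<bullet> (Tb *\<^sub>v y)"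
  proof -
    have "y \<bullet> (Tb *\<^sub>v y) = z \<bullet> (Lp *\<^sub>v z) + tm * (z \<bullet> z)" unfolding z_def by (rule Tb_form[OF y])
    thus ?thesis using pos.form_on_orthogonal(1)[OF z z0] by (simp add: distrib_right)
  qed
  finally show ?thesis .
qed

lemma Tb_up:
  assumes c: "c \<in> carrier_vec k"
  shows "(Th *\<^sub>v c) \<bullet> (Tb *\<^sub>v (Th *\<^sub>v c)) \<le> bb * (c \<bullet> c)"
proof -
  note S = pos_def_matD(1,2)[OF Tb_props(2)] and T = neg.Th_carrier
  let ?Z = "inv_sqrt_mat Cm"
  have Z: "pos_def_mat k ?Z"
    using inv_sqrt_mat_props[OF Cm_carrier Cm_sym basic(8) Cm_lower] by metis
  note Zc = pos_def_matD(1,2)[OF Z]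
  define y where "y = Th *\<^sub>v c"
  define e where "e = ?Z *\<^sub>v c"
  define z where "z = Sb *\<^sub>v y"
  have y: "y \<in> carrier_vec n" unfolding y_def by (rule mult_mat_vec_carrier[OF T c])
  have e: "e \<in> carrier_vec k" unfolding e_def by (rule mult_mat_vec_carrier[OF Zc(1) c])
  have z: "z \<in> carrier_vec n" unfolding z_def by (rule mult_mat_vec_carrier[OF S(1) y])
  have ze: "z = Th *\<^sub>v e"
    unfolding z_def y_def e_def using assoc_mult_mat_vec[OF S(1) T c] assoc_mult_mat_vec[OF T Zc(1) c] Sb_Th by simp
  have zz: "z \<bullet> z = e \<bullet> e"
    using orthonormal_vnorm[OF T neg.Th_orthonormal e] vnorm_sq[of z] vnorm_sq[of e] by (simp add: ze)
  have yy: "y \<bullet> y = c \<bullet> c"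
    using orthonormal_vnorm[OF T neg.Th_orthonormal c] vnorm_sq[of y] vnorm_sq[of c] by (simp add: y_def)
  have "z \<bullet> (Lp *\<^sub>v z) \<le> h / (A + h) * (e \<bullet> e)" unfolding ze
  proof (rule pos.form_on_range[OF e])
    fix c assume "c < k"
    have Ah: "0 < A + h" using A_pos h0 by simp
    have "p * \<eta> * real n = h / (A + h) * (p * real n * (A + h) / 2)" using Ah by (simp add: h_def)
    also have "\<dots> \<le> h / (A + h) * bdeg n cl (p * (1 - \<eta>)) (p * \<eta>) c"
      using pos_deg[OF \<open>c < k\<close>] h0 Ah by (intro mult_left_mono) auto
    finally show "p * \<eta> * real n \<le> h / (A + h) * bdeg n cl (p * (1 - \<eta>)) (p * \<eta>) c" .
  qed
  moreover have "y \<bullet> (Tb *\<^sub>v y) = z \<bullet> (Lp *\<^sub>v z) + tm * (z \<bullet> z)" unfolding z_def by (rule Tb_form[OF y])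
  ultimately have "y \<bullet> (Tb *\<^sub>v y) \<le> (h / (A + h) + tm) * (z \<bullet> z)" unfolding zz by (simp add: distrib_right)
  also have "\<dots> = bb * (tp * (z \<bullet> z))" using basic(8) by (simp add: bb_def)
  also have "\<dots> \<le> bb * (y \<bullet> y)"
  proof (rule mult_left_mono[OF _ bb_nonneg])
    have "y \<bullet> y = z \<bullet> (Lm *\<^sub>v z) + tp * (z \<bullet> z)"
      using Sb_Mn_form[OF y] shift_form[OF neg.L_props(1) z, of tp] by (simp add: z_def)
    thus "tp * (z \<bullet> z) \<le> y \<bullet> y" using neg.L_props(3)[OF z] by simp
  qed
  finally show ?thesis unfolding yy by (simp add: y_def)
qed

lemma Tb_Th: "\<exists>K \<in> carrier_mat k k. Tb * Th = Th * K"
proof -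
  note S = pos_def_matD(1)[OF Tb_props(2)] and T = neg.Th_carrier
  let ?Z = "inv_sqrt_mat Cm"
  have "pos_def_mat k ?Z"
    using inv_sqrt_mat_props[OF Cm_carrier Cm_sym basic(8) Cm_lower] by metis
  note Zc = pos_def_matD(1)[OF this]
  define P where "P = pos.BC + tm \<cdot>\<^sub>m 1\<^sub>m k"
  define M where "M = Lp + tm \<cdot>\<^sub>m 1\<^sub>m n"
  have P: "P \<in> carrier_mat k k" using pos.BC_carrier by (simp add: P_def)
  have M: "M \<in> carrier_mat n n" using pos.L_props(1) by (simp add: M_def)
  have 1: "(tm \<cdot>\<^sub>m 1\<^sub>m n) * Th = tm \<cdot>\<^sub>m Th" using mult_smult_assoc_mat[OF one_carrier_mat T] left_mult_one_mat[OF T] by simp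
  have 2: "Th * (tm \<cdot>\<^sub>m 1\<^sub>m k) = tm \<cdot>\<^sub>m Th" using mult_smult_distrib[OF T one_carrier_mat] right_mult_one_mat[OF T] by simp
  have "M * Th = Lp * Th + tm \<cdot>\<^sub>m Th" using T pos.L_props(1) 1 by (simp add: M_def add_mult_distrib_mat[of _ n n _ _ k])
  also have "\<dots> = Th * P"
    using T pos.BC_carrier 2 pos.L_Th by (simp add: P_def mult_add_distrib_mat[of _ n k _ k])
  finally have MT: "M * Th = Th * P" .
  have SM: "Sb * M \<in> carrier_mat n n" and PZ: "P * ?Z \<in> carrier_mat k k" using S M P Zc by simp_all
  have "Tb * Th = (Sb * M) * (Sb * Th)" unfolding Tb_props(1) M_def[symmetric] by (rule assoc_mult_mat[OF SM S T])
  also have "\<dots> = ((Sb * M) * Th) * ?Z" unfolding Sb_Th using assoc_mult_mat[OF SM T Zc] by simp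
  also have "(Sb * M) * Th = Sb * (Th * P)" unfolding MT[symmetric] by (rule assoc_mult_mat[OF S M T])
  also have "\<dots> = (Th * ?Z) * P" unfolding Sb_Th[symmetric] using assoc_mult_mat[OF S T P] by simp
  also have "\<dots> = Th * (?Z * P)" by (rule assoc_mult_mat[OF T Zc P])
  also have "\<dots> * ?Z = Th * ((?Z * P) * ?Z)" by (rule assoc_mult_mat[OF T _ Zc]) (use Zc P in simp)
  finally show ?thesis using Zc P by (intro bexI[of _ "(?Z * P) * ?Z"]) simp_all
qed

end

section \<open>Trace inequalities\<close>

text \<open>The Frobenius inner product; for symmetric matrices it is the trace of the
  product.\<close>

definition fip :: "nat \<Rightarrow> real mat \<Rightarrow> real mat \<Rightarrow> real" where
  "fip n A B = (\<Sum>i<n. \<Sum>j<n. A $$ (i,j) * B $$ (i,j))"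

lemma fip_conj_diag:
  assumes "U \<in> carrier_mat n n" "W \<in> carrier_mat n n"
  shows "fip n (conj_diag n U f) (conj_diag n W g) = (\<Sum>a<n. \<Sum>b<n. f a * g b * (col U a \<bullet> col W b)\<^sup>2)"
proof -
  have "fip n (conj_diag n U f) (conj_diag n W g) =
      (\<Sum>i<n. \<Sum>j<n. \<Sum>a<n. \<Sum>b<n. f a * g b * ((U $$ (i,a) * W $$ (i,b)) * (U $$ (j,a) * W $$ (j,b))))"
    unfolding fip_def
    by (intro sum.cong refl) (auto simp: conj_diag_index assms sum_product atLeast0LessThan intro!: sum.cong)
  also have "\<dots> = (\<Sum>i<n. \<Sum>a<n. \<Sum>j<n. \<Sum>b<n. f a * g b * ((U $$ (i,a) * W $$ (i,b)) * (U $$ (j,a) * W $$ (j,b))))"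
    by (intro sum.cong refl sum.swap)
  also have "\<dots> = (\<Sum>i<n. \<Sum>a<n. \<Sum>b<n. \<Sum>j<n. f a * g b * ((U $$ (i,a) * W $$ (i,b)) * (U $$ (j,a) * W $$ (j,b))))"
    by (intro sum.cong refl sum.swap)
  also have "\<dots> = (\<Sum>a<n. \<Sum>i<n. \<Sum>b<n. \<Sum>j<n. f a * g b * ((U $$ (i,a) * W $$ (i,b)) * (U $$ (j,a) * W $$ (j,b))))"
    by (rule sum.swap)
  also have "\<dots> = (\<Sum>a<n. \<Sum>b<n. \<Sum>i<n. \<Sum>j<n. f a * g b * ((U $$ (i,a) * W $$ (i,b)) * (U $$ (j,a) * W $$ (j,b))))"
    by (intro sum.cong refl sum.swap)
  also have "\<dots> = (\<Sum>a<n. \<Sum>b<n. f a * g b * (col U a \<bullet> col W b)\<^sup>2)"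
  proof (intro sum.cong refl)
    fix a b assume ab: "a \<in> {..<n}" "b \<in> {..<n}"
    have "col U a \<bullet> col W b = (\<Sum>i<n. U $$ (i,a) * W $$ (i,b))"
      using assms ab by (simp add: scalar_prod_def atLeast0LessThan)
    thus "(\<Sum>i<n. \<Sum>j<n. f a * g b * ((U $$ (i,a) * W $$ (i,b)) * (U $$ (j,a) * W $$ (j,b)))) = f a * g b * (col U a \<bullet> col W b)\<^sup>2"
      by (simp only: power2_eq_square sum_product) (simp only: sum_distrib_left)
  qed
  finally show ?thesis .
qed

lemma fip_diff_left: "A \<in> carrier_mat n n \<Longrightarrow> B \<in> carrier_mat n n \<Longrightarrow> fip n (A - B) C = fip n A C - fip n B C"
  by (simp add: fip_def algebra_simps sum_subtractf)

lemma fip_commute: "fip n A B = fip n B A"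
  by (simp add: fip_def mult.commute)

lemma fip_mult_left:
  assumes "A \<in> carrier_mat n n" "B \<in> carrier_mat n n" "C \<in> carrier_mat n n"
  shows "fip n (A * B) C = fip n B (A\<^sup>T * C)"
proof -
  have "fip n (A * B) C = (\<Sum>i<n. \<Sum>j<n. \<Sum>m<n. A $$ (i,m) * B $$ (m,j) * C $$ (i,j))"
    using assms by (auto simp: fip_def scalar_prod_def sum_distrib_right atLeast0LessThan intro!: sum.cong)
  also have "\<dots> = (\<Sum>i<n. \<Sum>m<n. \<Sum>j<n. A $$ (i,m) * B $$ (m,j) * C $$ (i,j))"
    by (intro sum.cong refl sum.swap)
  also have "\<dots> = (\<Sum>m<n. \<Sum>i<n. \<Sum>j<n. A $$ (i,m) * B $$ (m,j) * C $$ (i,j))" by (rule sum.swap)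
  also have "\<dots> = (\<Sum>m<n. \<Sum>j<n. \<Sum>i<n. A $$ (i,m) * B $$ (m,j) * C $$ (i,j))"
    by (intro sum.cong refl sum.swap)
  also have "\<dots> = fip n B (A\<^sup>T * C)"
    using assms by (auto simp: fip_def scalar_prod_def sum_distrib_left atLeast0LessThan mult_ac intro!: sum.cong)
  finally show ?thesis .
qed

lemma fip_mult_right:
  assumes "A \<in> carrier_mat n n" "B \<in> carrier_mat n n" "C \<in> carrier_mat n n"
  shows "fip n (A * B) C = fip n A (C * B\<^sup>T)"
proof -
  have "fip n (A * B) C = (\<Sum>i<n. \<Sum>j<n. \<Sum>m<n. A $$ (i,m) * B $$ (m,j) * C $$ (i,j))"
    using assms by (auto simp: fip_def scalar_prod_def sum_distrib_right atLeast0LessThan intro!: sum.cong)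
  also have "\<dots> = (\<Sum>i<n. \<Sum>m<n. \<Sum>j<n. A $$ (i,m) * B $$ (m,j) * C $$ (i,j))"
    by (intro sum.cong refl sum.swap)
  also have "\<dots> = fip n A (C * B\<^sup>T)"
    using assms by (auto simp: fip_def scalar_prod_def sum_distrib_left atLeast0LessThan mult_ac intro!: sum.cong)
  finally show ?thesis .
qed

text \<open>The exponents \<open>a\<close> and \<open>r - a\<close> are paired:
  \<open>(|x|^a - |y|^a) (|x|^(r-a) - |y|^(r-a))\<close> is nonnegative, since both factors have the
  same sign. Evenness of \<open>r\<close> removes the absolute values from the bound.\<close>

lemma power_product_sum_le:
  fixes x y :: real
  assumes "even r"
  shows "(\<Sum>a\<le>r. x ^ a * y ^ (r - a)) \<le> (real r + 1) / 2 * (x ^ r + y ^ r)"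
proof -
  define f where "f a = x ^ a * y ^ (r - a)" for a
  have "(\<Sum>a\<le>r. f a) = (\<Sum>a\<le>r. f (r - a))"
    by (rule sum.reindex_bij_witness[of _ "\<lambda>a. r - a" "\<lambda>a. r - a"]) auto
  hence "2 * (\<Sum>a\<le>r. f a) = (\<Sum>a\<le>r. f a + f (r - a))" by (simp add: sum.distrib)
  also have "\<dots> \<le> (\<Sum>a\<le>r. x ^ r + y ^ r)"
  proof (intro sum_mono)
    fix a assume "a \<in> {..r}"
    hence a: "a \<le> r" by simp
    let ?X = "\<bar>x\<bar>" and ?Y = "\<bar>y\<bar>"
    have "0 \<le> (?X ^ a - ?Y ^ a) * (?X ^ (r - a) - ?Y ^ (r - a))"
    proof (cases "?X \<le> ?Y")
      case True
      thus ?thesis by (intro mult_nonpos_nonpos) (auto intro!: power_mono)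
    next
      case False
      thus ?thesis by (intro mult_nonneg_nonneg) (auto intro!: power_mono)
    qed
    hence "?X ^ a * ?Y ^ (r - a) + ?X ^ (r - a) * ?Y ^ a \<le> ?X ^ a * ?X ^ (r - a) + ?Y ^ a * ?Y ^ (r - a)"
      by (simp add: algebra_simps)
    also have "\<dots> = x ^ r + y ^ r" using a assms by (simp flip: power_add add: power_even_abs)
    finally have 1: "?X ^ a * ?Y ^ (r - a) + ?X ^ (r - a) * ?Y ^ a \<le> x ^ r + y ^ r" .
    have "f a \<le> ?X ^ a * ?Y ^ (r - a)" unfolding f_def
      using abs_ge_self[of "x ^ a * y ^ (r - a)"] by (simp add: abs_mult power_abs)
    moreover have "f (r - a) \<le> ?X ^ (r - a) * ?Y ^ a" unfolding f_def
      using abs_ge_self[of "x ^ (r - a) * y ^ (r - (r - a))"] a by (simp add: abs_mult power_abs)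
    ultimately show "f a + f (r - a) \<le> x ^ r + y ^ r" using 1 by linarith
  qed
  also have "\<dots> = (real r + 1) * (x ^ r + y ^ r)" by (simp add: algebra_simps)
  finally show ?thesis by (simp add: f_def)
qed

lemma scalar_covariance_ineq:
  fixes x y :: real
  assumes "even r"
  shows "(x - y) * (x ^ Suc r - y ^ Suc r) \<le> (real r + 1) / 2 * ((x - y)\<^sup>2 * (x ^ r + y ^ r))"
proof -
  have "x ^ Suc r - y ^ Suc r = (x - y) * (\<Sum>a\<le>r. x ^ a * y ^ (r - a))"
    using diff_power_eq_sum[of x r y] by (simp add: lessThan_Suc_atMost)
  hence "(x - y) * (x ^ Suc r - y ^ Suc r) = (x - y)\<^sup>2 * (\<Sum>a\<le>r. x ^ a * y ^ (r - a))"
    by (simp add: power2_eq_square)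
  also have "\<dots> \<le> (x - y)\<^sup>2 * ((real r + 1) / 2 * (x ^ r + y ^ r))"
    by (intro mult_left_mono power_product_sum_le assms) auto
  finally show ?thesis by (simp add: mult_ac)
qed

text \<open>In eigenbases of \<open>X\<close> and \<open>Y\<close>, \<open>tr (X\<^sup>a Y\<^sup>b) = (\<Sum>i j. f\<^sub>i\<^sup>a g\<^sub>j\<^sup>b (u\<^sub>i \<bullet> w\<^sub>j)\<^sup>2)\<close>, so the claim
  reduces termwise to the scalar inequality.\<close>

lemma matrix_covariance_ineq:
  assumes X: "X \<in> carrier_mat n n" "sym_mat X" and Y: "Y \<in> carrier_mat n n" "sym_mat Y" and r: "even r"
  shows "fip n (X - Y) (X ^\<^sub>m Suc r) - fip n (X - Y) (Y ^\<^sub>m Suc r)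
    \<le> (real r + 1) / 2 * (fip n ((X - Y) * (X - Y)) (X ^\<^sub>m r) + fip n ((X - Y) * (X - Y)) (Y ^\<^sub>m r))"
proof -
  obtain U f where U: "U \<in> carrier_mat n n" "U\<^sup>T * U = 1\<^sub>m n" "U * U\<^sup>T = 1\<^sub>m n" "X = conj_diag n U f"
    using spectral_conj_diag[OF X] by metis
  obtain W g where W: "W \<in> carrier_mat n n" "W\<^sup>T * W = 1\<^sub>m n" "W * W\<^sup>T = 1\<^sub>m n" "Y = conj_diag n W g"
    using spectral_conj_diag[OF Y] by metis
  \<comment> \<open>\<open>T a b\<close> is the trace of \<open>X^a Y^b\<close>. Both sides of the
    claim are linear combinations of such traces of total degree \<open>r + 2\<close>, pure powers
    being included with exponent 0.\<close>
  define T where "T a b = (\<Sum>i<n. \<Sum>j<n. f i ^ a * g j ^ b * (col U i \<bullet> col W j)\<^sup>2)" for a b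
  have Xp: "X ^\<^sub>m a = conj_diag n U (\<lambda>i. f i ^ a)" for a unfolding U(4) by (rule conj_diag_pow[OF U(1-3)])
  have Yp: "Y ^\<^sub>m a = conj_diag n W (\<lambda>i. g i ^ a)" for a unfolding W(4) by (rule conj_diag_pow[OF W(1-3)])
  have T: "fip n (X ^\<^sub>m a) (Y ^\<^sub>m b) = T a b" for a b
    unfolding Xp Yp T_def by (rule fip_conj_diag[OF U(1) W(1)])
  have I: "X ^\<^sub>m 0 = 1\<^sub>m n" "Y ^\<^sub>m 0 = 1\<^sub>m n" "X ^\<^sub>m 1 = X" "Y ^\<^sub>m 1 = Y" using X Y by auto
  have pc: "X ^\<^sub>m a \<in> carrier_mat n n" "Y ^\<^sub>m a \<in> carrier_mat n n" for a using X Y by auto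
  have ps: "(X ^\<^sub>m a)\<^sup>T = X ^\<^sub>m a" "(Y ^\<^sub>m a)\<^sup>T = Y ^\<^sub>m a" for a
    using conj_diag_sym[OF U(1)] conj_diag_sym[OF W(1)] unfolding Xp Yp sym_mat_def by auto
  have Xm: "X ^\<^sub>m a * X ^\<^sub>m b = X ^\<^sub>m (a + b)" "Y ^\<^sub>m a * Y ^\<^sub>m b = Y ^\<^sub>m (a + b)" for a b
    unfolding Xp Yp conj_diag_mult[OF U(1,2)] conj_diag_mult[OF W(1,2)] by (simp_all add: power_add)
  have one: "fip n (X ^\<^sub>m a) (X ^\<^sub>m b) = T (a + b) 0" "fip n (Y ^\<^sub>m a) (Y ^\<^sub>m b) = T 0 (a + b)" for a b
  proof -
    have "fip n (X ^\<^sub>m a) (X ^\<^sub>m b) = fip n (X ^\<^sub>m a * X ^\<^sub>m b) (Y ^\<^sub>m 0)"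
      using fip_mult_left[OF pc(1) pc(1) one_carrier_mat, of a b] ps X I pc fip_commute[of n "X ^\<^sub>m b" "X ^\<^sub>m a"] by simp
    thus "fip n (X ^\<^sub>m a) (X ^\<^sub>m b) = T (a + b) 0" unfolding Xm T .
    have "fip n (Y ^\<^sub>m a) (Y ^\<^sub>m b) = fip n (X ^\<^sub>m 0) (Y ^\<^sub>m a * Y ^\<^sub>m b)"
      using fip_mult_left[OF pc(2) pc(2) one_carrier_mat, of a b] ps X Y I pc
      by (metis fip_commute right_mult_one_mat)
    thus "fip n (Y ^\<^sub>m a) (Y ^\<^sub>m b) = T 0 (a + b)" unfolding Xm T .
  qed
  have HH: "(X - Y) * (X - Y) = (X ^\<^sub>m 2 - X * Y) - (Y * X - Y ^\<^sub>m 2)"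
  proof -
    have "X ^\<^sub>m 2 = X * X" "Y ^\<^sub>m 2 = Y * Y" using Xm[of 1 1] I by (simp_all add: numeral_2_eq_2)
    thus ?thesis unfolding minus_mult_distrib_mat[OF X(1) Y(1) minus_carrier_mat[OF Y(1)]]
        mult_minus_distrib_mat[OF X(1) X(1) Y(1)] mult_minus_distrib_mat[OF Y(1) X(1) Y(1)] by simp
  qed
  have XY: "X * Y \<in> carrier_mat n n" "Y * X \<in> carrier_mat n n" using X Y by auto
  have st: "X\<^sup>T = X" "Y\<^sup>T = Y" using X Y by (auto simp: sym_mat_def)
  have Hd: "fip n ((X - Y) * (X - Y)) C = fip n (X ^\<^sub>m 2) C - fip n (X * Y) C - fip n (Y * X) C + fip n (Y ^\<^sub>m 2) C" for C
    unfolding HH using XY pc by (simp add: fip_diff_left minus_carrier_mat)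
  have RX: "fip n ((X - Y) * (X - Y)) (X ^\<^sub>m r) = T (r + 2) 0 - 2 * T (r + 1) 1 + T r 2"
  proof -
    have "fip n (X * Y) (X ^\<^sub>m r) = fip n (Y ^\<^sub>m 1) (X ^\<^sub>m (r + 1))"
      using fip_mult_left[OF X(1) Y(1) pc(1)[of r]] Xm(1)[of 1 r] unfolding I st by (metis add.commute)
    moreover have "fip n (Y * X) (X ^\<^sub>m r) = fip n (Y ^\<^sub>m 1) (X ^\<^sub>m (r + 1))"
      using fip_mult_right[OF Y(1) X(1) pc(1)[of r]] Xm(1)[of r 1] unfolding I st by metis
    moreover have "fip n (Y ^\<^sub>m 1) (X ^\<^sub>m (r + 1)) = T (r + 1) 1" "fip n (Y ^\<^sub>m 2) (X ^\<^sub>m r) = T r 2"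
      "fip n (X ^\<^sub>m 2) (X ^\<^sub>m r) = T (r + 2) 0"
      using T fip_commute one(1)[of r 2] by metis+
    ultimately show ?thesis unfolding Hd by linarith
  qed
  have RY: "fip n ((X - Y) * (X - Y)) (Y ^\<^sub>m r) = T 2 r - 2 * T 1 (r + 1) + T 0 (r + 2)"
  proof -
    have "fip n (X * Y) (Y ^\<^sub>m r) = fip n (X ^\<^sub>m 1) (Y ^\<^sub>m (r + 1))"
      using fip_mult_right[OF X(1) Y(1) pc(2)[of r]] Xm(2)[of r 1] unfolding I st by metis
    moreover have "fip n (Y * X) (Y ^\<^sub>m r) = fip n (X ^\<^sub>m 1) (Y ^\<^sub>m (r + 1))"
      using fip_mult_left[OF Y(1) X(1) pc(2)[of r]] Xm(2)[of 1 r] unfolding I st by (metis add.commute)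
    moreover have "fip n (X ^\<^sub>m 1) (Y ^\<^sub>m (r + 1)) = T 1 (r + 1)" "fip n (X ^\<^sub>m 2) (Y ^\<^sub>m r) = T 2 r"
      "fip n (Y ^\<^sub>m 2) (Y ^\<^sub>m r) = T 0 (r + 2)"
      using T fip_commute one(2)[of r 2] by metis+
    ultimately show ?thesis unfolding Hd by linarith
  qed
  have L: "fip n (X - Y) (X ^\<^sub>m Suc r) - fip n (X - Y) (Y ^\<^sub>m Suc r) = T (r + 2) 0 - T (r + 1) 1 - T 1 (r + 1) + T 0 (r + 2)"
  proof -
    have e: "1 + Suc r = r + 2" "Suc r = r + 1" by simp_all
    have "fip n (X ^\<^sub>m 1) (X ^\<^sub>m Suc r) = T (r + 2) 0" "fip n (Y ^\<^sub>m 1) (Y ^\<^sub>m Suc r) = T 0 (r + 2)"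
      unfolding one e(1) by (rule refl)+
    moreover have "fip n (Y ^\<^sub>m 1) (X ^\<^sub>m Suc r) = T (r + 1) 1" "fip n (X ^\<^sub>m 1) (Y ^\<^sub>m Suc r) = T 1 (r + 1)"
      using T fip_commute e(2) by metis+
    ultimately show ?thesis unfolding fip_diff_left[OF X(1) Y(1)] I by linarith
  qed
  have "T (r + 2) 0 - T (r + 1) 1 - T 1 (r + 1) + T 0 (r + 2) =
     (\<Sum>i<n. \<Sum>j<n. ((f i - g j) * (f i ^ Suc r - g j ^ Suc r)) * (col U i \<bullet> col W j)\<^sup>2)"
    unfolding T_def sum_subtractf[symmetric] sum.distrib[symmetric]
    by (intro sum.cong refl) (simp add: algebra_simps)
  also have "\<dots> \<le> (\<Sum>i<n. \<Sum>j<n. ((real r + 1) / 2 * ((f i - g j)\<^sup>2 * (f i ^ r + g j ^ r))) * (col U i \<bullet> col W j)\<^sup>2)"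
    by (intro sum_mono mult_right_mono scalar_covariance_ineq r) auto
  also have "\<dots> = (real r + 1) / 2 * ((T (r + 2) 0 - 2 * T (r + 1) 1 + T r 2) + (T 2 r - 2 * T 1 (r + 1) + T 0 (r + 2)))"
    unfolding T_def sum_subtractf[symmetric] sum.distrib[symmetric] sum_distrib_left
    by (intro sum.cong refl) (simp add: algebra_simps power2_eq_square)
  finally show ?thesis unfolding L RX RY .
qed

text \<open>Weighted arithmetic-geometric mean inequality with integer exponents. The induction step
  multiplies by \<open>a\<close> and adds \<open>(m + 1) x^m (a - x)^2\<close>, which is
  nonnegative.\<close>

lemma young_power:
  fixes a x :: real
  assumes "0 \<le> a" "0 \<le> x"
  shows "real (Suc m) * a * x ^ m \<le> a ^ Suc m + real m * x ^ Suc m"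
proof (induction m)
  case (Suc m)
  have "a * (real (Suc m) * a * x ^ m) \<le> a * (a ^ Suc m + real m * x ^ Suc m)"
    using assms by (intro mult_left_mono Suc.IH) auto
  moreover have "0 \<le> real (Suc m) * x ^ m * (a - x)\<^sup>2" using assms by simp
  ultimately show ?case by (simp add: algebra_simps power2_eq_square)
qed simp

section \<open>Sums over edges and traces of even powers\<close>

definition Ed :: "nat \<Rightarrow> (nat \<times> nat) set" where
  "Ed n = {(i,j). i < j \<and> j < n}"

lemma finite_Ed [simp]: "finite (Ed n)"
  by (rule finite_subset[of _ "{..<n} \<times> {..<n}"]) (auto simp: Ed_def)

text \<open>The independent variables are indexed by increasing pairs; \<open>edge\<close> selects
  that representative, so both entries of a symmetric matrix read the same variable.\<close>

definition edge :: "nat \<Rightarrow> nat \<Rightarrow> nat \<times> nat" where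
  "edge i j = (min i j, max i j)"

lemma edge_commute: "edge i j = edge j i" by (simp add: edge_def min.commute max.commute)

lemma edge_in_Ed: "i < n \<Longrightarrow> j < n \<Longrightarrow> i \<noteq> j \<Longrightarrow> edge i j \<in> Ed n"
  by (auto simp: edge_def Ed_def)

lemma sum_neighbours_eq:
  fixes f :: "nat \<times> nat \<Rightarrow> real"
  assumes "i < n"
  shows "(\<Sum>j<n. if i = j then 0 else f (edge i j)) = (\<Sum>e\<in>Ed n. if fst e = i \<or> snd e = i then f e else 0)"
proof -
  have "(\<Sum>j<n. if i = j then 0 else f (edge i j)) = (\<Sum>j\<in>{j. j < n \<and> j \<noteq> i}. f (edge i j))"
    by (rule sum.mono_neutral_cong_right) auto
  also have "\<dots> = (\<Sum>e\<in>{e \<in> Ed n. fst e = i \<or> snd e = i}. f e)"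
    by (rule sum.reindex_bij_witness[of _ "\<lambda>e. if fst e = i then snd e else fst e" "edge i"])
       (use assms in \<open>auto simp: edge_def Ed_def min_def max_def\<close>)
  also have "\<dots> = (\<Sum>e\<in>Ed n. if fst e = i \<or> snd e = i then f e else 0)"
    by (rule sum.mono_neutral_cong_left) auto
  finally show ?thesis .
qed

lemma sum_pairs_eq_edges:
  fixes g :: "nat \<Rightarrow> nat \<Rightarrow> real"
  shows "(\<Sum>i<n. \<Sum>j<n. if i = j then 0 else g i j) = (\<Sum>e\<in>Ed n. g (fst e) (snd e) + g (snd e) (fst e))"
proof -
  have "(\<Sum>i<n. \<Sum>j<n. if i = j then 0 else g i j) = (\<Sum>x\<in>{..<n} \<times> {..<n}. if fst x = snd x then 0 else g (fst x) (snd x))"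
    by (simp add: sum.cartesian_product case_prod_unfold)
  also have "\<dots> = (\<Sum>x\<in>Ed n \<union> prod.swap ` Ed n. g (fst x) (snd x))"
    by (rule sum.mono_neutral_cong_right) (auto simp: Ed_def image_iff)
  also have "\<dots> = (\<Sum>x\<in>Ed n. g (fst x) (snd x)) + (\<Sum>x\<in>prod.swap ` Ed n. g (fst x) (snd x))"
    by (rule sum.union_disjoint) (simp, simp, auto simp: Ed_def)
  also have "(\<Sum>x\<in>prod.swap ` Ed n. g (fst x) (snd x)) = (\<Sum>x\<in>Ed n. g (snd x) (fst x))"
    by (subst sum.reindex) (auto simp: o_def)
  finally show ?thesis by (simp add: sum.distrib)
qed

lemma pow_mat_diag_nonneg:
  assumes X: "X \<in> carrier_mat n n" "sym_mat X" and "even r" "i < n"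
  shows "0 \<le> (X ^\<^sub>m r) $$ (i,i)"
proof -
  obtain U f where U: "U \<in> carrier_mat n n" "U\<^sup>T * U = 1\<^sub>m n" "U * U\<^sup>T = 1\<^sub>m n" "X = conj_diag n U f"
    using spectral_conj_diag[OF X] by metis
  have "0 \<le> f k ^ r * U $$ (i,k) * U $$ (i,k)" for k
    using assms(3) by (simp add: zero_le_even_power mult.assoc)
  thus ?thesis unfolding U(4) conj_diag_pow[OF U(1-3)] conj_diag_index[OF U(1) assms(4,4)]
    by (intro sum_nonneg) auto
qed

text \<open>A diagonal entry of \<open>X^r\<close> is an average of \<open>r\<close>-th powers of
  eigenvalues with weights \<open>(U $$ (i,k))\<^sup>2\<close>, which sum to 1. Young's inequality
  is applied to \<open>v i\<close> and the squared eigenvalues under this average.\<close>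

lemma trace_young:
  assumes X: "X \<in> carrier_mat n n" "sym_mat X" and v: "\<And>i. i < n \<Longrightarrow> 0 \<le> v i"
  shows "real (Suc m) * (\<Sum>i<n. v i * (X ^\<^sub>m (2 * m)) $$ (i,i))
    \<le> (\<Sum>i<n. v i ^ Suc m) + real m * (\<Sum>i<n. (X ^\<^sub>m (2 * Suc m)) $$ (i,i))"
proof -
  obtain U f where U: "U \<in> carrier_mat n n" "U\<^sup>T * U = 1\<^sub>m n" "U * U\<^sup>T = 1\<^sub>m n" "X = conj_diag n U f"
    using spectral_conj_diag[OF X] by metis
  have diag: "(X ^\<^sub>m r) $$ (i,i) = (\<Sum>k<n. f k ^ r * (U $$ (i,k))\<^sup>2)" if "i < n" for i r
    unfolding U(4) conj_diag_pow[OF U(1-3)] conj_diag_index[OF U(1) that that]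
    by (simp add: power2_eq_square atLeast0LessThan mult.assoc)
  have U1: "(\<Sum>k<n. (U $$ (i,k))\<^sup>2) = 1" if "i < n" for i
    using diag[OF that, of 0] X that by simp
  have "real (Suc m) * (\<Sum>i<n. v i * (X ^\<^sub>m (2 * m)) $$ (i,i)) =
      (\<Sum>i<n. \<Sum>k<n. (real (Suc m) * v i * (f k ^ 2) ^ m) * (U $$ (i,k))\<^sup>2)"
  proof (simp only: sum_distrib_left, intro sum.cong refl)
    fix i assume "i \<in> {..<n}"
    hence i: "i < n" by simp
    show "real (Suc m) * (v i * (X ^\<^sub>m (2 * m)) $$ (i,i)) = (\<Sum>k<n. real (Suc m) * v i * (f k ^ 2) ^ m * (U $$ (i,k))\<^sup>2)"
      unfolding diag[OF i] power_mult sum_distrib_left by (simp only: mult_ac)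
  qed
  also have "\<dots> \<le> (\<Sum>i<n. \<Sum>k<n. (v i ^ Suc m + real m * (f k ^ 2) ^ Suc m) * (U $$ (i,k))\<^sup>2)"
    by (intro sum_mono mult_right_mono young_power v) auto
  also have "\<dots> = (\<Sum>i<n. v i ^ Suc m * (\<Sum>k<n. (U $$ (i,k))\<^sup>2)) + real m * (\<Sum>i<n. \<Sum>k<n. f k ^ (2 * Suc m) * (U $$ (i,k))\<^sup>2)"
    by (simp only: power_mult[symmetric] distrib_right sum.distrib sum_distrib_left mult.assoc)
  also have "\<dots> = (\<Sum>i<n. v i ^ Suc m) + real m * (\<Sum>i<n. (X ^\<^sub>m (2 * Suc m)) $$ (i,i))"
  proof -
    have "(\<Sum>i<n. v i ^ Suc m * (\<Sum>k<n. (U $$ (i,k))\<^sup>2)) = (\<Sum>i<n. v i ^ Suc m)"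
      by (intro sum.cong refl) (simp only: U1 lessThan_iff mult_1_right)
    moreover have "(\<Sum>i<n. \<Sum>k<n. f k ^ (2 * Suc m) * (U $$ (i,k))\<^sup>2) = (\<Sum>i<n. (X ^\<^sub>m (2 * Suc m)) $$ (i,i))"
      by (intro sum.cong refl) (simp only: diag lessThan_iff)
    ultimately show ?thesis by (simp only:)
  qed
  finally show ?thesis .
qed

text \<open>An even power makes every term of the trace nonnegative, so the trace bounds each
  eigenvalue separately.\<close>

lemma op_bound_if_trace_power_le:
  assumes X: "X \<in> carrier_mat n n" "sym_mat X" and t: "0 \<le> t" and m: "0 < m"
    and tr: "(\<Sum>i<n. (X ^\<^sub>m (2 * m)) $$ (i,i)) \<le> t ^ (2 * m)"
  shows "op_bound t X"
proof -
  obtain U f where U: "U \<in> carrier_mat n n" "U\<^sup>T * U = 1\<^sub>m n" "U * U\<^sup>T = 1\<^sub>m n" "X = conj_diag n U f"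
    "\<And>i. i < n \<Longrightarrow> col U i \<bullet> col U i = 1"
    using spectral_conj_diag[OF X] by metis
  have "\<bar>f a\<bar> \<le> t" if a: "a < n" for a
  proof -
    have "(\<Sum>i<n. (X ^\<^sub>m (2 * m)) $$ (i,i)) = (\<Sum>i<n. \<Sum>k<n. f k ^ (2 * m) * (U $$ (i,k))\<^sup>2)"
      by (intro sum.cong refl)
         (simp add: U(4) conj_diag_pow[OF U(1-3)] conj_diag_index[OF U(1)] power2_eq_square atLeast0LessThan mult.assoc)
    also have "\<dots> = (\<Sum>k<n. f k ^ (2 * m) * (col U k \<bullet> col U k))"
      using U(1) by (subst sum.swap) (auto simp: scalar_prod_def sum_distrib_left power2_eq_square atLeast0LessThan intro!: sum.cong)
    also have "\<dots> = (\<Sum>k<n. f k ^ (2 * m))" by (intro sum.cong refl) (simp add: U(5))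
    finally have "(\<Sum>k<n. f k ^ (2 * m)) \<le> t ^ (2 * m)" using tr by simp
    moreover have "f a ^ (2 * m) \<le> (\<Sum>k<n. f k ^ (2 * m))" using a by (intro member_le_sum) auto
    ultimately have "\<bar>f a\<bar> ^ (2 * m) \<le> t ^ (2 * m)" by (simp add: power_even_abs)
    thus ?thesis using t m by (subst (asm) power_mono_iff) auto
  qed
  thus ?thesis by (rule op_bound_spectral[OF U(1-4)]) (use t in auto)
qed

lemma trace_mult_pow:
  assumes X: "X \<in> carrier_mat n n" "sym_mat X"
  shows "(\<Sum>i<n. (X ^\<^sub>m Suc r) $$ (i,i)) = fip n X (X ^\<^sub>m r)"
proof -
  have s: "X $$ (j,i) = X $$ (i,j)" if "i < n" "j < n" for i j
    using X that by (metis carrier_matD index_transpose_mat(1) sym_mat_def)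
  have "X ^\<^sub>m r \<in> carrier_mat n n" using X by simp
  thus ?thesis using X s unfolding fip_def
    by (auto simp: scalar_prod_def atLeast0LessThan mult.commute intro!: sum.cong)
qed

section \<open>Moment bound for random graphs with independent edges\<close>

definition edge_mat :: "nat \<Rightarrow> (nat \<Rightarrow> nat \<Rightarrow> real) \<Rightarrow> real mat" where
  "edge_mat n f = Matrix.mat n n (\<lambda>(i,j). if i = j then 0 else f i j)"

definition graph_mat :: "nat \<Rightarrow> (nat \<times> nat \<Rightarrow> bool) \<Rightarrow> real mat" where
  "graph_mat n Z = edge_mat n (\<lambda>i j. of_bool (Z (edge i j)))"

lemma edge_mat_carrier [simp]: "edge_mat n f \<in> carrier_mat n n" by (simp add: edge_mat_def)
lemma graph_mat_carrier [simp]: "graph_mat n Z \<in> carrier_mat n n" by (simp add: graph_mat_def)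

lemma edge_mat_sym: "(\<And>i j. f i j = f j i) \<Longrightarrow> sym_mat (edge_mat n f)"
  unfolding sym_mat_def edge_mat_def by (intro eq_matI) auto

lemma graph_mat_sym: "sym_mat (graph_mat n Z)"
  unfolding graph_mat_def by (rule edge_mat_sym) (simp add: edge_commute)

lemma row_sum_edge_mat: "i < n \<Longrightarrow> row_sum (edge_mat n f) i = (\<Sum>j<n. if i = j then 0 else f i j)"
  unfolding row_sum_def edge_mat_def by (auto intro!: sum.cong)

text \<open>\<open>H\<close> is the change caused by switching the edge between \<open>i\<close> and
  \<open>j\<close>. Its square is \<open>w\<^sup>2\<close> at the diagonal positions
  \<open>i\<close> and \<open>j\<close> and zero elsewhere, which is why the variance proxy is
  diagonal.\<close>

lemma single_edge_mat:
  assumes ij: "i < n" "j < n" "i \<noteq> j"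
    and H: "H \<in> carrier_mat n n" "\<And>a b. a < n \<Longrightarrow> b < n \<Longrightarrow> H $$ (a,b) = (if a = i \<and> b = j \<or> a = j \<and> b = i then w else 0)"
  shows "C $$ (j,i) = C $$ (i,j) \<Longrightarrow> fip n H C = 2 * w * C $$ (i,j)"
    and "fip n (H * H) C = w\<^sup>2 * (C $$ (i,i) + C $$ (j,j))"
proof -
  have Hrow: "(\<Sum>b<n. H $$ (a,b) * g b) = (if a = i then w * g j else if a = j then w * g i else 0)" if "a < n" for a g
  proof -
    have "(\<Sum>b<n. H $$ (a,b) * g b) = (\<Sum>b<n. (if b = j then (if a = i then w * g j else 0) else 0) + (if b = i then (if a = j then w * g i else 0) else 0))"
      using that ij by (intro sum.cong refl) (auto simp: H(2))
    also have "\<dots> = (if a = i then w * g j else 0) + (if a = j then w * g i else 0)"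
      using ij by (simp add: sum.distrib)
    finally show ?thesis using ij by auto
  qed
  have two: "(\<Sum>a<n. if a = i then x else if a = j then y else 0) = x + (y::real)" for x y
  proof -
    have "(\<Sum>a<n. if a = i then x else if a = j then y else 0) = (\<Sum>a<n. (if a = i then x else 0) + (if a = j then y else 0))"
      using ij by (intro sum.cong) auto
    thus ?thesis using ij by (simp add: sum.distrib)
  qed
  {
    assume "C $$ (j,i) = C $$ (i,j)"
    have "fip n H C = (\<Sum>a<n. if a = i then w * C $$ (i,j) else if a = j then w * C $$ (j,i) else 0)"
      unfolding fip_def by (intro sum.cong refl) (auto simp: Hrow)
    thus "fip n H C = 2 * w * C $$ (i,j)" unfolding two using \<open>C $$ (j,i) = C $$ (i,j)\<close> by simp
  }
  have HH: "(H * H) $$ (a,b) = (if a = i then w * H $$ (j,b) else if a = j then w * H $$ (i,b) else 0)" if "a < n" "b < n" for a b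
  proof -
    have "(H * H) $$ (a,b) = (\<Sum>c<n. H $$ (a,c) * H $$ (c,b))"
      using H(1) that by (simp add: scalar_prod_def atLeast0LessThan)
    thus ?thesis by (simp add: Hrow[OF that(1)])
  qed
  have "fip n (H * H) C = (\<Sum>a<n. if a = i then w * (w * C $$ (i,i)) else if a = j then w * (w * C $$ (j,j)) else 0)"
    unfolding fip_def
  proof (intro sum.cong refl)
    fix a assume "a \<in> {..<n}"
    hence a: "a < n" by simp
    have "(\<Sum>b<n. (H * H) $$ (a,b) * C $$ (a,b)) =
       (\<Sum>b<n. (if a = i then w * (H $$ (j,b) * C $$ (a,b)) else if a = j then w * (H $$ (i,b) * C $$ (a,b)) else 0))"
      using a by (intro sum.cong refl) (auto simp: HH mult.assoc)
    also have "\<dots> = (if a = i then w * (\<Sum>b<n. H $$ (j,b) * C $$ (a,b)) else if a = j then w * (\<Sum>b<n. H $$ (i,b) * C $$ (a,b)) else 0)"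
      by (simp add: sum_distrib_left)
    also have "\<dots> = (if a = i then w * (w * C $$ (i,i)) else if a = j then w * (w * C $$ (j,j)) else 0)"
      using ij by (simp add: Hrow)
    finally show "(\<Sum>b<n. (H * H) $$ (a,b) * C $$ (a,b)) = (if a = i then w * (w * C $$ (i,i)) else if a = j then w * (w * C $$ (j,j)) else 0)" .
  qed
  thus "fip n (H * H) C = w\<^sup>2 * (C $$ (i,i) + C $$ (j,j))" unfolding two by (simp add: power2_eq_square algebra_simps)
qed

locale bern_graph =
  fixes n :: nat and q :: "nat \<Rightarrow> nat \<Rightarrow> real" and dm :: real and d :: "nat \<Rightarrow> real"
  assumes q01: "\<And>i j. 0 \<le> q i j" "\<And>i j. q i j \<le> 1" and qsym: "\<And>i j. q i j = q j i"
    and d_def: "\<And>i. i < n \<Longrightarrow> d i = row_sum (edge_mat n q) i"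
    and dm0: "0 < dm" and d_ge: "\<And>i. i < n \<Longrightarrow> dm \<le> d i"
begin

definition P where "P = Pi_pmf (Ed n) False (\<lambda>e. bernoulli_pmf (q (fst e) (snd e)))"

abbreviation "E g \<equiv> measure_pmf.expectation P (g :: _ \<Rightarrow> real)"

definition w where "w i j = 1 / (sqrt (d i) * sqrt (d j))"

text \<open>The deterministic normalisation \<open>d\<close> keeps the entries of different edges
  independent and centred; observed degrees would destroy both properties.\<close>

definition X where "X Z = nadj n d (graph_mat n Z) - nadj n d (edge_mat n q)"

lemma finite_P: "finite (set_pmf P)"
proof -
  have "set_pmf P \<subseteq> PiE_dflt (Ed n) False (\<lambda>_. UNIV)"
    unfolding P_def using set_Pi_pmf_subset'[OF finite_Ed, of n False] by (fastforce simp: PiE_dflt_def)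
  thus ?thesis by (rule finite_subset) (auto intro!: finite_PiE_dflt)
qed

lemma integrable_P: "integrable (measure_pmf P) (g :: _ \<Rightarrow> real)"
  by (rule integrable_measure_pmf_finite[OF finite_P])

lemma E_mono: "(\<And>Z. f Z \<le> g Z) \<Longrightarrow> E f \<le> E g"
  by (intro integral_mono integrable_P) auto

text \<open>Integrates out the edge \<open>e\<close> with all others fixed. Overwriting the
  coordinate \<open>e\<close> of a full sample stands in for sampling the other edges, so both
  expectations are taken under \<open>P\<close>.\<close>

lemma E_resample:
  assumes e: "e \<in> Ed n"
  defines "qe \<equiv> q (fst e) (snd e)"
  shows "E g = E (\<lambda>Z. qe * g (Z(e := True)) + (1 - qe) * g (Z(e := False)))"
proof -
  define P' where "P' = Pi_pmf (Ed n - {e}) False (\<lambda>e. bernoulli_pmf (q (fst e) (snd e)))"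
  have "insert e (Ed n - {e}) = Ed n" using e by auto
  hence PP: "P = bernoulli_pmf qe \<bind> (\<lambda>y. map_pmf (\<lambda>f. f(e := y)) P')"
    unfolding P_def P'_def qe_def
    using Pi_pmf_insert'[of "Ed n - {e}" e False "\<lambda>e. bernoulli_pmf (q (fst e) (snd e))"] by (simp add: map_pmf_def)
  have fin: "finite (set_pmf P')"
  proof -
    have "set_pmf P' \<subseteq> PiE_dflt (Ed n - {e}) False (\<lambda>_. UNIV)"
      unfolding P'_def using set_Pi_pmf_subset'[of "Ed n - {e}" False] by (fastforce simp: PiE_dflt_def)
    thus ?thesis by (rule finite_subset) (auto intro!: finite_PiE_dflt)
  qed
  have i': "integrable (measure_pmf P') (h :: _ \<Rightarrow> real)" for h by (rule integrable_measure_pmf_finite[OF fin])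
  have q: "0 \<le> qe" "qe \<le> 1" using q01 by (auto simp: qe_def)
  have star: "E h = qe * measure_pmf.expectation P' (\<lambda>f. h (f(e := True))) + (1 - qe) * measure_pmf.expectation P' (\<lambda>f. h (f(e := False)))" for h :: "_ \<Rightarrow> real"
    unfolding PP using q fin
    by (subst pmf_expectation_bind[of "{True, False}"]) auto
  have "E (\<lambda>Z. qe * g (Z(e := True)) + (1 - qe) * g (Z(e := False))) =
     measure_pmf.expectation P' (\<lambda>f. qe * g (f(e := True)) + (1 - qe) * g (f(e := False)))"
    unfolding star by (simp add: algebra_simps)
  also have "\<dots> = qe * measure_pmf.expectation P' (\<lambda>f. g (f(e := True))) + (1 - qe) * measure_pmf.expectation P' (\<lambda>f. g (f(e := False)))"
    using i' by simp
  finally show ?thesis unfolding star[of g] by simp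
qed

lemma X_carrier [simp]: "X Z \<in> carrier_mat n n" unfolding X_def by (rule minus_carrier_mat) simp

lemma X_sym: "sym_mat (X Z)"
  unfolding X_def by (intro diff_sym_mat[of _ n] nadj_sym graph_mat_sym edge_mat_sym qsym) auto

lemma X_index: "i < n \<Longrightarrow> j < n \<Longrightarrow> X Z $$ (i,j) = (if i = j then 0 else w i j * (of_bool (Z (edge i j)) - q i j))"
  by (auto simp: X_def nadj_def graph_mat_def edge_mat_def w_def diff_divide_distrib)

lemma w_commute: "w i j = w j i" by (simp add: w_def mult.commute)

lemma pow_sym: "i < n \<Longrightarrow> j < n \<Longrightarrow> (X Z ^\<^sub>m r) $$ (j,i) = (X Z ^\<^sub>m r) $$ (i,j)"
proof -
  assume ij: "i < n" "j < n"
  obtain U f where U: "U \<in> carrier_mat n n" "U\<^sup>T * U = 1\<^sub>m n" "U * U\<^sup>T = 1\<^sub>m n" "X Z = conj_diag n U f"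
    using spectral_conj_diag[OF X_carrier X_sym, of Z] by metis
  show ?thesis unfolding U(4) conj_diag_pow[OF U(1-3)] using ij by (auto simp: conj_diag_index[OF U(1)] mult_ac intro!: sum.cong)
qed

text \<open>For a Bernoulli variable \<open>x\<close> with mean \<open>q\<close>,
  \<open>E ((x - q) \<phi>(x)) = q (1 - q) (\<phi>(1) - \<phi>(0))\<close>; the increment of \<open>\<phi>\<close> is bounded by
  the matrix covariance inequality.\<close>

lemma edge_step:
  assumes ij: "i < j" "j < n" and r: "even r"
  shows "E (\<lambda>Z. 2 * (X Z $$ (i,j) * (X Z ^\<^sub>m Suc r) $$ (i,j)))
    \<le> (real r + 1) / 2 * E (\<lambda>Z. (w i j)\<^sup>2 * (of_bool (Z (i,j)) + q i j) * ((X Z ^\<^sub>m r) $$ (i,i) + (X Z ^\<^sub>m r) $$ (j,j)))"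
proof -
  let ?e = "(i,j)"
  have e: "?e \<in> Ed n" "edge i j = ?e" using ij by (auto simp: Ed_def edge_def)
  have ij': "i < n" "j < n" "i \<noteq> j" using ij by auto
  define \<psi> where "\<psi> Z = (X Z ^\<^sub>m r) $$ (i,i) + (X Z ^\<^sub>m r) $$ (j,j)" for Z
  have psi0: "0 \<le> \<psi> Z" for Z
    unfolding \<psi>_def using pow_mat_diag_nonneg[OF X_carrier X_sym r] ij' by simp
  define g where "g Z = 2 * (X Z $$ (i,j) * (X Z ^\<^sub>m Suc r) $$ (i,j))" for Z
  define k where "k Z = (w i j)\<^sup>2 * (of_bool (Z ?e) + q i j) * \<psi> Z" for Z
  have q: "0 \<le> q i j" "q i j \<le> 1" using q01 by auto
  have "q i j * g (Z(?e := True)) + (1 - q i j) * g (Z(?e := False))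
     \<le> (real r + 1) / 2 * (q i j * k (Z(?e := True)) + (1 - q i j) * k (Z(?e := False)))" for Z
  proof -
    define A where "A = X (Z(?e := True))"
    define B where "B = X (Z(?e := False))"
    have A: "A \<in> carrier_mat n n" "sym_mat A" and B: "B \<in> carrier_mat n n" "sym_mat B"
      using X_sym by (auto simp: A_def B_def)
    have H: "A - B \<in> carrier_mat n n" by (rule minus_carrier_mat[OF B(1)])
    have Hi: "(A - B) $$ (a,b) = (if a = i \<and> b = j \<or> a = j \<and> b = i then w i j else 0)" if "a < n" "b < n" for a b
    proof -
      have "(A - B) $$ (a,b) = A $$ (a,b) - B $$ (a,b)" using that B by simp
      also have "\<dots> = (if a \<noteq> b \<and> edge a b = ?e then w a b else 0)"
        using that by (auto simp: A_def B_def X_index algebra_simps)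
      also have "(a \<noteq> b \<and> edge a b = ?e) \<longleftrightarrow> (a = i \<and> b = j \<or> a = j \<and> b = i)"
        using ij by (auto simp: edge_def min_def max_def)
      finally show ?thesis using w_commute[of j i] by auto
    qed
    have gA: "g (Z(?e := True)) = 2 * (w i j * (1 - q i j) * (A ^\<^sub>m Suc r) $$ (i,j))"
      unfolding g_def A_def[symmetric] using ij' e by (simp add: A_def X_index)
    have gB: "g (Z(?e := False)) = 2 * (w i j * (0 - q i j) * (B ^\<^sub>m Suc r) $$ (i,j))"
      unfolding g_def B_def[symmetric] using ij' e by (simp add: B_def X_index)
    have "q i j * g (Z(?e := True)) + (1 - q i j) * g (Z(?e := False)) =
       q i j * (1 - q i j) * (2 * w i j * (A ^\<^sub>m Suc r) $$ (i,j) - 2 * w i j * (B ^\<^sub>m Suc r) $$ (i,j))"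
      unfolding gA gB by (simp only: algebra_simps)
    also have "\<dots> = q i j * (1 - q i j) * (fip n (A - B) (A ^\<^sub>m Suc r) - fip n (A - B) (B ^\<^sub>m Suc r))"
      using single_edge_mat(1)[OF ij' H Hi, of "A ^\<^sub>m Suc r"] single_edge_mat(1)[OF ij' H Hi, of "B ^\<^sub>m Suc r"]
        pow_sym[OF ij'(1,2), of "Z(?e := True)" "Suc r"] pow_sym[OF ij'(1,2), of "Z(?e := False)" "Suc r"]
      unfolding A_def[symmetric] B_def[symmetric] by (simp only:)
    also have "\<dots> \<le> q i j * (1 - q i j) * ((real r + 1) / 2 * (fip n ((A - B) * (A - B)) (A ^\<^sub>m r) + fip n ((A - B) * (A - B)) (B ^\<^sub>m r)))"
      by (rule mult_left_mono[OF matrix_covariance_ineq[OF A B r]]) (use q in simp)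
    also have "\<dots> = (real r + 1) / 2 * (w i j)\<^sup>2 * (q i j * (1 - q i j) * (\<psi> (Z(?e := True)) + \<psi> (Z(?e := False))))"
    proof -
      have f: "fip n ((A - B) * (A - B)) (A ^\<^sub>m r) = (w i j)\<^sup>2 * \<psi> (Z(?e := True))"
        "fip n ((A - B) * (A - B)) (B ^\<^sub>m r) = (w i j)\<^sup>2 * \<psi> (Z(?e := False))"
        unfolding \<psi>_def A_def[symmetric] B_def[symmetric] by (rule single_edge_mat(2)[OF ij' H Hi], assumption+)+
      show ?thesis unfolding f by (simp only: distrib_left mult_ac)
    qed
    \<comment> \<open>Enlarging \<open>1 - q\<close> to \<open>1 + q\<close> in one place makes the
      right side the resampled form of an expectation: the weight in \<open>k\<close> is
      \<open>1 + q\<close> when the edge is present and \<open>q\<close> when it is absent.\<close>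
    also have "\<dots> \<le> (real r + 1) / 2 * (w i j)\<^sup>2 * (q i j * (1 + q i j) * \<psi> (Z(?e := True)) + (1 - q i j) * q i j * \<psi> (Z(?e := False)))"
    proof (rule mult_left_mono)
      have "q i j * (1 - q i j) \<le> q i j * (1 + q i j)" using q by (intro mult_left_mono) auto
      from mult_right_mono[OF this psi0[of "Z(?e := True)"]]
      show "q i j * (1 - q i j) * (\<psi> (Z(?e := True)) + \<psi> (Z(?e := False)))
         \<le> q i j * (1 + q i j) * \<psi> (Z(?e := True)) + (1 - q i j) * q i j * \<psi> (Z(?e := False))"
        by (simp add: algebra_simps)
    qed simp
    also have "\<dots> = (real r + 1) / 2 * (q i j * k (Z(?e := True)) + (1 - q i j) * k (Z(?e := False)))"
      unfolding k_def by (simp add: algebra_simps)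
    finally show ?thesis .
  qed
  hence "E g \<le> E (\<lambda>Z. (real r + 1) / 2 * (q i j * k (Z(?e := True)) + (1 - q i j) * k (Z(?e := False))))"
    unfolding E_resample[OF e(1), of g] by (intro E_mono) simp
  also have "\<dots> = (real r + 1) / 2 * E k"
    unfolding E_resample[OF e(1), of k] using integrable_P by simp
  finally show ?thesis unfolding g_def k_def \<psi>_def .
qed

text \<open>The \<open>i\<close>-th diagonal entry of the variance proxy. Edge indicators plus their
  means occur, so it is controlled by the observed degree of \<open>i\<close> together with
  \<open>d i\<close>.\<close>

definition V where "V Z i = (\<Sum>j<n. if i = j then 0 else (w i j)\<^sup>2 * (of_bool (Z (edge i j)) + q i j))"

lemma V_nonneg: "0 \<le> V Z i"
  unfolding V_def using q01 by (intro sum_nonneg) auto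

definition tr where "tr r Z = (\<Sum>i<n. (X Z ^\<^sub>m r) $$ (i,i))"

text \<open>As the pairing of \<open>X\<close> with \<open>X^(2m+1)\<close>, the trace is a sum over
  edges, to which the one-edge estimate applies term by term; regrouping the bounds by endpoint
  produces \<open>V\<close>.\<close>

lemma moment_step:
  "E (tr (2 * Suc m)) \<le> (2 * real m + 1) / 2 * E (\<lambda>Z. \<Sum>i<n. V Z i * (X Z ^\<^sub>m (2 * m)) $$ (i,i))"
proof -
  let ?r = "2 * m"
  have trZ: "tr (2 * Suc m) Z = (\<Sum>e\<in>Ed n. 2 * (X Z $$ (fst e, snd e) * (X Z ^\<^sub>m Suc ?r) $$ (fst e, snd e)))" for Z
  proof -
    have "tr (2 * Suc m) Z = fip n (X Z) (X Z ^\<^sub>m Suc ?r)"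
      unfolding tr_def using trace_mult_pow[OF X_carrier X_sym, of Z "Suc ?r"] by (simp only: mult_Suc_right add_2_eq_Suc)
    also have "\<dots> = (\<Sum>i<n. \<Sum>j<n. if i = j then 0 else X Z $$ (i,j) * (X Z ^\<^sub>m Suc ?r) $$ (i,j))"
      unfolding fip_def by (intro sum.cong refl) (auto simp: X_index)
    also have "\<dots> = (\<Sum>e\<in>Ed n. 2 * (X Z $$ (fst e, snd e) * (X Z ^\<^sub>m Suc ?r) $$ (fst e, snd e)))"
      unfolding sum_pairs_eq_edges
    proof (intro sum.cong refl)
      fix e assume "e \<in> Ed n"
      hence e: "fst e < n" "snd e < n" by (auto simp: Ed_def)
      have "X Z $$ (snd e, fst e) = X Z $$ (fst e, snd e)"
        using e by (metis X_carrier X_sym carrier_matD index_transpose_mat(1) sym_mat_def)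
      thus "X Z $$ (fst e, snd e) * (X Z ^\<^sub>m Suc ?r) $$ (fst e, snd e) + X Z $$ (snd e, fst e) * (X Z ^\<^sub>m Suc ?r) $$ (snd e, fst e)
         = 2 * (X Z $$ (fst e, snd e) * (X Z ^\<^sub>m Suc ?r) $$ (fst e, snd e))"
        using pow_sym[OF e, of Z "Suc ?r"] by (simp only: mult_2)
    qed
    finally show ?thesis .
  qed
  have "tr (2 * Suc m) = (\<lambda>Z. \<Sum>e\<in>Ed n. 2 * (X Z $$ (fst e, snd e) * (X Z ^\<^sub>m Suc ?r) $$ (fst e, snd e)))"
    by (rule ext) (rule trZ)
  hence "E (tr (2 * Suc m)) = E (\<lambda>Z. \<Sum>e\<in>Ed n. 2 * (X Z $$ (fst e, snd e) * (X Z ^\<^sub>m Suc ?r) $$ (fst e, snd e)))"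
    by (simp only:)
  also have "\<dots> = (\<Sum>e\<in>Ed n. E (\<lambda>Z. 2 * (X Z $$ (fst e, snd e) * (X Z ^\<^sub>m Suc ?r) $$ (fst e, snd e))))"
    by (rule Bochner_Integration.integral_sum) (rule integrable_P)
  also have "\<dots> \<le> (\<Sum>e\<in>Ed n. (real ?r + 1) / 2 * E (\<lambda>Z. (w (fst e) (snd e))\<^sup>2 * (of_bool (Z e) + q (fst e) (snd e)) * ((X Z ^\<^sub>m ?r) $$ (fst e, fst e) + (X Z ^\<^sub>m ?r) $$ (snd e, snd e))))"
  proof (rule sum_mono)
    fix e assume "e \<in> Ed n"
    hence "fst e < snd e" "snd e < n" by (auto simp: Ed_def)
    from edge_step[OF this, of ?r] show "E (\<lambda>Z. 2 * (X Z $$ (fst e, snd e) * (X Z ^\<^sub>m Suc ?r) $$ (fst e, snd e)))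
      \<le> (real ?r + 1) / 2 * E (\<lambda>Z. (w (fst e) (snd e))\<^sup>2 * (of_bool (Z e) + q (fst e) (snd e)) * ((X Z ^\<^sub>m ?r) $$ (fst e, fst e) + (X Z ^\<^sub>m ?r) $$ (snd e, snd e)))"
      by simp
  qed
  also have "\<dots> = (real ?r + 1) / 2 * E (\<lambda>Z. \<Sum>e\<in>Ed n. (w (fst e) (snd e))\<^sup>2 * (of_bool (Z e) + q (fst e) (snd e)) * ((X Z ^\<^sub>m ?r) $$ (fst e, fst e) + (X Z ^\<^sub>m ?r) $$ (snd e, snd e)))"
    using integrable_P by (simp only: Bochner_Integration.integral_sum sum_distrib_left[symmetric])
  also have "(\<lambda>Z. \<Sum>e\<in>Ed n. (w (fst e) (snd e))\<^sup>2 * (of_bool (Z e) + q (fst e) (snd e)) * ((X Z ^\<^sub>m ?r) $$ (fst e, fst e) + (X Z ^\<^sub>m ?r) $$ (snd e, snd e)))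
    = (\<lambda>Z. \<Sum>i<n. V Z i * (X Z ^\<^sub>m ?r) $$ (i,i))"
  proof
    fix Z
    have "(\<Sum>i<n. V Z i * (X Z ^\<^sub>m ?r) $$ (i,i)) = (\<Sum>i<n. \<Sum>j<n. if i = j then 0 else (w i j)\<^sup>2 * (of_bool (Z (edge i j)) + q i j) * (X Z ^\<^sub>m ?r) $$ (i,i))"
      unfolding V_def sum_distrib_right by (intro sum.cong refl) auto
    also have "\<dots> = (\<Sum>e\<in>Ed n. (w (fst e) (snd e))\<^sup>2 * (of_bool (Z e) + q (fst e) (snd e)) * ((X Z ^\<^sub>m ?r) $$ (fst e, fst e) + (X Z ^\<^sub>m ?r) $$ (snd e, snd e)))"
      unfolding sum_pairs_eq_edges
    proof (intro sum.cong refl)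
      fix e assume "e \<in> Ed n"
      hence "edge (fst e) (snd e) = e" "edge (snd e) (fst e) = e" by (auto simp: Ed_def edge_def)
      thus "(w (fst e) (snd e))\<^sup>2 * (of_bool (Z (edge (fst e) (snd e))) + q (fst e) (snd e)) * (X Z ^\<^sub>m ?r) $$ (fst e, fst e)
          + (w (snd e) (fst e))\<^sup>2 * (of_bool (Z (edge (snd e) (fst e))) + q (snd e) (fst e)) * (X Z ^\<^sub>m ?r) $$ (snd e, snd e)
         = (w (fst e) (snd e))\<^sup>2 * (of_bool (Z e) + q (fst e) (snd e)) * ((X Z ^\<^sub>m ?r) $$ (fst e, fst e) + (X Z ^\<^sub>m ?r) $$ (snd e, snd e))"
        using w_commute[of "snd e" "fst e"] qsym[of "snd e" "fst e"] by (simp only: distrib_left)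
    qed
    finally show "(\<Sum>e\<in>Ed n. (w (fst e) (snd e))\<^sup>2 * (of_bool (Z e) + q (fst e) (snd e)) * ((X Z ^\<^sub>m ?r) $$ (fst e, fst e) + (X Z ^\<^sub>m ?r) $$ (snd e, snd e)))
      = (\<Sum>i<n. V Z i * (X Z ^\<^sub>m ?r) $$ (i,i))" by simp
  qed
  finally show ?thesis by simp
qed

text \<open>The trace moment of the same order that Young's inequality produces on the right has a
  coefficient below one and is absorbed.\<close>

lemma moment_bound:
  "E (tr (2 * Suc m)) \<le> E (\<lambda>Z. \<Sum>i<n. (real (Suc m) * V Z i) ^ Suc m)"
proof -
  define \<kappa> where "\<kappa> = (2 * real m + 1) / 2"
  define F where "F Z = (\<Sum>i<n. V Z i * (X Z ^\<^sub>m (2 * m)) $$ (i,i))" for Z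
  have \<kappa>: "0 \<le> \<kappa>" "\<kappa> \<le> real (Suc m)" by (auto simp: \<kappa>_def)
  let ?A = "E (\<lambda>Z. \<Sum>i<n. (\<kappa> * V Z i) ^ Suc m)"
  have "real (Suc m) * E (tr (2 * Suc m)) \<le> real (Suc m) * (\<kappa> * E F)"
    unfolding \<kappa>_def F_def by (rule mult_left_mono[OF moment_step]) simp
  also have "\<dots> = E (\<lambda>Z. real (Suc m) * (\<kappa> * F Z))" by simp
  also have "(\<lambda>Z. real (Suc m) * (\<kappa> * F Z)) = (\<lambda>Z. real (Suc m) * (\<Sum>i<n. (\<kappa> * V Z i) * (X Z ^\<^sub>m (2 * m)) $$ (i,i)))"
    unfolding F_def by (simp only: sum_distrib_left mult.assoc)
  also have "E \<dots> \<le> E (\<lambda>Z. (\<Sum>i<n. (\<kappa> * V Z i) ^ Suc m) + real m * tr (2 * Suc m) Z)"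
    unfolding tr_def by (intro E_mono trace_young X_carrier X_sym mult_nonneg_nonneg V_nonneg \<kappa>)
  also have "\<dots> = ?A + real m * E (tr (2 * Suc m))"
    using integrable_P by simp
  finally have "E (tr (2 * Suc m)) \<le> ?A" by (simp add: algebra_simps)
  also have "\<dots> \<le> E (\<lambda>Z. \<Sum>i<n. (real (Suc m) * V Z i) ^ Suc m)"
    by (intro E_mono sum_mono power_mono mult_right_mono mult_nonneg_nonneg V_nonneg \<kappa>)
  finally show ?thesis .
qed

section \<open>Chernoff bounds for the degrees and the tail of the norm\<close>

definition deg where "deg i Z = row_sum (graph_mat n Z) i"

lemma deg_eq: "i < n \<Longrightarrow> deg i Z = (\<Sum>e\<in>Ed n. if fst e = i \<or> snd e = i then of_bool (Z e) else 0)"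
  unfolding deg_def graph_mat_def row_sum_edge_mat by (subst sum_neighbours_eq[symmetric]) auto

lemma d_eq: "i < n \<Longrightarrow> d i = (\<Sum>e\<in>Ed n. if fst e = i \<or> snd e = i then q (fst e) (snd e) else 0)"
proof -
  assume i: "i < n"
  have eq: "q i j = q (fst (edge i j)) (snd (edge i j))" for j
    using qsym[of i j] by (auto simp: edge_def min_def max_def)
  show ?thesis unfolding d_def[OF i] row_sum_edge_mat[OF i] sum_neighbours_eq[OF i, of "\<lambda>e. q (fst e) (snd e)", symmetric]
    by (intro sum.cong refl if_cong eq)
qed

text \<open>A degree is a sum of independent indicators, so its exponential factorises, and
  \<open>1 + x \<le> exp x\<close> bounds each factor. The right side is the moment generating
  function of a Poisson variable of mean \<open>d i\<close>.\<close>

lemma deg_mgf: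
  assumes i: "i < n"
  shows "E (\<lambda>Z. exp (\<theta> * deg i Z)) \<le> exp (d i * (exp \<theta> - 1))"
proof -
  let ?f = "\<lambda>e y. if fst e = i \<or> snd e = i then exp (\<theta> * of_bool y) else 1"
  have "E (\<lambda>Z. exp (\<theta> * deg i Z)) = E (\<lambda>Z. \<Prod>e\<in>Ed n. ?f e (Z e))"
    unfolding deg_eq[OF i] sum_distrib_left exp_sum[OF finite_Ed]
    by (intro arg_cong[where f = E] ext prod.cong refl) auto
  also have "\<dots> = (\<Prod>e\<in>Ed n. measure_pmf.expectation (bernoulli_pmf (q (fst e) (snd e))) (?f e))"
    unfolding P_def by (rule expectation_prod_Pi_pmf) (auto intro: integrable_measure_pmf_finite)
  also have "\<dots> \<le> (\<Prod>e\<in>Ed n. exp (if fst e = i \<or> snd e = i then q (fst e) (snd e) * (exp \<theta> - 1) else 0))"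
  proof (intro prod_mono conjI)
    fix e assume "e \<in> Ed n"
    let ?q = "q (fst e) (snd e)"
    have q: "0 \<le> ?q" "?q \<le> 1" using q01 by auto
    show "0 \<le> measure_pmf.expectation (bernoulli_pmf ?q) (?f e)"
      by (intro Bochner_Integration.integral_nonneg) auto
    have "?q * exp \<theta> + (1 - ?q) = 1 + ?q * (exp \<theta> - 1)" by (simp add: algebra_simps)
    also have "\<dots> \<le> exp (?q * (exp \<theta> - 1))" by (rule exp_ge_add_one_self)
    finally show "measure_pmf.expectation (bernoulli_pmf ?q) (?f e) \<le> exp (if fst e = i \<or> snd e = i then ?q * (exp \<theta> - 1) else 0)"
      using q by (simp add: mult.commute)
  qed
  also have "\<dots> = exp (d i * (exp \<theta> - 1))"
    unfolding exp_sum[OF finite_Ed, symmetric] d_eq[OF i] sum_distrib_right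
    by (intro arg_cong[where f = exp] sum.cong refl) auto
  finally show ?thesis .
qed

lemma markov:
  assumes "\<And>Z. 0 \<le> (f Z :: real)" "0 < c"
  shows "measure_pmf.prob P {Z. c \<le> f Z} \<le> E f / c"
  using integral_Markov_inequality_measure[of "measure_pmf P" f "{}" c] integrable_P[of f] assms by simp

lemma deg_concentration:
  assumes i: "i < n" and b: "0 \<le> b" "b \<le> 2"
  shows "measure_pmf.prob P {Z. b * d i < \<bar>deg i Z - d i\<bar>} \<le> 2 * exp (- (b\<^sup>2 * d i / 4))"
proof -
  have d0: "0 < d i" using d_ge[OF i] dm0 by linarith
  \<comment> \<open>Both tails at once: multiplication by a \<open>\<theta>\<close> of either sign
    turns each into a lower bound on \<open>\<theta> * deg i Z\<close>. For \<open>\<theta>\<close>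
    equal to \<open>b/2\<close> or \<open>- b/2\<close> the exponent becomes
    \<open>- \<theta>\<^sup>2 * d i\<close>. The condition \<open>b \<le> 2\<close> serves the
    quadratic bound for \<open>exp (b/2)\<close>.\<close>
  have tail: "measure_pmf.prob P {Z. \<theta> * c \<le> \<theta> * deg i Z} \<le> exp (- (b\<^sup>2 * d i / 4))"
    if "exp \<theta> - 1 \<le> \<theta> + \<theta>\<^sup>2" "\<theta> * c = \<theta> * d i + 2 * \<theta>\<^sup>2 * d i" "\<theta>\<^sup>2 = b\<^sup>2 / 4" for \<theta> c
  proof -
    have "{Z. \<theta> * c \<le> \<theta> * deg i Z} = {Z. exp (\<theta> * c) \<le> exp (\<theta> * deg i Z)}" by simp
    hence "measure_pmf.prob P {Z. \<theta> * c \<le> \<theta> * deg i Z} \<le> E (\<lambda>Z. exp (\<theta> * deg i Z)) / exp (\<theta> * c)"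
      using markov[of "\<lambda>Z. exp (\<theta> * deg i Z)" "exp (\<theta> * c)"] by simp
    also have "\<dots> \<le> exp (d i * (exp \<theta> - 1)) / exp (\<theta> * c)" by (intro divide_right_mono deg_mgf i) auto
    also have "\<dots> = exp (d i * (exp \<theta> - 1) - \<theta> * c)" by (simp add: exp_diff)
    also have "\<dots> \<le> exp (d i * (\<theta> + \<theta>\<^sup>2) - \<theta> * c)"
      using mult_left_mono[OF that(1), of "d i"] d0 by simp
    also have "d i * (\<theta> + \<theta>\<^sup>2) - \<theta> * c = - (b\<^sup>2 * d i / 4)" unfolding that(2) that(3) by (simp add: algebra_simps)
    finally show ?thesis .
  qed
  have up: "measure_pmf.prob P {Z. b/2 * ((1 + b) * d i) \<le> b/2 * deg i Z} \<le> exp (- (b\<^sup>2 * d i / 4))"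
  proof (rule tail)
    show "exp (b/2) - 1 \<le> b/2 + (b/2)\<^sup>2" using exp_bound[of "b/2"] b by simp
  qed (simp_all add: power2_eq_square algebra_simps)
  have lo: "measure_pmf.prob P {Z. (- b/2) * ((1 - b) * d i) \<le> (- b/2) * deg i Z} \<le> exp (- (b\<^sup>2 * d i / 4))"
  proof (rule tail)
    define x where "x = b / 2"
    have x: "0 \<le> x" using b by (simp add: x_def)
    have "exp (- x) = 1 / exp x" by (simp add: exp_minus field_simps)
    also have "\<dots> \<le> 1 / (1 + x)" using x exp_ge_add_one_self[of x] by (intro divide_left_mono) auto
    also have "\<dots> \<le> 1 - x + x\<^sup>2"
    proof -
      have "(1 - x + x\<^sup>2) * (1 + x) = 1 + x ^ 3" by (simp add: power2_eq_square power3_eq_cube algebra_simps)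
      also have "\<dots> \<ge> 1" using x by simp
      finally show ?thesis using x by (simp add: field_simps)
    qed
    finally show "exp (- b/2) - 1 \<le> - b/2 + (- b/2)\<^sup>2" by (simp add: x_def)
  qed (simp_all add: power2_eq_square algebra_simps)
  have "{Z. b * d i < \<bar>deg i Z - d i\<bar>} \<subseteq>
     {Z. b/2 * ((1 + b) * d i) \<le> b/2 * deg i Z} \<union> {Z. (- b/2) * ((1 - b) * d i) \<le> (- b/2) * deg i Z}"
  proof
    fix Z assume "Z \<in> {Z. b * d i < \<bar>deg i Z - d i\<bar>}"
    hence "(1 + b) * d i \<le> deg i Z \<or> deg i Z \<le> (1 - b) * d i" by (auto simp: algebra_simps abs_if split: if_splits)
    thus "Z \<in> {Z. b/2 * ((1 + b) * d i) \<le> b/2 * deg i Z} \<union> {Z. (- b/2) * ((1 - b) * d i) \<le> (- b/2) * deg i Z}"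
    proof
      assume "(1 + b) * d i \<le> deg i Z"
      from mult_left_mono[OF this, of "b/2"] show ?thesis using b by simp
    next
      assume "deg i Z \<le> (1 - b) * d i"
      from mult_left_mono_neg[OF this, of "- b/2"] show ?thesis using b by simp
    qed
  qed
  hence "measure_pmf.prob P {Z. b * d i < \<bar>deg i Z - d i\<bar>} \<le> measure_pmf.prob P ({Z. b/2 * ((1 + b) * d i) \<le> b/2 * deg i Z} \<union> {Z. (- b/2) * ((1 - b) * d i) \<le> (- b/2) * deg i Z})"
    by (intro measure_pmf.finite_measure_mono) auto
  also have "\<dots> \<le> measure_pmf.prob P {Z. b/2 * ((1 + b) * d i) \<le> b/2 * deg i Z} + measure_pmf.prob P {Z. (- b/2) * ((1 - b) * d i) \<le> (- b/2) * deg i Z}"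
    by (rule measure_Un_le) auto
  also have "\<dots> \<le> 2 * exp (- (b\<^sup>2 * d i / 4))" using up lo by linarith
  finally show ?thesis .
qed

text \<open>The exponential enters through \<open>1 + x \<le> exp x\<close>, so that powers of
  \<open>V\<close> become moment generating functions of the degree. Bounding \<open>d j\<close>
  below by \<open>dm\<close> removes the neighbour from the weight.\<close>

lemma V_le:
  assumes i: "i < n"
  shows "V Z i \<le> 1 / dm * exp (deg i Z / d i)"
proof -
  have d0: "0 < d i" using d_ge[OF i] dm0 by linarith
  have "V Z i \<le> (\<Sum>j<n. 1 / (d i * dm) * ((if i = j then 0 else of_bool (Z (edge i j))) + (if i = j then 0 else q i j)))"
    unfolding V_def
  proof (intro sum_mono)
    fix j assume "j \<in> {..<n}"
    hence j: "dm \<le> d j" using d_ge by simp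
    have "(w i j)\<^sup>2 = 1 / (d i * d j)" using d0 j dm0 by (simp add: w_def power_divide power_mult_distrib)
    also have "\<dots> \<le> 1 / (d i * dm)" using d0 j dm0 by (intro divide_left_mono mult_left_mono mult_pos_pos) auto
    finally have "(w i j)\<^sup>2 \<le> 1 / (d i * dm)" .
    from mult_right_mono[OF this, of "of_bool (Z (edge i j)) + q i j"]
    show "(if i = j then 0 else (w i j)\<^sup>2 * (of_bool (Z (edge i j)) + q i j))
       \<le> 1 / (d i * dm) * ((if i = j then 0 else of_bool (Z (edge i j))) + (if i = j then 0 else q i j))"
      using q01 by simp
  qed
  also have "\<dots> = 1 / (d i * dm) * (deg i Z + d i)"
    unfolding deg_def graph_mat_def d_def[OF i] row_sum_edge_mat[OF i] sum_distrib_left[symmetric] sum.distrib ..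
  also have "\<dots> = 1 / dm * (1 + deg i Z / d i)" using d0 dm0 by (simp add: field_simps)
  also have "\<dots> \<le> 1 / dm * exp (deg i Z / d i)"
    using dm0 exp_ge_add_one_self by (intro mult_left_mono) auto
  finally show ?thesis .
qed

text \<open>Markov's inequality is applied at the level \<open>(exp 3 * M / dm)^M\<close> of the
  trace. The moment is at most \<open>n (M / dm)^M exp (2 M)\<close>, so a factor
  \<open>exp (- M)\<close> remains.\<close>

lemma norm_concentration:
  assumes M: "1 \<le> M" "real M \<le> dm"
  shows "measure_pmf.prob P {Z. \<not> op_bound (sqrt (exp 3 * real M / dm)) (X Z)} \<le> real n * exp (- real M)"
proof -
  define t where "t = sqrt (exp 3 * real M / dm)"
  define c where "c = (exp 3 * real M / dm) ^ M"
  have M0: "0 < exp 3 * real M / dm" using M dm0 by simp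
  have c: "0 < c" unfolding c_def using M0 by simp
  have tc: "t ^ (2 * M) = c" unfolding t_def c_def power_mult using M0 by simp
  obtain m where m: "M = Suc m" using M by (cases M) auto
  have "E (tr (2 * M)) \<le> E (\<lambda>Z. \<Sum>i<n. (real M * V Z i) ^ M)" unfolding m by (rule moment_bound)
  also have "\<dots> = (\<Sum>i<n. E (\<lambda>Z. (real M * V Z i) ^ M))" by (rule Bochner_Integration.integral_sum) (rule integrable_P)
  also have "\<dots> \<le> (\<Sum>i<n. (real M / dm) ^ M * exp (2 * real M))"
  proof (rule sum_mono)
    fix i assume "i \<in> {..<n}"
    hence i: "i < n" by simp
    have d0: "0 < d i" "real M \<le> d i" using d_ge[OF i] dm0 M by linarith+
    define \<theta> where "\<theta> = real M / d i"
    have th: "0 \<le> \<theta>" "\<theta> \<le> 1" using d0 by (auto simp: \<theta>_def)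
    have "E (\<lambda>Z. (real M * V Z i) ^ M) \<le> E (\<lambda>Z. (real M / dm) ^ M * exp (\<theta> * deg i Z))"
    proof (rule E_mono)
      fix Z
      have "real M * V Z i \<le> real M / dm * exp (deg i Z / d i)"
        using mult_left_mono[OF V_le[OF i], of "real M" Z] by simp
      hence "(real M * V Z i) ^ M \<le> (real M / dm * exp (deg i Z / d i)) ^ M"
        by (intro power_mono mult_nonneg_nonneg V_nonneg) auto
      also have "\<dots> = (real M / dm) ^ M * exp (\<theta> * deg i Z)"
        unfolding power_mult_distrib exp_of_nat_mult[symmetric] \<theta>_def by simp
      finally show "(real M * V Z i) ^ M \<le> (real M / dm) ^ M * exp (\<theta> * deg i Z)" .
    qed
    also have "\<dots> = (real M / dm) ^ M * E (\<lambda>Z. exp (\<theta> * deg i Z))" by simp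
    also have "\<dots> \<le> (real M / dm) ^ M * exp (2 * real M)"
    proof (rule mult_left_mono)
      \<comment> \<open>The assumption \<open>M \<le> dm\<close> makes
        \<open>\<theta> = M / d i\<close> at most 1, where
        \<open>exp \<theta> - 1 \<le> 2 * \<theta>\<close>; this is the origin of
        \<open>exp (2 * real M)\<close>.\<close>
      have "\<theta>\<^sup>2 \<le> \<theta>" using th by (simp add: power2_eq_square mult_left_le)
      hence "exp \<theta> - 1 \<le> 2 * \<theta>" using exp_bound[OF th] by linarith
      hence "d i * (exp \<theta> - 1) \<le> d i * (2 * \<theta>)" using d0 by (intro mult_left_mono) auto
      also have "\<dots> = 2 * real M" using d0 by (simp add: \<theta>_def)
      finally show "E (\<lambda>Z. exp (\<theta> * deg i Z)) \<le> exp (2 * real M)"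
        using deg_mgf[OF i, of \<theta>] by (meson exp_le_cancel_iff order_trans)
    qed (use dm0 in simp)
    finally show "E (\<lambda>Z. (real M * V Z i) ^ M) \<le> (real M / dm) ^ M * exp (2 * real M)" .
  qed
  also have "\<dots> = real n * exp (- real M) * c"
  proof -
    have "c = (real M / dm) ^ M * exp (3 * real M)"
      unfolding c_def by (simp add: power_divide power_mult_distrib exp_of_nat_mult[symmetric] mult.commute)
    moreover have "exp (2 * real M) = exp (- real M) * exp (3 * real M)" by (simp flip: exp_add)
    ultimately show ?thesis by simp
  qed
  finally have Etr: "E (tr (2 * M)) \<le> real n * exp (- real M) * c" .
  have "0 \<le> tr (2 * M) Z" for Z
    unfolding tr_def by (intro sum_nonneg pow_mat_diag_nonneg[OF X_carrier X_sym]) auto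
  hence "measure_pmf.prob P {Z. c \<le> tr (2 * M) Z} \<le> E (tr (2 * M)) / c" using c by (intro markov)
  also have "\<dots> \<le> real n * exp (- real M)" using Etr c by (simp add: divide_le_eq)
  finally have "measure_pmf.prob P {Z. c \<le> tr (2 * M) Z} \<le> real n * exp (- real M)" .
  moreover have "{Z. \<not> op_bound t (X Z)} \<subseteq> {Z. c \<le> tr (2 * M) Z}"
  proof (rule ccontr)
    assume "\<not> ?thesis"
    then obtain Z where "\<not> op_bound t (X Z)" "tr (2 * M) Z < c" by fastforce
    moreover have "op_bound t (X Z)" if "tr (2 * M) Z < c"
      by (rule op_bound_if_trace_power_le[OF X_carrier X_sym, of _ M])
         (use that M M0 in \<open>auto simp: t_def tr_def tc[unfolded t_def]\<close>)
    ultimately show False by blast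
  qed
  hence "measure_pmf.prob P {Z. \<not> op_bound t (X Z)} \<le> measure_pmf.prob P {Z. c \<le> tr (2 * M) Z}"
    by (intro measure_pmf.finite_measure_mono) auto
  ultimately show ?thesis unfolding t_def by linarith
qed

end

section \<open>From the signed stochastic block model to Bernoulli graphs\<close>

text \<open>Since \<open>M \<le> 2 L\<close> and \<open>exp 3 \<le> 27\<close>,
  \<open>t\<^sup>2\<close> is at most \<open>108 / \<rho>\<close>, rounded up to 121 over
  \<open>\<rho>\<close>. The reweighting adds \<open>b (2 + b) \<le> 9 / sqrt \<rho>\<close>, and 11
  + 9 = 20. With \<open>b = 3 / sqrt \<rho>\<close> the degree exponent
  \<open>b\<^sup>2 dm / 4\<close> is \<open>9 L / 8\<close>, enough for \<open>exp (- L)\<close>;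
  \<open>\<rho> \<ge> 9\<close> gives \<open>b \<le> 1\<close>.\<close>

lemma (in bern_graph) lap_concentration:
  assumes L: "1 \<le> L" and r: "9 \<le> \<rho>" and dm: "dm = \<rho> * L / 2"
  shows "measure_pmf.prob P {Z. \<not> op_bound (20 / sqrt \<rho>)
      (nadj n (row_sum (graph_mat n Z)) (graph_mat n Z) - nadj n d (edge_mat n q))} \<le> 3 * real n * exp (- L)"
proof -
  define b where "b = 3 / sqrt \<rho>"
  define M where "M = nat \<lceil>L\<rceil>"
  define t where "t = sqrt (exp 3 * real M / dm)"
  have r3: "3 \<le> sqrt \<rho>" using r by (simp add: real_le_rsqrt)
  have b: "0 \<le> b" "b \<le> 1" using r3 r by (auto simp: b_def divide_le_eq_1)
  have M_ge: "L \<le> real M" "real M \<le> L + 1" using L unfolding M_def by linarith+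
  have M: "1 \<le> M" "real M \<le> 2 * L" using M_ge L by linarith+
  have "4 * L \<le> \<rho> * L" using r L by (intro mult_right_mono) auto
  hence Mdm: "real M \<le> dm" using M(2) unfolding dm by linarith
  have t_le: "t \<le> 11 / sqrt \<rho>"
  proof -
    have "exp (3::real) = exp 1 ^ 3" by (simp flip: exp_of_nat_mult)
    also have "\<dots> \<le> 3 ^ 3" by (intro power_mono exp_le) auto
    finally have "exp 3 * real M \<le> 27 * (2 * L)" using M(2) by (intro mult_mono) auto
    hence "exp 3 * real M / dm \<le> 27 * (2 * L) / dm" using dm0 by (intro divide_right_mono) auto
    also have "\<dots> = 108 / \<rho>" unfolding dm using L r by simp
    also have "\<dots> \<le> 121 / \<rho>" using r by (intro divide_right_mono) auto
    finally have "t \<le> sqrt (121 / \<rho>)" unfolding t_def by (rule real_sqrt_le_mono)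
    also have "\<dots> = 11 / sqrt \<rho>"
    proof -
      have "sqrt (121::real) = 11" by (rule real_sqrt_unique) auto
      thus ?thesis by (simp add: real_sqrt_divide)
    qed
    finally show ?thesis .
  qed
  have total: "t + b * (2 + b) \<le> 20 / sqrt \<rho>"
  proof -
    have "b * (2 + b) \<le> b * 3" using b by (intro mult_left_mono) auto
    hence "t + b * (2 + b) \<le> 11 / sqrt \<rho> + 3 / sqrt \<rho> * 3" using t_le by (simp add: b_def)
    also have "\<dots> = 20 / sqrt \<rho>" by (simp flip: add_divide_distrib)
    finally show ?thesis .
  qed
  let ?bad = "\<lambda>i. {Z. b * d i < \<bar>deg i Z - d i\<bar>}"
  have good: "op_bound (20 / sqrt \<rho>) (nadj n (row_sum (graph_mat n Z)) (graph_mat n Z) - nadj n d (edge_mat n q))"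
    if "op_bound t (X Z)" "\<And>i. i < n \<Longrightarrow> \<bar>deg i Z - d i\<bar> \<le> b * d i" for Z
  proof -
    let ?B = "graph_mat n Z"
    let ?N = "nadj n (row_sum ?B) ?B" and ?K = "nadj n d ?B" and ?Q = "nadj n d (edge_mat n q)"
    have "op_bound (b * (2 + b)) (?K - ?N)"
    proof (rule op_bound_nadj_reweight[OF graph_mat_carrier graph_mat_sym])
      show "0 \<le> ?B $$ (i,j)" if "i < n" "j < n" for i j using that by (simp add: graph_mat_def edge_mat_def)
      show "0 < d i" if "i < n" for i using d_ge[OF that] dm0 by linarith
      show "\<bar>row_sum ?B i - d i\<bar> \<le> b * d i" if "i < n" for i using \<open>\<And>i. i < n \<Longrightarrow> \<bar>deg i Z - d i\<bar> \<le> b * d i\<close>[OF that] by (simp add: deg_def)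
    qed (rule b)
    moreover have "op_bound t (?K - ?Q)" using that(1) by (simp add: X_def)
    ultimately have "op_bound (t + b * (2 + b)) ((?K - ?Q) - (?K - ?N))"
      by (intro op_bound_diff[of _ _ _ _ n n] minus_carrier_mat) auto
    moreover have "(?K - ?Q) - (?K - ?N) = ?N - ?Q" by (intro eq_matI) (auto simp: nadj_def)
    ultimately show ?thesis using op_bound_mono[OF _ total] by simp
  qed
  hence "{Z. \<not> op_bound (20 / sqrt \<rho>) (nadj n (row_sum (graph_mat n Z)) (graph_mat n Z) - nadj n d (edge_mat n q))}
     \<subseteq> {Z. \<not> op_bound t (X Z)} \<union> (\<Union>i\<in>{..<n}. ?bad i)" by (fastforce simp: not_less)
  hence "measure_pmf.prob P {Z. \<not> op_bound (20 / sqrt \<rho>) (nadj n (row_sum (graph_mat n Z)) (graph_mat n Z) - nadj n d (edge_mat n q))}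
     \<le> measure_pmf.prob P ({Z. \<not> op_bound t (X Z)} \<union> (\<Union>i\<in>{..<n}. ?bad i))"
    by (intro measure_pmf.finite_measure_mono) auto
  also have "\<dots> \<le> measure_pmf.prob P {Z. \<not> op_bound t (X Z)} + measure_pmf.prob P (\<Union>i\<in>{..<n}. ?bad i)"
    by (rule measure_Un_le) auto
  also have "measure_pmf.prob P (\<Union>i\<in>{..<n}. ?bad i) \<le> (\<Sum>i<n. measure_pmf.prob P (?bad i))"
    by (rule measure_pmf.finite_measure_subadditive_finite) auto
  also have "\<dots> \<le> (\<Sum>i<n. 2 * exp (- L))"
  proof (rule sum_mono)
    fix i assume "i \<in> {..<n}"
    hence i: "i < n" by simp
    have "b\<^sup>2 = 9 / \<rho>" using r by (simp add: b_def power_divide)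
    hence "b\<^sup>2 * dm = 9 * L / 2" unfolding dm using r by simp
    moreover have "b\<^sup>2 * dm \<le> b\<^sup>2 * d i" using d_ge[OF i] by (intro mult_left_mono) auto
    ultimately have "- (b\<^sup>2 * d i / 4) \<le> - L" using L by linarith
    hence "exp (- (b\<^sup>2 * d i / 4)) \<le> exp (- L)" by simp
    thus "measure_pmf.prob P (?bad i) \<le> 2 * exp (- L)" using deg_concentration[OF i b(1)] b(2) by linarith
  qed
  also have "measure_pmf.prob P {Z. \<not> op_bound t (X Z)} \<le> real n * exp (- real M)"
    unfolding t_def by (rule norm_concentration[OF M(1) Mdm])
  also have "real n * exp (- real M) \<le> real n * exp (- L)" using M_ge by (intro mult_left_mono) auto
  finally show ?thesis by simp
qed

section \<open>Deterministic conclusions for population and sample eigenvectors\<close>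

lemma is_Vk_orthonormal:
  assumes "is_Vk T k V" "T \<in> carrier_mat n n"
  shows "V \<in> carrier_mat n k" "V\<^sup>T * V = 1\<^sub>m k"
  using assms unfolding is_Vk_def Let_def by auto

lemma orth_mat_transpose:
  assumes "orth_mat k R"
  shows "R \<in> carrier_mat k k" "R\<^sup>T * R = 1\<^sub>m k" "R * R\<^sup>T = 1\<^sub>m k"
proof -
  show R: "R \<in> carrier_mat k k" "R\<^sup>T * R = 1\<^sub>m k" using assms by (auto simp: orth_mat_def)
  show "R * R\<^sup>T = 1\<^sub>m k" by (rule mat_mult_left_right_inverse[OF _ R]) (use R in simp)
qed

lemma op_bound_zero_eq:
  assumes "op_bound 0 M" "M \<in> carrier_mat n k"
  shows "M = 0\<^sub>m n k"
proof (rule eq_matI)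
  fix i j assume ij: "i < dim_row (0\<^sub>m n k :: real mat)" "j < dim_col (0\<^sub>m n k :: real mat)"
  have "vnorm (M *\<^sub>v unit_vec k j) \<le> 0 * vnorm (unit_vec k j)" by (rule op_boundD[OF assms]) simp
  hence "M *\<^sub>v unit_vec k j = 0\<^sub>v n" using vnorm_eq_0[of "M *\<^sub>v unit_vec k j" n] vnorm_nonneg[of "M *\<^sub>v unit_vec k j"] assms(2) by auto
  moreover have "(M *\<^sub>v unit_vec k j) $ i = M $$ (i,j)" using ij assms(2) by simp
  ultimately show "M $$ (i,j) = 0\<^sub>m n k $$ (i,j)" using ij by simp
qed (use assms in auto)

lemma op_bound_zero_mat: "op_bound 0 (0\<^sub>m n k)"
proof (rule op_boundI[of _ n k])
  fix x :: "real vec" assume "x \<in> carrier_vec k"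
  hence "0\<^sub>m n k *\<^sub>v x = 0\<^sub>v n" by (intro eq_vecI) auto
  thus "vnorm (0\<^sub>m n k *\<^sub>v x) \<le> 0 * vnorm x" by simp
qed auto

context sponge
begin

text \<open>The perturbation bound is applied to \<open>Tb\<close> against itself with error 0,
  which places the columns of \<open>Vb\<close> in the range of \<open>Th\<close>. Their coordinates
  \<open>R\<close> are orthogonal because both matrices have orthonormal columns.\<close>

lemma Vk_population:
  assumes Vb: "is_Vk Tb k Vb"
  obtains R where "orth_mat k R" "Vb = Th * R" "Gk Lm tp Vb = Th * inv_sqrt_mat Cm * R"
proof -
  note V = is_Vk_orthonormal[OF Vb Tb_props(5)] and T = neg.Th_carrier neg.Th_orthonormal
  obtain K where K: "K \<in> carrier_mat k k" "Tb * Th = Th * K" using Tb_Th by blast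
  have bm: "bb < \<mu>" using bb_less mu_pos beta mult_strict_right_mono[of \<beta> 1 \<mu>] by linarith
  have "Tb - Tb = 0\<^sub>m n n" using Tb_props(5) by (intro eq_matI) auto
  hence "op_bound 0 (Tb - Tb)" using op_bound_zero_mat by simp
  from is_Vk_davis_kahan[OF Tb_props(5,6) Tb_props(5,6) T K Tb_low Tb_up Tb_props(7) this bb_nonneg _ Vb] bm
  have "op_bound 0 (Vb - Th * (Th\<^sup>T * Vb))" by simp
  moreover have tT: "Th\<^sup>T \<in> carrier_mat k n" using T by simp
  define R where "R = Th\<^sup>T * Vb"
  have R: "R \<in> carrier_mat k k" unfolding R_def by (rule mult_carrier_mat[OF tT V(1)])
  have TR: "Th * R \<in> carrier_mat n k" by (rule mult_carrier_mat[OF T(1) R])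
  ultimately have "Vb - Th * R = 0\<^sub>m n k" using op_bound_zero_eq[OF _ minus_carrier_mat[OF TR], of Vb] by (simp add: R_def)
  hence VR: "Vb = Th * R"
  proof -
    assume 0: "Vb - Th * R = 0\<^sub>m n k"
    have "Vb $$ (i,j) = (Th * R) $$ (i,j)" if "i < n" "j < k" for i j
    proof -
      have "(Vb - Th * R) $$ (i,j) = Vb $$ (i,j) - (Th * R) $$ (i,j)" by (rule index_minus_mat(1)) (use that TR in auto)
      thus ?thesis unfolding 0 using that by simp
    qed
    thus ?thesis using V(1) TR by (intro eq_matI) (auto simp only: carrier_matD)
  qed
  have "R\<^sup>T * R = R\<^sup>T * (Th\<^sup>T * Th * R)" unfolding T(2) using R by simp
  also have "\<dots> = (R\<^sup>T * Th\<^sup>T) * (Th * R)"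
    using R T(1) tT TR assoc_mult_mat[of "R\<^sup>T" k k "Th\<^sup>T" n "Th * R" k] assoc_mult_mat[OF tT T(1) R] by simp
  also have "\<dots> = 1\<^sub>m k" using V(2) unfolding VR transpose_mult[OF T(1) R] .
  finally have "orth_mat k R" using R by (simp add: orth_mat_def)
  moreover have "Gk Lm tp Vb = Th * inv_sqrt_mat Cm * R"
  proof -
    have "dim_row Lm = n" using neg.L_props(1) by auto
    hence "Gk Lm tp Vb = Sb * (Th * R)" unfolding Gk_def VR by simp
    also have "\<dots> = (Sb * Th) * R" using assoc_mult_mat[OF pos_def_matD(1)[OF Tb_props(2)] T(1) R] by simp
    finally show ?thesis unfolding Sb_Th .
  qed
  ultimately show ?thesis using that VR by blast
qed

text \<open>The left side is the Lipschitz factor of \<open>sponge_op_perturbation\<close>; the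
  larger constant \<open>C1\<close> of the statement may thus replace it.\<close>

lemma C1_ge: "(2 + tm) / tp\<^sup>2 + 1 / tp \<le> C1 tp tm / 3"
proof -
  have t: "0 < tp" "0 \<le> tm" using basic by auto
  have "1 * (2 + tm) \<le> (2 * sqrt tp + 1) * (3 + tm)" using t by (intro mult_mono) auto
  hence "2 + tm + tp \<le> (3 + tm) * (2 * sqrt tp + 1) + tp" by (simp add: mult.commute)
  hence "(2 + tm + tp) / tp\<^sup>2 \<le> ((3 + tm) * (2 * sqrt tp + 1) + tp) / tp\<^sup>2" by (rule divide_right_mono) simp
  moreover have "(2 + tm) / tp\<^sup>2 + 1 / tp = (2 + tm + tp) / tp\<^sup>2" using t by (simp add: add_divide_distrib power2_eq_square)
  moreover have "C1 tp tm / 3 = ((3 + tm) * (2 * sqrt tp + 1) + tp) / tp\<^sup>2" unfolding C1_def by (simp add: divide_simps)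
  ultimately show ?thesis by metis
qed

text \<open>Both eigenvector matrices are compared with \<open>Th\<close>: \<open>V\<close> is close
  to \<open>Th * Q0\<close> and \<open>Vb = Th * R\<close>, which suggests
  \<open>Q = R\<^sup>T * Q0\<close>. For \<open>Gk\<close> the error splits into the eigenvector
  error multiplied by \<open>S\<close> and the error of the inverse root multiplied by
  \<open>Vb * Q\<close>.\<close>

lemma Vk_sample:
  assumes L1: "L1 \<in> carrier_mat n n" "sym_mat L1" "\<And>x. x \<in> carrier_vec n \<Longrightarrow> 0 \<le> x \<bullet> (L1 *\<^sub>v x)" "op_bound 2 L1"
    and L2: "L2 \<in> carrier_mat n n" "sym_mat L2" "\<And>x. x \<in> carrier_vec n \<Longrightarrow> 0 \<le> x \<bullet> (L2 *\<^sub>v x)"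
    and D: "op_bound \<Delta> (L1 - Lp)" "op_bound \<Delta> (L2 - Lm)"
    and delta: "0 < \<delta>" "\<delta> < 1" and Dd: "\<Delta> \<le> \<delta>" and Dc: "\<Delta> * C1 tp tm / 3 \<le> \<delta> * ((1 - \<beta>) * \<mu>) / 60"
    and V: "is_Vk (sponge_op L1 L2 tp tm) k V" and Vb: "is_Vk Tb k Vb"
  shows "\<exists>Q. orth_mat k Q \<and> spec_norm (V - Vb * Q) \<le> \<delta> \<and>
     spec_norm (Gk L2 tp V - Gk Lm tp Vb * Q) \<le> \<delta> / sqrt tp + \<delta> / tp ^ 2"
proof -
  have t: "0 < tp" "0 \<le> tm" using basic by auto
  have D0: "0 \<le> \<Delta>" using op_bound_nonneg[OF D(1)] .
  define T where "T = sponge_op L1 L2 tp tm"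
  define S where "S = inv_sqrt_mat (L2 + tp \<cdot>\<^sub>m 1\<^sub>m n)"
  define e where "e = \<Delta> * ((2 + tm) / tp\<^sup>2 + 1 / tp)"
  define g where "g = (1 - \<beta>) * \<mu>"
  have S: "pos_def_mat n S" "op_bound (1 / sqrt tp) S" unfolding S_def
    by (rule sponge_op_factor[OF L1(1,2) L2(1,2) L1(3) L2(3) t]; assumption)+
  have T: "T \<in> carrier_mat n n" "sym_mat T" "\<And>x. x \<in> carrier_vec n \<Longrightarrow> 0 \<le> x \<bullet> (T *\<^sub>v x)" unfolding T_def
    by (rule sponge_op_factor[OF L1(1,2) L2(1,2) L1(3) L2(3) t]; assumption)+
  note Sc = pos_def_matD(1)[OF S(1)] and Sbc = pos_def_matD(1)[OF Tb_props(2)]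
  have TD: "op_bound e (T - Tb)" and SD: "op_bound (\<Delta> / (2 * tp * sqrt tp)) (S - Sb)"
    unfolding T_def S_def e_def
    by (rule sponge_op_perturbation[OF L1(1,2) L2(1,2) pos.L_props(1,2) neg.L_props(1,2) L1(3) L2(3) pos.L_props(3) neg.L_props(3) L1(4) pos.L_props(4) t D]; assumption)+
  have g0: "0 < g" using beta mu_pos by (simp add: g_def)
  have e_le: "e \<le> \<delta> * g / 60"
  proof -
    have "e \<le> \<Delta> * (C1 tp tm / 3)" unfolding e_def by (rule mult_left_mono[OF C1_ge D0])
    also have "\<dots> = \<Delta> * C1 tp tm / 3" by simp
    finally show ?thesis using Dc unfolding g_def by linarith
  qed
  have e0: "0 \<le> e" using op_bound_nonneg[OF TD] .
  have dg: "\<delta> * g \<le> g" using delta g0 by (simp add: mult_left_le_one_le)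
  \<comment> \<open>The perturbation uses at most \<open>1/60\<close> of the gap \<open>g\<close>,
    so \<open>\<sigma> \<le> \<delta> / 59\<close> and
    \<open>\<sigma> + \<sigma>\<^sup>2 \<le> 2 * \<sigma>\<close> stays below
    \<open>\<delta> / 2\<close>.\<close>
  have gap: "59 / 60 * g \<le> \<mu> - bb - e"
  proof -
    have "g \<le> \<mu> - bb" using bb_less by (simp add: g_def algebra_simps)
    thus ?thesis using e_le dg by linarith
  qed
  obtain K where K: "K \<in> carrier_mat k k" "Tb * Th = Th * K" using Tb_Th by blast
  note Thc = neg.Th_carrier neg.Th_orthonormal
  define \<sigma> where "\<sigma> = e / (\<mu> - bb - e)"
  have VT: "is_Vk T k V" using V by (simp add: T_def)
  note Vc = is_Vk_orthonormal[OF VT T(1)]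
  have sb: "op_bound \<sigma> (V - Th * (Th\<^sup>T * V))" unfolding \<sigma>_def
    by (rule is_Vk_davis_kahan[OF T(1,2) Tb_props(5,6) Thc K Tb_low Tb_up T(3) TD bb_nonneg _ VT]) (use gap g0 in auto)
  have s_le: "\<sigma> \<le> \<delta> / 59"
  proof -
    have "\<sigma> \<le> (\<delta> * g / 60) / (59 / 60 * g)" unfolding \<sigma>_def using e_le gap g0 e0 delta by (intro frac_le) auto
    also have "\<dots> = \<delta> / 59" using g0 by simp
    finally show ?thesis .
  qed
  have s0: "0 \<le> \<sigma>" using op_bound_nonneg[OF sb] .
  have s1: "\<sigma> < 1" using s_le delta by linarith
  obtain Q0 where Q0: "orth_mat k Q0" "op_bound (\<sigma> + \<sigma>\<^sup>2) (V - Th * Q0)"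
    using procrustes_alignment[OF Thc Vc sb s1] by metis
  have "\<sigma>\<^sup>2 \<le> \<sigma>" using s0 s1 by (simp add: power2_eq_square mult_left_le)
  hence VQ0: "op_bound (\<delta> / 2) (V - Th * Q0)" using op_bound_mono[OF Q0(2)] s_le delta by simp
  obtain R where R: "orth_mat k R" "Vb = Th * R" using Vk_population[OF Vb] by metis
  note Rc = orth_mat_transpose[OF R(1)] and Q0c = orth_mat_transpose[OF Q0(1)]
  define Q where "Q = R\<^sup>T * Q0"
  have tR: "R\<^sup>T \<in> carrier_mat k k" using Rc by simp
  have Qc: "Q \<in> carrier_mat k k" using tR Q0c by (simp add: Q_def)
  have "Q\<^sup>T * Q = (Q0\<^sup>T * R) * (R\<^sup>T * Q0)"
    unfolding Q_def transpose_mult[OF tR Q0c(1)] by simp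
  also have "\<dots> = Q0\<^sup>T * ((R * R\<^sup>T) * Q0)"
    using Rc(1) tR Q0c(1) by (simp add: assoc_mult_mat[of _ k k _ k _ k] mult_carrier_mat[of _ k k _ k])
  also have "\<dots> = 1\<^sub>m k" unfolding Rc(3) using Q0c by simp
  finally have Qo: "orth_mat k Q" using Qc by (simp add: orth_mat_def)
  have RQ: "R * Q = Q0"
    unfolding Q_def using assoc_mult_mat[OF Rc(1) tR Q0c(1)] Rc(3) Q0c(1) by simp
  have VbQ: "Vb * Q = Th * Q0" unfolding R(2) using assoc_mult_mat[OF Thc(1) Rc(1) Qc] RQ by simp
  have TQ: "Th * Q0 \<in> carrier_mat n k" using Thc Q0c by simp
  note Vbc = is_Vk_orthonormal[OF Vb Tb_props(5)]
  have b1: "op_bound (\<delta> / 2) (V - Vb * Q)" using VQ0 by (simp only: VbQ)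
  have "op_bound (1 * 1) (Th * Q0)"
    by (rule op_bound_mult[OF op_bound_orthonormal[OF Thc] op_bound_orthonormal[OF Q0c(1,2)] Thc(1) Q0c(1)])
  hence b2: "op_bound 1 (Vb * Q)" by (simp only: VbQ mult_1)
  have VbQc: "Vb * Q \<in> carrier_mat n k" unfolding VbQ by (rule TQ)
  have "op_bound (1 / sqrt tp * (\<delta> / 2) + \<Delta> / (2 * tp * sqrt tp) * 1) (S * (V - Vb * Q) + (S - Sb) * (Vb * Q))"
  proof (rule op_bound_add)
    show "op_bound (1 / sqrt tp * (\<delta> / 2)) (S * (V - Vb * Q))"
      by (rule op_bound_mult[OF S(2) b1 Sc minus_carrier_mat[OF VbQc]])
    show "op_bound (\<Delta> / (2 * tp * sqrt tp) * 1) ((S - Sb) * (Vb * Q))"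
      by (rule op_bound_mult[OF SD b2 minus_carrier_mat[OF Sbc] VbQc])
    show "S * (V - Vb * Q) \<in> carrier_mat n k" by (rule mult_carrier_mat[OF Sc minus_carrier_mat[OF VbQc]])
    show "(S - Sb) * (Vb * Q) \<in> carrier_mat n k" by (rule mult_carrier_mat[OF minus_carrier_mat[OF Sbc] VbQc])
  qed
  moreover have "S * (V - Vb * Q) + (S - Sb) * (Vb * Q) = Gk L2 tp V - Gk Lm tp Vb * Q"
  proof -
    have G: "Gk L2 tp V = S * V" "Gk Lm tp Vb = Sb * Vb" using L2(1) neg.L_props(1) by (auto simp: Gk_def S_def)
    have "Sb * Vb * Q = Sb * (Vb * Q)" by (rule assoc_mult_mat[OF Sbc Vbc(1) Qc])
    moreover have "S * (V - Vb * Q) = S * V - S * (Vb * Q)" by (rule mult_minus_distrib_mat[OF Sc Vc(1) VbQc])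
    moreover have "(S - Sb) * (Vb * Q) = S * (Vb * Q) - Sb * (Vb * Q)" by (rule minus_mult_distrib_mat[OF Sc Sbc VbQc])
    moreover have "S * V \<in> carrier_mat n k" "S * (Vb * Q) \<in> carrier_mat n k" "Sb * (Vb * Q) \<in> carrier_mat n k"
      by (rule mult_carrier_mat[OF Sc Vc(1)], rule mult_carrier_mat[OF Sc VbQc], rule mult_carrier_mat[OF Sbc VbQc])
    moreover have "(a - b) + (b - c) = a - c" if "a \<in> carrier_mat n k" "b \<in> carrier_mat n k" "c \<in> carrier_mat n k" for a b c :: "real mat"
      using that by (intro eq_matI) auto
    ultimately show ?thesis unfolding G by metis
  qed
  ultimately have "spec_norm (Gk L2 tp V - Gk Lm tp Vb * Q) \<le> 1 / sqrt tp * (\<delta> / 2) + \<Delta> / (2 * tp * sqrt tp) * 1"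
    using spec_norm_le by metis
  also have "\<dots> \<le> \<delta> / sqrt tp + \<delta> / tp ^ 2"
  proof -
    have sp: "0 < sqrt tp" using t by simp
    have "\<Delta> / (2 * tp * sqrt tp) \<le> \<delta> / (2 * tp * sqrt tp)" using Dd t by (intro divide_right_mono) auto
    \<comment> \<open>Half of \<open>\<delta> / sqrt tp\<close> is already taken by the eigenvector
      error. If \<open>tp \<ge> 1\<close>, the other half suffices; if \<open>tp < 1\<close>, then
      \<open>tp \<le> sqrt tp\<close> and the term \<open>\<delta> / tp ^ 2\<close>
      suffices.\<close>
    also have "\<dots> \<le> \<delta> / (2 * sqrt tp) + \<delta> / tp ^ 2"
    proof (cases "1 \<le> tp")
      case True
      have "\<delta> / (2 * tp * sqrt tp) \<le> \<delta> / (2 * sqrt tp)"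
        using True delta sp by (intro divide_left_mono) auto
      moreover have "0 \<le> \<delta> / tp ^ 2" using delta by simp
      ultimately show ?thesis by linarith
    next
      case False
      have "tp = sqrt tp * sqrt tp" using t by simp
      also have "\<dots> \<le> sqrt tp * 1" using False t by (intro mult_left_mono) auto
      finally have "tp * tp \<le> tp * sqrt tp" using t by (intro mult_left_mono) auto
      also have "\<dots> \<le> 2 * tp * sqrt tp" using t by simp
      finally have "tp ^ 2 \<le> 2 * tp * sqrt tp" by (simp add: power2_eq_square)
      hence "\<delta> / (2 * tp * sqrt tp) \<le> \<delta> / tp ^ 2" using delta t by (intro divide_left_mono) auto
      moreover have "0 \<le> \<delta> / (2 * sqrt tp)" using delta t by simp
      ultimately show ?thesis by linarith
    qed
    finally show ?thesis by (simp add: field_simps)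
  qed
  finally have "spec_norm (Gk L2 tp V - Gk Lm tp Vb * Q) \<le> \<delta> / sqrt tp + \<delta> / tp ^ 2" .
  moreover have "spec_norm (V - Vb * Q) \<le> \<delta>" using spec_norm_le[OF b1] delta by linarith
  ultimately show ?thesis using Qo by blast
qed

text \<open>Used to derive \<open>\<Delta> \<le> \<delta>\<close>. The bound on \<open>tm\<close>
  keeps \<open>(1 - \<beta>) * (1 + tm)\<close> below 2, so the left side is at most
  \<open>2 / (2 + tp)\<close>, which the last summand of \<open>C1\<close>, equal to
  \<open>3 / tp\<close>, dominates.\<close>

lemma g_le_C1: "(1 - \<beta>) * \<mu> \<le> C1 tp tm"
proof -
  have t: "0 < tp" "0 \<le> tm" using basic by auto
  define u where "u = s * (1 - 2 * \<eta>) / (s * (1 - 2 * \<eta>) + 2 * \<eta>)"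
  have "u = A / (A + h)" by (simp add: u_def A_def h_def)
  hence u: "0 < u" "u \<le> 1" using A_pos h0 by auto
  have "tm < \<beta> / 2 * u * min (1 / (4 * (1 - \<beta>))) (tp / 8)" using tm_less by (simp add: u_def)
  also have "\<dots> \<le> \<beta> / 2 * u * (1 / (4 * (1 - \<beta>)))" by (rule mult_left_mono[OF min.cobounded1]) (use beta u in simp)
  finally have "tm < \<beta> / 2 * u / (4 * (1 - \<beta>))" by simp
  hence 1: "tm * (4 * (1 - \<beta>)) < \<beta> / 2 * u" using beta by (subst (asm) pos_less_divide_eq) auto
  have 2: "\<beta> * u \<le> 1" using mult_mono[of \<beta> 1 u 1] beta u by simp
  have "(1 - \<beta>) * (1 + tm) = (1 - \<beta>) + tm * (4 * (1 - \<beta>)) / 4" by (simp add: field_simps)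
  also have "\<dots> \<le> 2" using 1 2 beta by simp
  finally have "(1 - \<beta>) * (1 + tm) \<le> 2" .
  hence "(1 - \<beta>) * \<mu> \<le> 2 / (2 + tp)" using divide_right_mono[of "(1 - \<beta>) * (1 + tm)" 2 "2 + tp"] t by (simp add: \<mu>_def)
  also have "\<dots> \<le> 3 / tp" using t by (simp add: field_simps)
  also have "\<dots> = 3 * tp / tp ^ 2" using t by (simp add: power2_eq_square)
  also have "\<dots> \<le> C1 tp tm" unfolding C1_def using t by (intro divide_right_mono) auto
  finally show ?thesis .
qed

end

section \<open>Laws of the positive and negative parts of the signed graph\<close>

definition adj :: "nat \<Rightarrow> (nat \<times> nat \<Rightarrow> real) \<Rightarrow> real mat" where
  "adj n X = Matrix.mat n n (\<lambda>(i,j). if i < j then X (i,j) else if j < i then X (j,i) else 0)"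

definition edge_law :: "nat \<Rightarrow> (nat \<Rightarrow> nat) \<Rightarrow> real \<Rightarrow> real \<Rightarrow> (nat \<times> nat \<Rightarrow> real) pmf" where
  "edge_law n cl p \<eta> = Pi_pmf (Ed n) 0 (\<lambda>e. edge_pmf p \<eta> (cl (fst e) = cl (snd e)))"

lemma ssbm_pmf_eq: "ssbm_pmf n cl p \<eta> = map_pmf (adj n) (edge_law n cl p \<eta>)"
  by (simp add: ssbm_pmf_def adj_def[abs_def] edge_law_def Ed_def case_prod_beta')

lemma adj_index: "i < n \<Longrightarrow> j < n \<Longrightarrow> adj n X $$ (i,j) = (if i = j then 0 else X (edge i j))"
  by (auto simp: adj_def edge_def min_def max_def)

lemma adj_carrier [simp]: "adj n X \<in> carrier_mat n n" by (simp add: adj_def)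

lemma set_edge_pmf: "set_pmf (edge_pmf p \<eta> same) \<subseteq> {0, 1, -1}"
  by (auto simp: edge_pmf_def split: if_splits)

lemma expectation_edge_pmf:
  assumes "0 \<le> p" "p \<le> 1" "0 \<le> \<eta>" "\<eta> \<le> 1"
  shows "measure_pmf.expectation (edge_pmf p \<eta> same) (h :: real \<Rightarrow> real) =
    p * (\<eta> * h (if same then -1 else 1) + (1 - \<eta>) * h (if same then 1 else -1)) + (1 - p) * h 0"
proof -
  have fin: "finite (set_pmf (bernoulli_pmf \<eta> \<bind> (\<lambda>f. return_pmf (if e then (if same then 1 else -1) * (if f then -1 else 1) else (0::real)))))" for e
    by (rule finite_subset[of _ "{0,1,-1}"]) (auto split: if_splits)
  have inner: "measure_pmf.expectation (bernoulli_pmf \<eta> \<bind> (\<lambda>f. return_pmf (g f))) h = \<eta> * h (g True) + (1 - \<eta>) * h (g False)" for g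
    by (subst pmf_expectation_bind[of "{True,False}"]) (use assms in auto)
  show ?thesis unfolding edge_pmf_def
    by (subst pmf_expectation_bind[of "{True,False}"])
       (use assms fin in \<open>auto simp: inner algebra_simps\<close>)
qed

text \<open>The condition \<open>(c = 1) = same\<close> says that \<open>c\<close> is the sign
  assigned before the noise, so a present edge carries it with probability
  \<open>1 - \<eta>\<close>.\<close>

lemma map_edge_pmf:
  assumes "0 \<le> p" "p \<le> 1" "0 \<le> \<eta>" "\<eta> \<le> 1" and c: "c = 1 \<or> c = -1"
  shows "map_pmf (\<lambda>x. x = c) (edge_pmf p \<eta> same) = bernoulli_pmf (if (c = 1) = same then p * (1 - \<eta>) else p * \<eta>)"
proof -
  let ?M = "map_pmf (\<lambda>x. x = c) (edge_pmf p \<eta> same)"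
  let ?q = "if (c = 1) = same then p * (1 - \<eta>) else p * \<eta>"
  have q: "0 \<le> ?q" "?q \<le> 1" using assms mult_mono[of p 1 "1 - \<eta>" 1] mult_mono[of p 1 \<eta> 1] by auto
  have "pmf ?M True = measure_pmf.expectation ?M (\<lambda>b. of_bool b)"
    by (subst integral_measure_pmf[of "{True,False}"]) auto
  also have "\<dots> = measure_pmf.expectation (edge_pmf p \<eta> same) (\<lambda>x. of_bool (x = c))" by simp
  also have "\<dots> = ?q" using c by (auto simp: expectation_edge_pmf[OF assms(1-4)])
  finally have T: "pmf ?M True = ?q" .
  have "pmf ?M True + pmf ?M False = 1"
    using sum_pmf_eq_1[of "{True,False}" ?M] by (auto simp: UNIV_bool)
  hence F: "pmf ?M False = 1 - ?q" using T by simp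
  show ?thesis
  proof (rule pmf_eqI)
    fix b show "pmf ?M b = pmf (bernoulli_pmf ?q) b" using T F q by (cases b) simp_all
  qed
qed

lemma set_edge_law: "X \<in> set_pmf (edge_law n cl p \<eta>) \<Longrightarrow> e \<in> Ed n \<Longrightarrow> X e \<in> {0, 1, -1}"
  using set_Pi_pmf_subset'[OF finite_Ed, of n 0 "\<lambda>e. edge_pmf p \<eta> (cl (fst e) = cl (snd e))"] set_edge_pmf
  unfolding edge_law_def PiE_dflt_def by fastforce

lemma finite_edge_law: "finite (set_pmf (edge_law n cl p \<eta>))"
proof -
  have "set_pmf (edge_law n cl p \<eta>) \<subseteq> PiE_dflt (Ed n) 0 (\<lambda>_. {0, 1, -1})"
    using set_edge_law set_Pi_pmf_subset[OF finite_Ed, of n "0::real"] unfolding PiE_dflt_def edge_law_def by fastforce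
  thus ?thesis by (rule finite_subset) (auto intro!: finite_PiE_dflt)
qed

text \<open>The indicators of a fixed sign are independent across edges, so each of the two parts is
  a Bernoulli graph by itself. The parts depend on each other, which a union bound
  tolerates.\<close>

lemma sign_law:
  assumes "0 \<le> p" "p \<le> 1" "0 \<le> \<eta>" "\<eta> \<le> 1" and c: "c = 1 \<or> c = -1"
  shows "map_pmf (\<lambda>X e. X e = c) (edge_law n cl p \<eta>) =
    Pi_pmf (Ed n) False (\<lambda>e. bernoulli_pmf (if (c = 1) = (cl (fst e) = cl (snd e)) then p * (1 - \<eta>) else p * \<eta>))"
proof -
  have "map_pmf (\<lambda>X e. X e = c) (edge_law n cl p \<eta>) = map_pmf (\<lambda>X. (\<lambda>x. x = c) \<circ> X) (edge_law n cl p \<eta>)"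
    by (simp add: comp_def)
  also have "\<dots> = Pi_pmf (Ed n) False (\<lambda>e. map_pmf (\<lambda>x. x = c) (edge_pmf p \<eta> (cl (fst e) = cl (snd e))))"
    unfolding edge_law_def by (rule Pi_pmf_map[symmetric]) (use c in auto)
  finally show ?thesis unfolding map_edge_pmf[OF assms] .
qed

lemma expectation_entry:
  assumes "i < n" "j < n" "i \<noteq> j"
  shows "measure_pmf.expectation (edge_law n cl p \<eta>) (\<lambda>X. h (adj n X $$ (i,j))) =
    measure_pmf.expectation (edge_pmf p \<eta> (cl i = cl j)) (h :: real \<Rightarrow> real)"
proof -
  let ?e = "edge i j"
  have "map_pmf (\<lambda>X. X ?e) (edge_law n cl p \<eta>) = edge_pmf p \<eta> (cl (fst ?e) = cl (snd ?e))"
    unfolding edge_law_def Pi_pmf_component[OF finite_Ed] using edge_in_Ed[OF assms] by simp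
  also have "(cl (fst ?e) = cl (snd ?e)) = (cl i = cl j)" by (auto simp: edge_def min_def max_def)
  finally have "edge_pmf p \<eta> (cl i = cl j) = map_pmf (\<lambda>X. X ?e) (edge_law n cl p \<eta>)" by simp
  thus ?thesis using assms by (simp add: adj_index)
qed

text \<open>\<open>h\<close> stands for the positive or the negative part of an entry, and
  \<open>h 0 = 0\<close> makes the mean diagonal vanish. The second claim exchanges expectation and
  row sum.\<close>

lemma exp_mat_map:
  assumes h: "h 0 = (0::real)"
    and ab: "a = measure_pmf.expectation (edge_pmf p \<eta> True) h" "b = measure_pmf.expectation (edge_pmf p \<eta> False) h"
  shows "exp_mat n (ssbm_pmf n cl p \<eta>) (map_mat h) = qmat n cl a b"
    and "exp_mat n (ssbm_pmf n cl p \<eta>) (\<lambda>A. deg_mat (map_mat h A)) = deg_mat (qmat n cl a b)"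
proof -
  have ent: "measure_pmf.expectation (edge_law n cl p \<eta>) (\<lambda>X. h (adj n X $$ (i,j))) = qmat n cl a b $$ (i,j)" if "i < n" "j < n" for i j
  proof (cases "i = j")
    case True thus ?thesis using that h by (simp add: adj_index qmat_def)
  next
    case False
    thus ?thesis unfolding expectation_entry[OF that False] using that by (simp add: qmat_def ab)
  qed
  have idx: "map_mat h (adj n X) $$ (i,j) = h (adj n X $$ (i,j))" if "i < n" "j < n" for X i j
    using that carrier_matD[OF adj_carrier] by simp
  have dims: "dim_row (adj n X) = n" "dim_col (adj n X) = n" for X using carrier_matD[OF adj_carrier] by auto
  show "exp_mat n (ssbm_pmf n cl p \<eta>) (map_mat h) = qmat n cl a b"
  proof (rule eq_matI)
    fix i j assume "i < dim_row (qmat n cl a b)" "j < dim_col (qmat n cl a b)"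
    hence ij: "i < n" "j < n" by (auto simp: qmat_def)
    have "exp_mat n (ssbm_pmf n cl p \<eta>) (map_mat h) $$ (i,j) = measure_pmf.expectation (edge_law n cl p \<eta>) (\<lambda>X. map_mat h (adj n X) $$ (i,j))"
      using ij by (simp add: exp_mat_def ssbm_pmf_eq)
    thus "exp_mat n (ssbm_pmf n cl p \<eta>) (map_mat h) $$ (i,j) = qmat n cl a b $$ (i,j)"
      using ent[OF ij] by (simp only: idx[OF ij])
  qed (auto simp: exp_mat_def qmat_def)
  show "exp_mat n (ssbm_pmf n cl p \<eta>) (\<lambda>A. deg_mat (map_mat h A)) = deg_mat (qmat n cl a b)"
  proof (rule eq_matI)
    fix i j assume "i < dim_row (deg_mat (qmat n cl a b))" "j < dim_col (deg_mat (qmat n cl a b))"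
    hence ij: "i < n" "j < n" by (auto simp: qmat_def deg_mat_def mat_diag_def)
    have dg: "deg_mat (map_mat h (adj n X)) $$ (i,j) = (if i = j then \<Sum>j'<n. h (adj n X $$ (i,j')) else 0)" for X
      using ij by (auto simp: deg_mat_def mat_diag_def dims)
    have "exp_mat n (ssbm_pmf n cl p \<eta>) (\<lambda>A. deg_mat (map_mat h A)) $$ (i,j) = measure_pmf.expectation (edge_law n cl p \<eta>) (\<lambda>X. deg_mat (map_mat h (adj n X)) $$ (i,j))"
      using ij by (simp add: exp_mat_def ssbm_pmf_eq)
    also have "\<dots> = (if i = j then \<Sum>j'<n. measure_pmf.expectation (edge_law n cl p \<eta>) (\<lambda>X. h (adj n X $$ (i,j'))) else 0)"
      unfolding dg by (auto intro!: Bochner_Integration.integral_sum integrable_measure_pmf_finite finite_edge_law)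
    also have "\<dots> = (if i = j then \<Sum>j'<n. qmat n cl a b $$ (i,j') else 0)"
      using ij by (auto intro!: sum.cong simp: ent)
    also have "\<dots> = deg_mat (qmat n cl a b) $$ (i,j)"
      using ij by (auto simp: deg_mat_def mat_diag_def qmat_def)
    finally show "exp_mat n (ssbm_pmf n cl p \<eta>) (\<lambda>A. deg_mat (map_mat h A)) $$ (i,j) = deg_mat (qmat n cl a b) $$ (i,j)" .
  qed (auto simp: exp_mat_def qmat_def deg_mat_def mat_diag_def)
qed

lemma Lbar_eq_blap:
  assumes "0 \<le> p" "p \<le> 1" "0 \<le> \<eta>" "\<eta> \<le> 1"
  shows "Lbar_pos n cl p \<eta> = blap n cl (p * (1 - \<eta>)) (p * \<eta>)"
    and "Lbar_neg n cl p \<eta> = blap n cl (p * \<eta>) (p * (1 - \<eta>))"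
proof -
  have pp: "pos_part = map_mat (\<lambda>x. max x 0)" "neg_part = map_mat (\<lambda>x. max (- x) 0)"
    by (auto simp: pos_part_def neg_part_def fun_eq_iff)
  let ?a = "p * (1 - \<eta>)" and ?b = "p * \<eta>"
  have "?a = measure_pmf.expectation (edge_pmf p \<eta> True) (\<lambda>x. max x 0)" "?b = measure_pmf.expectation (edge_pmf p \<eta> False) (\<lambda>x. max x 0)"
    "?b = measure_pmf.expectation (edge_pmf p \<eta> True) (\<lambda>x. max (- x) 0)" "?a = measure_pmf.expectation (edge_pmf p \<eta> False) (\<lambda>x. max (- x) 0)"
    by (auto simp: expectation_edge_pmf[OF assms])
  note e = exp_mat_map[OF _ this(1,2), of n cl] exp_mat_map[OF _ this(3,4), of n cl]
  show "Lbar_pos n cl p \<eta> = blap n cl ?a ?b"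
    unfolding Lbar_pos_def blap_def pp using e(1,2) by simp
  show "Lbar_neg n cl p \<eta> = blap n cl ?b ?a"
    unfolding Lbar_neg_def blap_def pp using e(3,4) by simp
qed

text \<open>Stated on the support, because elsewhere an edge variable may differ from 0, 1 and
  -1.\<close>

lemma sign_part_graph:
  assumes "X \<in> set_pmf (edge_law n cl p \<eta>)"
  shows "pos_part (adj n X) = graph_mat n (\<lambda>e. X e = 1)" "neg_part (adj n X) = graph_mat n (\<lambda>e. X e = -1)"
proof -
  have dims: "dim_row (adj n X) = n" "dim_col (adj n X) = n" using carrier_matD[OF adj_carrier] by auto
  have X: "X (edge i j) = 0 \<or> X (edge i j) = 1 \<or> X (edge i j) = -1" if "i < n" "j < n" "i \<noteq> j" for i j
    using set_edge_law[OF assms edge_in_Ed[OF that]] by simp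
  show "pos_part (adj n X) = graph_mat n (\<lambda>e. X e = 1)"
  proof (rule eq_matI)
    fix i j assume "i < dim_row (graph_mat n (\<lambda>e. X e = 1))" "j < dim_col (graph_mat n (\<lambda>e. X e = 1))"
    hence ij: "i < n" "j < n" by (auto simp: graph_mat_def edge_mat_def)
    thus "pos_part (adj n X) $$ (i,j) = graph_mat n (\<lambda>e. X e = 1) $$ (i,j)"
      using X[OF ij] by (cases "i = j") (auto simp: pos_part_def dims adj_index graph_mat_def edge_mat_def)
  qed (auto simp: pos_part_def dims graph_mat_def edge_mat_def)
  show "neg_part (adj n X) = graph_mat n (\<lambda>e. X e = -1)"
  proof (rule eq_matI)
    fix i j assume "i < dim_row (graph_mat n (\<lambda>e. X e = -1))" "j < dim_col (graph_mat n (\<lambda>e. X e = -1))"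
    hence ij: "i < n" "j < n" by (auto simp: graph_mat_def edge_mat_def)
    thus "neg_part (adj n X) $$ (i,j) = graph_mat n (\<lambda>e. X e = -1) $$ (i,j)"
      using X[OF ij] by (cases "i = j") (auto simp: neg_part_def dims adj_index graph_mat_def edge_mat_def)
  qed (auto simp: neg_part_def dims graph_mat_def edge_mat_def)
qed

lemma graph_lap_props:
  fixes n :: nat
  defines "L \<equiv> \<lambda>Z. lap_sym (deg_mat (graph_mat n Z)) (graph_mat n Z)"
  shows "L Z \<in> carrier_mat n n" "sym_mat (L Z)" "x \<in> carrier_vec n \<Longrightarrow> 0 \<le> x \<bullet> (L Z *\<^sub>v x)" "op_bound 2 (L Z)"
proof -
  have nn: "0 \<le> graph_mat n Z $$ (i,j)" if "i < n" "j < n" for i j using that by (simp add: graph_mat_def edge_mat_def)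
  show "L Z \<in> carrier_mat n n" unfolding L_def by (rule lap_sym_deg_mat_props(1)[OF graph_mat_carrier graph_mat_sym nn])
  show "sym_mat (L Z)" unfolding L_def by (rule lap_sym_deg_mat_props(2)[OF graph_mat_carrier graph_mat_sym nn])
  show "x \<in> carrier_vec n \<Longrightarrow> 0 \<le> x \<bullet> (L Z *\<^sub>v x)" unfolding L_def by (rule lap_sym_deg_mat_props(3)[OF graph_mat_carrier graph_mat_sym nn])
  show "op_bound 2 (L Z)" unfolding L_def by (rule lap_sym_deg_mat_props(4)[OF graph_mat_carrier graph_mat_sym nn])
qed

lemma graph_lap_concentration:
  fixes a b :: real
  assumes ab: "0 \<le> a" "a \<le> 1" "0 \<le> b" "b \<le> 1"
    and L: "1 \<le> L" and r: "9 \<le> \<rho>"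
    and d: "\<And>i. i < n \<Longrightarrow> \<rho> * L / 2 \<le> bdeg n cl a b (cl i)"
  shows "measure_pmf.prob (Pi_pmf (Ed n) False (\<lambda>e. bernoulli_pmf (if cl (fst e) = cl (snd e) then a else b)))
     {Z. \<not> op_bound (20 / sqrt \<rho>) (lap_sym (deg_mat (graph_mat n Z)) (graph_mat n Z) - blap n cl a b)} \<le> 3 * real n * exp (- L)"
proof -
  define q where "q i j = (if cl i = cl j then a else b)" for i j
  have eq: "edge_mat n q = qmat n cl a b" by (auto simp: edge_mat_def qmat_def q_def intro!: eq_matI)
  interpret bern_graph n q "\<rho> * L / 2" "\<lambda>i. bdeg n cl a b (cl i)"
    by unfold_locales (use ab L r d in \<open>auto simp: q_def eq row_sum_qmat\<close>)
  have PP: "P = Pi_pmf (Ed n) False (\<lambda>e. bernoulli_pmf (if cl (fst e) = cl (snd e) then a else b))"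
    by (simp add: P_def q_def)
  have "op_bound (20 / sqrt \<rho>) (lap_sym (deg_mat (graph_mat n Z)) (graph_mat n Z) - blap n cl a b)"
    if "op_bound (20 / sqrt \<rho>) (nadj n (row_sum (graph_mat n Z)) (graph_mat n Z) - nadj n (\<lambda>i. bdeg n cl a b (cl i)) (edge_mat n q))" for Z
  proof -
    let ?N = "nadj n (row_sum (graph_mat n Z)) (graph_mat n Z)" and ?Q = "nadj n (\<lambda>i. bdeg n cl a b (cl i)) (edge_mat n q)"
    have "blap n cl a b = 1\<^sub>m n - ?Q" unfolding blap_def lap_sym_deg_mat[OF qmat_carrier] eq
      by (rule arg_cong[where f = "\<lambda>N. 1\<^sub>m n - N"], rule nadj_cong, rule row_sum_qmat)
    moreover have "lap_sym (deg_mat (graph_mat n Z)) (graph_mat n Z) = 1\<^sub>m n - ?N" by (rule lap_sym_deg_mat[OF graph_mat_carrier])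
    moreover have "(1\<^sub>m n - ?N) - (1\<^sub>m n - ?Q) = ?Q - ?N" by (intro eq_matI) (auto simp: nadj_def)
    moreover have "op_bound (20 / sqrt \<rho>) (?Q - ?N)" by (rule op_bound_diff_commute[OF that nadj_carrier nadj_carrier])
    ultimately show ?thesis by metis
  qed
  hence "measure_pmf.prob P {Z. \<not> op_bound (20 / sqrt \<rho>) (lap_sym (deg_mat (graph_mat n Z)) (graph_mat n Z) - blap n cl a b)}
    \<le> measure_pmf.prob P {Z. \<not> op_bound (20 / sqrt \<rho>) (nadj n (row_sum (graph_mat n Z)) (graph_mat n Z) - nadj n (\<lambda>i. bdeg n cl a b (cl i)) (edge_mat n q))}"
    by (intro measure_pmf.finite_measure_mono) auto
  also have "\<dots> \<le> 3 * real n * exp (- L)" by (rule lap_concentration[OF L r refl])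
  finally show ?thesis unfolding PP .
qed

section \<open>Degree thresholds and the failure probability\<close>

context sponge
begin

text \<open>The number \<open>1 / C2\<close> lies below both degree constants, so
  \<open>p n / (2 C2)\<close> is a common lower bound for the expected degrees of both
  graphs.\<close>

lemma C2_bounds: "0 < C2 s \<eta> l" "1 / C2 s \<eta> l \<le> A + h" "1 / C2 s \<eta> l \<le> 1 - l"
proof -
  have Ah: "0 < A + h" using A_pos h0 by linarith
  have l0: "0 < 1 - l" using l_less by simp
  have 1: "1 / (A + h) \<le> C2 s \<eta> l" by (simp add: C2_def A_def h_def)
  have "1 / (1 - l) \<le> 2 / (1 - l)" using l0 by (intro divide_right_mono) auto
  hence 2: "1 / (1 - l) \<le> C2 s \<eta> l" unfolding C2_def by linarith
  show 0: "0 < C2 s \<eta> l" by (rule less_le_trans[OF _ 1]) (use Ah in simp)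
  show "1 / C2 s \<eta> l \<le> A + h" using 1 0 Ah by (simp add: field_simps)
  show "1 / C2 s \<eta> l \<le> 1 - l" using 2 0 l0 by (simp add: field_simps)
qed

lemma sample_probability:
  assumes eps: "0 < \<epsilon>" "\<epsilon> < 1" and delta: "0 < \<delta>" "\<delta> < 1"
    and pc: "10 ^ 8 * C2 s \<eta> l * (ln (4 * real n / \<epsilon>) / real n) \<le> p"
    and pd: "256 * C1 tp tm ^ 4 * (2 + tp) ^ 4 / (\<delta> ^ 4 * (1 + tm) ^ 4 * (1 - \<beta>) ^ 4) * C2 s \<eta> l
       * (ln (4 * real n / \<epsilon>) / real n) \<le> p"
  shows "1 - 2 * \<epsilon> \<le> measure_pmf.prob (ssbm_pmf n cl p \<eta>)
    {A. \<forall>V Vb. is_Vk (sponge_op (Lsym_pos A) (Lsym_neg A) tp tm) k V \<and> is_Vk Tb k Vb \<longrightarrow>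
       (\<exists>Q. orth_mat k Q \<and> spec_norm (V - Vb * Q) \<le> \<delta> \<and>
          spec_norm (Gk (Lsym_neg A) tp V - Gk Lm tp Vb * Q) \<le> \<delta> / sqrt tp + \<delta> / tp ^ 2)}"
    (is "_ \<le> measure_pmf.prob _ ?good")
proof -
  define L where "L = ln (4 * real n / \<epsilon>)"
  define C where "C = C2 s \<eta> l"
  \<comment> \<open>\<open>\<rho>\<close> measures degrees in units of \<open>L\<close>: the common
    lower bound of the expected degrees is \<open>\<rho> * L / 2\<close>, and lower bounds on
    \<open>p\<close> become lower bounds on \<open>\<rho>\<close>.\<close>
  define \<rho> where "\<rho> = real n * p / (C * L)"
  have n0: "0 < real n" "2 \<le> real n" using basic(1) by simp_all
  have C0: "0 < C" using C2_bounds(1) by (simp add: C_def)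
  have p01: "0 \<le> p" "p \<le> 1" "0 \<le> \<eta>" "\<eta> \<le> 1" "0 < p" using basic by auto
  have "8 \<le> 4 * real n" using n0 by simp
  also have "\<dots> \<le> 4 * real n / \<epsilon>" using eps n0 by (simp add: le_divide_eq)
  finally have e8: "8 \<le> 4 * real n / \<epsilon>" .
  have "exp 1 \<le> 4 * real n / \<epsilon>" using e8 exp_le by linarith
  hence L1: "1 \<le> L" unfolding L_def using e8 by (subst ln_ge_iff) auto
  have expL: "exp (- L) = \<epsilon> / (4 * real n)" unfolding L_def using n0 eps by (simp add: exp_minus field_simps)
  \<comment> \<open>Its fourth power is the coefficient of \<open>C2\<close> in
    \<open>pd\<close>.\<close>
  define y where "y = 4 * C1 tp tm * (2 + tp) / (\<delta> * (1 + tm) * (1 - \<beta>))"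
  define g where "g = (1 - \<beta>) * \<mu>"
  have g0: "0 < g" using beta mu_pos by (simp add: g_def)
  have C1g: "g \<le> C1 tp tm" using g_le_C1 by (simp add: g_def)
  have C10: "0 < C1 tp tm" using g0 C1g by linarith
  have yg: "y = 4 * C1 tp tm / (\<delta> * g)"
    unfolding y_def g_def \<mu>_def using basic(8) by (simp add: mult_ac)
  have y0: "0 < y" unfolding yg using C10 g0 delta by simp
  have CL: "0 < C * L" using C0 L1 by simp
  have r_ge: "x \<le> \<rho>" if "x * C * (L / real n) \<le> p" for x
  proof -
    have "x * (C * L) \<le> real n * p" using that n0 by (simp add: field_simps)
    thus ?thesis unfolding \<rho>_def using CL by (simp add: le_divide_eq)
  qed
  have r1: "10 ^ 8 \<le> \<rho>" using r_ge pc by (simp only: L_def C_def)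
  have "y ^ 4 = 256 * C1 tp tm ^ 4 * (2 + tp) ^ 4 / (\<delta> ^ 4 * (1 + tm) ^ 4 * (1 - \<beta>) ^ 4)"
    unfolding y_def by (simp only: power_divide power_mult_distrib) simp
  hence r2: "y ^ 4 \<le> \<rho>" using r_ge pd by (simp only: L_def C_def)
  have r0: "0 < \<rho>" using r1 by simp
  \<comment> \<open>Geometric mean of the lower bounds \<open>10 ^ 8\<close> and
    \<open>y ^ 4\<close>; the second alone gives only \<open>y\<^sup>2\<close>, which need not
    exceed \<open>100 * y\<close>.\<close>
  have sq: "100 * y \<le> sqrt \<rho>"
  proof (rule real_le_rsqrt)
    have "(10 ^ 4 * y ^ 2) ^ 2 = 10 ^ 8 * y ^ 4" by (simp add: power_mult_distrib)
    also have "\<dots> \<le> \<rho> * \<rho>" using r1 r2 by (intro mult_mono) auto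
    finally have "(10 ^ 4 * y ^ 2) ^ 2 \<le> \<rho> ^ 2" by (simp add: power2_eq_square)
    hence "10 ^ 4 * y ^ 2 \<le> \<rho>" by (rule power2_le_imp_le) (use r0 in simp)
    thus "(100 * y)\<^sup>2 \<le> \<rho>" by (simp add: power_mult_distrib)
  qed
  define \<Delta> where "\<Delta> = 20 / sqrt \<rho>"
  \<comment> \<open>The factor 100 is chosen to give
    \<open>\<Delta> * C1 tp tm / 3 \<le> \<delta> * g / 60\<close>, the share of the gap that the
    deterministic estimate allows.\<close>
  have D_le: "\<Delta> \<le> \<delta> * g / (20 * C1 tp tm)"
  proof -
    have "\<Delta> \<le> 20 / (100 * y)" unfolding \<Delta>_def using sq y0 r0 by (intro divide_left_mono) auto
    also have "\<dots> = \<delta> * g / (20 * C1 tp tm)" unfolding yg using C10 g0 delta by (simp add: divide_simps)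
    finally show ?thesis .
  qed
  have Dd: "\<Delta> \<le> \<delta>"
  proof -
    have "\<delta> * g \<le> \<delta> * (20 * C1 tp tm)" using C1g C10 delta by (intro mult_left_mono) auto
    hence "\<delta> * g / (20 * C1 tp tm) \<le> \<delta>" using C10 by (simp add: divide_le_eq)
    thus ?thesis using D_le by linarith
  qed
  have Dc: "\<Delta> * C1 tp tm / 3 \<le> \<delta> * ((1 - \<beta>) * \<mu>) / 60"
  proof -
    have "\<Delta> * C1 tp tm \<le> \<delta> * g / (20 * C1 tp tm) * C1 tp tm" using D_le C10 by (intro mult_right_mono) auto
    also have "\<dots> = \<delta> * g / 20" using C10 by simp
    finally show ?thesis unfolding g_def by simp
  qed
  have dm: "\<rho> * L / 2 = p * real n * (1 / C) / 2" unfolding \<rho>_def using L1 C0 by simp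
  have dpos: "\<rho> * L / 2 \<le> bdeg n cl (p * (1 - \<eta>)) (p * \<eta>) (cl i)" if "i < n" for i
  proof -
    have "p * real n * (1 / C) / 2 \<le> p * real n * (A + h) / 2"
      using C2_bounds(2) p01 n0 unfolding C_def by (intro divide_right_mono mult_left_mono) auto
    thus ?thesis using pos_deg[OF pos.cl_less[OF that]] unfolding dm by linarith
  qed
  have dneg: "\<rho> * L / 2 \<le> bdeg n cl (p * \<eta>) (p * (1 - \<eta>)) (cl i)" if "i < n" for i
  proof -
    have "p * real n * (1 / C) / 2 \<le> p * real n * (1 - l) / 2"
      using C2_bounds(3) p01 n0 unfolding C_def by (intro divide_right_mono mult_left_mono) auto
    thus ?thesis using neg_deg(1)[OF pos.cl_less[OF that]] unfolding dm by linarith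
  qed
  have ab: "0 \<le> p * (1 - \<eta>)" "p * (1 - \<eta>) \<le> 1" "0 \<le> p * \<eta>" "p * \<eta> \<le> 1"
    using p01 mult_mono[of p 1 "1 - \<eta>" 1] mult_mono[of p 1 \<eta> 1] by auto
  have r9: "9 \<le> \<rho>" using r1 by simp
  let ?\<Omega> = "edge_law n cl p \<eta>"
  let ?lap = "\<lambda>Z. lap_sym (deg_mat (graph_mat n Z)) (graph_mat n Z)"
  have fail: "measure_pmf.prob ?\<Omega> {X. \<not> op_bound \<Delta> (?lap (\<lambda>e. X e = c) - blap n cl a b)} \<le> \<epsilon>"
    if c: "c = 1 \<or> c = -1"
      and ab': "a = (if c = 1 then p * (1 - \<eta>) else p * \<eta>)" "b = (if c = 1 then p * \<eta> else p * (1 - \<eta>))" for a b c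
  proof -
    let ?B = "{Z. \<not> op_bound \<Delta> (?lap Z - blap n cl a b)}"
    have "map_pmf (\<lambda>X e. X e = c) ?\<Omega> = Pi_pmf (Ed n) False (\<lambda>e. bernoulli_pmf (if cl (fst e) = cl (snd e) then a else b))"
      unfolding sign_law[OF p01(1-4) c] ab' using c by (intro Pi_pmf_cong) auto
    moreover have "measure_pmf.prob (map_pmf (\<lambda>X e. X e = c) ?\<Omega>) ?B = measure_pmf.prob ?\<Omega> {X. \<not> op_bound \<Delta> (?lap (\<lambda>e. X e = c) - blap n cl a b)}"
      by (simp add: vimage_def)
    moreover have "measure_pmf.prob (Pi_pmf (Ed n) False (\<lambda>e. bernoulli_pmf (if cl (fst e) = cl (snd e) then a else b))) ?B \<le> 3 * real n * exp (- L)"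
      unfolding \<Delta>_def by (rule graph_lap_concentration[OF _ _ _ _ L1 r9]) (use ab ab' dpos dneg c in auto)
    \<comment> \<open>By the choice of \<open>L\<close> as the logarithm of
      \<open>4 n / \<epsilon>\<close>, the left side is three quarters of
      \<open>\<epsilon>\<close>.\<close>
    moreover have "3 * real n * exp (- L) \<le> \<epsilon>" unfolding expL using n0 eps by simp
    ultimately show ?thesis by simp
  qed
  define Bp where "Bp = {X :: nat \<times> nat \<Rightarrow> real. \<not> op_bound \<Delta> (?lap (\<lambda>e. X e = 1) - Lp)}"
  define Bn where "Bn = {X :: nat \<times> nat \<Rightarrow> real. \<not> op_bound \<Delta> (?lap (\<lambda>e. X e = -1) - Lm)}"
  have Bp: "measure_pmf.prob ?\<Omega> Bp \<le> \<epsilon>" unfolding Bp_def by (rule fail) auto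
  have Bn: "measure_pmf.prob ?\<Omega> Bn \<le> \<epsilon>" unfolding Bn_def by (rule fail) auto
  have "1 - 2 * \<epsilon> \<le> 1 - measure_pmf.prob ?\<Omega> (Bp \<union> Bn)"
    using measure_Un_le[of Bp ?\<Omega> Bn] Bp Bn by simp
  also have "\<dots> = measure_pmf.prob ?\<Omega> (- (Bp \<union> Bn))"
    using measure_pmf.prob_compl[of "Bp \<union> Bn" ?\<Omega>] by (simp add: Compl_eq_Diff_UNIV)
  \<comment> \<open>The sample Laplacians are Laplacians of graphs only on the support, so the good
    event is intersected with it.\<close>
  also have "\<dots> = measure_pmf.prob ?\<Omega> (- (Bp \<union> Bn) \<inter> set_pmf ?\<Omega>)" by (simp add: measure_Int_set_pmf)
  also have "\<dots> \<le> measure_pmf.prob ?\<Omega> (adj n -` ?good)"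
  proof (intro measure_pmf.finite_measure_mono subsetI vimageI2 CollectI allI impI)
    fix X V Vb assume X: "X \<in> - (Bp \<union> Bn) \<inter> set_pmf ?\<Omega>"
    have LL: "Lsym_pos (adj n X) = ?lap (\<lambda>e. X e = 1)" "Lsym_neg (adj n X) = ?lap (\<lambda>e. X e = -1)"
      unfolding Lsym_pos_def Lsym_neg_def using sign_part_graph[of X n cl p \<eta>] X by simp_all
    have D: "op_bound \<Delta> (?lap (\<lambda>e. X e = 1) - Lp)" "op_bound \<Delta> (?lap (\<lambda>e. X e = -1) - Lm)"
      using X by (auto simp: Bp_def Bn_def)
    assume "is_Vk (sponge_op (Lsym_pos (adj n X)) (Lsym_neg (adj n X)) tp tm) k V \<and> is_Vk Tb k Vb"
    hence V: "is_Vk (sponge_op (?lap (\<lambda>e. X e = 1)) (?lap (\<lambda>e. X e = -1)) tp tm) k V" "is_Vk Tb k Vb"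
      unfolding LL by auto
    show "\<exists>Q. orth_mat k Q \<and> spec_norm (V - Vb * Q) \<le> \<delta> \<and>
          spec_norm (Gk (Lsym_neg (adj n X)) tp V - Gk Lm tp Vb * Q) \<le> \<delta> / sqrt tp + \<delta> / tp ^ 2"
      unfolding LL
      by (rule Vk_sample[OF graph_lap_props(1,2) graph_lap_props(3) graph_lap_props(4) graph_lap_props(1,2) graph_lap_props(3) D delta Dd Dc V])
  qed auto
  finally show ?thesis unfolding ssbm_pmf_eq measure_map_pmf .
qed

end

theorem mainTheorem1:
  shows "(\<forall>n k cl p \<eta> taup taum \<beta>. sponge_hyps n k cl p \<eta> taup taum \<beta> \<longrightarrow>
            (let Tbar = sponge_op (Lbar_pos n cl p \<eta>) (Lbar_neg n cl p \<eta>) taup taum;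
                 Cm = Cminus n k cl p \<eta> taup
             in pos_def_mat k Cm \<and>
                (\<forall>Vb. is_Vk Tbar k Vb \<longrightarrow>
                   (\<exists>R. orth_mat k R \<and> Vb = Theta n k cl * R \<and>
                        Gk (Lbar_neg n cl p \<eta>) taup Vb = Theta n k cl * inv_sqrt_mat Cm * R))))
       \<and>
       (\<forall>\<epsilon>::real. 0 < \<epsilon> \<and> \<epsilon> < 1 \<longrightarrow>
          (\<exists>c::real. c > 0 \<and>
             (\<forall>\<delta>::real. \<forall>n k cl p \<eta> taup taum \<beta>.
                sponge_hyps n k cl p \<eta> taup taum \<beta> \<and> 0 < \<delta> \<and> \<delta> < 1 \<and>
                p \<ge> Max {c * C2 (smin n k cl) \<eta> (lmax n k cl),
                          256 * C1 taup taum ^ 4 * (2 + taup) ^ 4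
                            / (\<delta> ^ 4 * (1 + taum) ^ 4 * (1 - \<beta>) ^ 4)
                            * C2 (smin n k cl) \<eta> (lmax n k cl),
                          81 / ((1 - lmax n k cl) * \<delta> ^ 4)}
                     * ln (4 * real n / \<epsilon>) / real n
                \<longrightarrow>
                measure_pmf.prob (ssbm_pmf n cl p \<eta>)
                  {A. let Tbar = sponge_op (Lbar_pos n cl p \<eta>) (Lbar_neg n cl p \<eta>) taup taum;
                          T = sponge_op (Lsym_pos A) (Lsym_neg A) taup taum
                      in \<forall>V Vb. is_Vk T k V \<and> is_Vk Tbar k Vb \<longrightarrow>
                           (\<exists>Q. orth_mat k Q \<and>
                                spec_norm (V - Vb * Q) \<le> \<delta> \<and>
                                spec_norm (Gk (Lsym_neg A) taup V - Gk (Lbar_neg n cl p \<eta>) taup Vb * Q)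
                                  \<le> \<delta> / sqrt taup + \<delta> / taup ^ 2)}
                \<ge> 1 - 2 * \<epsilon>)))"
proof (intro conjI allI impI, goal_cases)
  case (1 n k cl p \<eta> tp tm \<beta>)
  interpret sponge n k cl p \<eta> tp tm \<beta> by unfold_locales (rule 1)
  have L: "Lbar_pos n cl p \<eta> = Lp" "Lbar_neg n cl p \<eta> = Lm"
    using Lbar_eq_blap[of p \<eta> n cl] basic by auto
  show ?case unfolding Let_def L
    using Cm_pos_def Vk_population by metis
next
  case (2 \<epsilon>)
  hence eps: "0 < \<epsilon>" "\<epsilon> < 1" by auto
  show ?case
  proof (intro exI[of _ "10 ^ 8 :: real"] conjI allI impI, goal_cases)
    case 1
    show ?case by simp
  next
    case (2 \<delta> n k cl p \<eta> tp tm \<beta>)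
    hence hyps: "sponge_hyps n k cl p \<eta> tp tm \<beta>" and delta: "0 < \<delta>" "\<delta> < 1" by auto
    interpret sponge n k cl p \<eta> tp tm \<beta> by unfold_locales (rule hyps)
    let ?M = "Max {10 ^ 8 * C2 s \<eta> l, 256 * C1 tp tm ^ 4 * (2 + tp) ^ 4 / (\<delta> ^ 4 * (1 + tm) ^ 4 * (1 - \<beta>) ^ 4) * C2 s \<eta> l, 81 / ((1 - l) * \<delta> ^ 4)}"
    have pM: "?M * (ln (4 * real n / \<epsilon>) / real n) \<le> p" using 2 by simp
    have "2 \<le> real n" using basic(1) by simp
    hence "1 \<le> 4 * real n / \<epsilon>" using eps by (simp add: le_divide_eq)
    hence ln0: "0 \<le> ln (4 * real n / \<epsilon>) / real n" by simp
    have le: "x * (ln (4 * real n / \<epsilon>) / real n) \<le> p" if "x \<le> ?M" for x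
      using mult_right_mono[OF that ln0] pM by linarith
    have L: "Lbar_pos n cl p \<eta> = Lp" "Lbar_neg n cl p \<eta> = Lm"
      using Lbar_eq_blap[of p \<eta> n cl] basic by auto
    show ?case unfolding Let_def L
      by (rule sample_probability[OF eps delta]; rule le; rule Max_ge) simp_all
  qed
qed

end
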